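(* There exists an absolute constant $C>0$ such that, for every planar convex domain $\Omega$ normalised as in the context, with length scale $L$, first Dirichlet eigenfunction $u$, and maximum point $(x^*,y^* )$ of $u$, for all $(x,y)\in\Omega_{1/2}$, $$\left|u(x,y)-P_2^*(x,y)\right| \leq C\max\left\{L^{-3}|x-x^*|^3,\ |y-y^*|^3\right\},$$ where $P_2^*$ is the degree $2$ Taylor polynomial of $u$ at $(x^*,y^* )$: $$P_2^*(x,y) = 1 + \tfrac{1}{2} \partial_{x}^2u(x^*,y^* ) (x-x^* )^2 + \partial_{x}\partial_{y}u(x^*,y^* )(x-x^* )(y-y^* ) + \tfrac{1}{2} \partial_{y}^2u(x^*,y^* ) (y-y^* )^2.$$
   Context: Domain: $\Omega\subset\mathbb{R}^2$ is a bounded convex domain, normalised (by a rotation, dilation and translation) so that its projection onto the $y$-axis is the smallest among its projections onto all directions, and $$\Omega=\{(x,y)\in\mathbb{R}^2: x\in[a,b],\ f_1(x)\leq y\leq f_2(x)\},$$ where $f_1$ is convex and $f_2$ is concave on $[a,b]$, $\min_{[a,b]}f_1=0$ and $\max_{[a,b]}f_2=1$. No further regularity of $\partial\Omega$ is assumed. Length scale: let $h(x)=f_2(x)-f_1(x)$ (a concave function on $[a,b]$). $L$ is the largest value such that $h(x)\geq 1-L^{-2}$ for all $x\in I$, for some interval $I\subset[a,b]$ of length at least $L$. Eigenfunction: $\lambda$ is the first Dirichlet eigenvalue of $\Omega$ and $u$ the corresponding eigenfunction, $\Delta u=-\lambda u$ in $\Omega$, $u=0$ on $\partial\Omega$, normalised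 to be positive inside $\Omega$ with maximum value $1$, attained at $(x^*,y^* )$. Superlevel sets: $\Omega_c=\{(x,y)\in\Omega: u(x,y)\geq c\}$. An absolute constant is one that does not depend on $\Omega$ or $L$. *)

theory Defs
  imports "HOL-Analysis.Analysis"
begin

section \<open>Normalised planar convex domains\<close>

definition region :: "real \<Rightarrow> real \<Rightarrow> (real \<Rightarrow> real) \<Rightarrow> (real \<Rightarrow> real) \<Rightarrow> (real \<times> real) set" where
  "region a b f\<^sub>1 f\<^sub>2 = {(x, y). x \<in> {a..b} \<and> f\<^sub>1 x \<le> y \<and> y \<le> f\<^sub>2 x}"

text \<open>For a unit vector \<open>v\<close>, the length of the projection onto the line spanned by \<open>v\<close>.
  For bounded convex \<open>S\<close> the image below is a bounded interval.\<close>

definition projection_length :: "(real \<times> real) set \<Rightarrow> real \<times> real \<Rightarrow> real" where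
  "projection_length S v = measure lborel ((\<lambda>p. p \<bullet> v) ` S)"

text \<open>Continuity of \<open>f\<^sub>1\<close>, \<open>f\<^sub>2\<close> at the end points \<open>a\<close>, \<open>b\<close> is not required, so the region need not
  be closed; below, the equation is posed in its interior and the boundary condition on its
  frontier. That the interior is nonempty follows from the last condition.\<close>

definition normalised_domain :: "real \<Rightarrow> real \<Rightarrow> (real \<Rightarrow> real) \<Rightarrow> (real \<Rightarrow> real) \<Rightarrow> bool" where
  "normalised_domain a b f\<^sub>1 f\<^sub>2 \<longleftrightarrow>
     a < b \<and>
     convex_on {a..b} f\<^sub>1 \<and> concave_on {a..b} f\<^sub>2 \<and>
     (\<forall>x\<in>{a..b}. f\<^sub>1 x \<le> f\<^sub>2 x) \<and>
     (\<exists>x\<in>{a..b}. f\<^sub>1 x = 0) \<and> (\<forall>x\<in>{a..b}. 0 \<le> f\<^sub>1 x) \<and>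
     (\<exists>x\<in>{a..b}. f\<^sub>2 x = 1) \<and> (\<forall>x\<in>{a..b}. f\<^sub>2 x \<le> 1) \<and>
     (\<forall>v. norm v = 1 \<longrightarrow>
        projection_length (region a b f\<^sub>1 f\<^sub>2) (0, 1) \<le> projection_length (region a b f\<^sub>1 f\<^sub>2) v)"

text \<open>\<open>I\<close> may be open, closed or half-open. As \<open>h\<close> may be discontinuous at \<open>a\<close> and \<open>b\<close>, allowing
  only closed \<open>I\<close> could leave the largest value unattained.\<close>

definition admissible_length :: "real \<Rightarrow> real \<Rightarrow> (real \<Rightarrow> real) \<Rightarrow> real \<Rightarrow> bool" where
  "admissible_length a b h L \<longleftrightarrow>
     L > 0 \<and>
     (\<exists>I. is_interval I \<and> I \<subseteq> {a..b} \<and> measure lborel I \<ge> L \<and> (\<forall>x\<in>I. h x \<ge> 1 - 1 / L\<^sup>2))"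

definition is_length_scale :: "real \<Rightarrow> real \<Rightarrow> (real \<Rightarrow> real) \<Rightarrow> (real \<Rightarrow> real) \<Rightarrow> real \<Rightarrow> bool" where
  "is_length_scale a b f\<^sub>1 f\<^sub>2 L \<longleftrightarrow>
     admissible_length a b (\<lambda>x. f\<^sub>2 x - f\<^sub>1 x) L \<and>
     (\<forall>M. admissible_length a b (\<lambda>x. f\<^sub>2 x - f\<^sub>1 x) M \<longrightarrow> M \<le> L)"


section \<open>Partial derivatives and the Laplacian\<close>

definition dx :: "(real \<times> real \<Rightarrow> real) \<Rightarrow> real \<times> real \<Rightarrow> real" where
  "dx u p = deriv (\<lambda>s. u (s, snd p)) (fst p)"

definition dy :: "(real \<times> real \<Rightarrow> real) \<Rightarrow> real \<times> real \<Rightarrow> real" where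
  "dy u p = deriv (\<lambda>t. u (fst p, t)) (snd p)"

definition laplacian :: "(real \<times> real \<Rightarrow> real) \<Rightarrow> real \<times> real \<Rightarrow> real" where
  "laplacian u p = dx (dx u) p + dy (dy u) p"

text \<open>\<open>k\<close> times continuously differentiable; meaningful for open \<open>S\<close>.\<close>

fun Ck_on :: "nat \<Rightarrow> (real \<times> real \<Rightarrow> real) \<Rightarrow> (real \<times> real) set \<Rightarrow> bool" where
  "Ck_on 0 u S \<longleftrightarrow> continuous_on S u"
| "Ck_on (Suc k) u S \<longleftrightarrow>
     continuous_on S u \<and>
     (\<forall>p\<in>S. (\<lambda>s. u (s, snd p)) field_differentiable (at (fst p)) \<and>
            (\<lambda>t. u (fst p, t)) field_differentiable (at (snd p))) \<and>
     Ck_on k (dx u) S \<and> Ck_on k (dy u) S"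


section \<open>The first Dirichlet eigenfunction\<close>

text \<open>Classical formulation. On the bounded convex domains considered here every weak
  eigenfunction has a representative that is smooth inside and continuous up to the boundary,
  so the eigenvalues are the usual ones.\<close>

definition dirichlet_eigenfunction ::
    "(real \<times> real) set \<Rightarrow> real \<Rightarrow> (real \<times> real \<Rightarrow> real) \<Rightarrow> bool" where
  "dirichlet_eigenfunction \<Omega> \<mu> u \<longleftrightarrow>
     continuous_on (closure \<Omega>) u \<and> Ck_on 2 u (interior \<Omega>) \<and>
     (\<forall>p\<in>interior \<Omega>. laplacian u p = - \<mu> * u p) \<and>
     (\<forall>p\<in>frontier \<Omega>. u p = 0) \<and>
     (\<exists>p\<in>interior \<Omega>. u p \<noteq> 0)"

definition first_dirichlet_eigenvalue :: "(real \<times> real) set \<Rightarrow> real \<Rightarrow> bool" where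
  "first_dirichlet_eigenvalue \<Omega> \<mu> \<longleftrightarrow>
     (\<exists>u. dirichlet_eigenfunction \<Omega> \<mu> u) \<and>
     (\<forall>\<nu>. (\<exists>u. dirichlet_eigenfunction \<Omega> \<nu> u) \<longrightarrow> \<mu> \<le> \<nu>)"

definition normalised_first_eigenfunction ::
    "(real \<times> real) set \<Rightarrow> real \<Rightarrow> (real \<times> real \<Rightarrow> real) \<Rightarrow> real \<times> real \<Rightarrow> bool" where
  "normalised_first_eigenfunction \<Omega> \<mu> u p\<^sub>0 \<longleftrightarrow>
     first_dirichlet_eigenvalue \<Omega> \<mu> \<and> dirichlet_eigenfunction \<Omega> \<mu> u \<and>
     (\<forall>p\<in>interior \<Omega>. u p > 0) \<and>
     (\<forall>p\<in>\<Omega>. u p \<le> 1) \<and> p\<^sub>0 \<in> \<Omega> \<and> u p\<^sub>0 = 1"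

definition superlevel :: "(real \<times> real) set \<Rightarrow> (real \<times> real \<Rightarrow> real) \<Rightarrow> real \<Rightarrow> (real \<times> real) set" where
  "superlevel \<Omega> u c = {p \<in> \<Omega>. u p \<ge> c}"

text \<open>The second-order Taylor polynomial at a point where \<open>u\<close> equals \<open>1\<close> and has vanishing
  gradient.\<close>

definition P2 :: "(real \<times> real \<Rightarrow> real) \<Rightarrow> real \<Rightarrow> real \<Rightarrow> real \<Rightarrow> real \<Rightarrow> real" where
  "P2 u x\<^sub>0 y\<^sub>0 x y =
     1 + 1/2 * dx (dx u) (x\<^sub>0, y\<^sub>0) * (x - x\<^sub>0)\<^sup>2
       + dx (dy u) (x\<^sub>0, y\<^sub>0) * (x - x\<^sub>0) * (y - y\<^sub>0)
       + 1/2 * dy (dy u) (x\<^sub>0, y\<^sub>0) * (y - y\<^sub>0)\<^sup>2"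

end

theory Submission
  imports Defs
begin

text \<open>The proof rests on the maximum principle alone. In a strip of width \<open>1\<close> the eigenvalue \<open>\<pi>\<^sup>2\<close> is
  resonant: an error \<open>\<epsilon>\<close> on the walls may cause an error of order \<open>L\<^sup>2 \<epsilon>\<close> in the amplitude of the first
  mode. One therefore first removes that mode by the Darboux transform
  \<open>z = v\<^sub>y - \<pi> cot (\<pi> y) v\<close>, which solves \<open>\<Delta> z = (2 \<pi>\<^sup>2 / sin\<^sup>2 (\<pi> y) - \<mu>) z\<close> and hence admits
  positive constants as barriers, and then recovers \<open>v\<^sub>x\<^sub>x = - (\<mu> - \<pi>\<^sup>2) v - z\<^sub>y - \<pi> cot (\<pi> y) z\<close>.
  For the eigenfunction \<open>w\<close> itself the data on the walls are \<open>O(L\<^sup>-\<^sup>2)\<close>, so \<open>w\<^sub>x\<^sub>x = O(L\<^sup>-\<^sup>2)\<close> and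
  \<open>w\<^sub>x = O(L\<^sup>-\<^sup>1)\<close>. The walls have slope \<open>O(L\<^sup>-\<^sup>3)\<close>, so \<open>w\<^sub>x\<close> has data \<open>O(L\<^sup>-\<^sup>3)\<close> on them, and a second
  application, to \<open>v = w\<^sub>x\<close>, yields \<open>w\<^sub>x\<^sub>x\<^sub>x = O(L\<^sup>-\<^sup>3)\<close>. The other third derivatives follow from the
  equation and interior gradient estimates. Barriers also show that the maximum lies at distance at
  least a multiple of \<open>L\<close> from the places where the domain is thinner than \<open>1 - k L\<^sup>-\<^sup>2\<close>, because
  \<open>\<mu> = \<pi>\<^sup>2 + O(L\<^sup>-\<^sup>2)\<close>. For bounded \<open>L\<close> interior estimates around the maximum suffice.\<close>

section \<open>The comparison principle\<close>

definition d2_at :: "(real \<Rightarrow> real) \<Rightarrow> real \<Rightarrow> real \<Rightarrow> bool" where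
  "d2_at f x A \<longleftrightarrow>
     (\<exists>g. (\<forall>\<^sub>F s in nhds x. (f has_real_derivative g s) (at s)) \<and> (g has_real_derivative A) (at x))"

text \<open>A relation with the value as an argument: a first derivative near the point and a second
  one at it are all that the test at a maximum uses, so barriers and Darboux transforms need not be
  shown to be \<open>Ck_on 2\<close>.\<close>

definition lap_at :: "(real \<times> real \<Rightarrow> real) \<Rightarrow> real \<times> real \<Rightarrow> real \<Rightarrow> bool" where
  "lap_at v p l \<longleftrightarrow>
     (\<exists>A B. d2_at (\<lambda>s. v (s, snd p)) (fst p) A \<and> d2_at (\<lambda>t. v (fst p, t)) (snd p) B \<and> l = A + B)"

lemma d2_at_add: "d2_at f x A \<Longrightarrow> d2_at g x B \<Longrightarrow> d2_at (\<lambda>s. f s + g s) x (A + B)"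
  unfolding d2_at_def
proof (elim exE conjE)
  fix F G
  assume "\<forall>\<^sub>F s in nhds x. (f has_real_derivative F s) (at s)" "(F has_real_derivative A) (at x)"
    "\<forall>\<^sub>F s in nhds x. (g has_real_derivative G s) (at s)" "(G has_real_derivative B) (at x)"
  then show "\<exists>ga. (\<forall>\<^sub>F s in nhds x. ((\<lambda>s. f s + g s) has_real_derivative ga s) (at s)) \<and> (ga has_real_derivative A + B) (at x)"
    by (intro exI[of _ "\<lambda>s. F s + G s"] conjI)
      (auto elim: eventually_elim2 intro: DERIV_add)
qed

lemma d2_at_cmult: "d2_at f x A \<Longrightarrow> d2_at (\<lambda>s. c * f s) x (c * A)"
  unfolding d2_at_def
proof (elim exE conjE)
  fix F
  assume "\<forall>\<^sub>F s in nhds x. (f has_real_derivative F s) (at s)" "(F has_real_derivative A) (at x)"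
  then show "\<exists>ga. (\<forall>\<^sub>F s in nhds x. ((\<lambda>s. c * f s) has_real_derivative ga s) (at s)) \<and> (ga has_real_derivative c * A) (at x)"
    by (intro exI[of _ "\<lambda>s. c * F s"] conjI)
      (auto elim!: eventually_mono intro!: derivative_eq_intros)
qed

lemma d2_at_const: "d2_at (\<lambda>s. c) x 0"
  unfolding d2_at_def by (intro exI[of _ "\<lambda>s. 0"]) auto

lemma d2_atI:
  assumes "\<And>s. (f has_real_derivative g s) (at s)" "(g has_real_derivative A) (at x)"
  shows "d2_at f x A"
  unfolding d2_at_def using assms by (intro exI[of _ g]) auto

lemma d2_atI_open:
  assumes "open S" "x \<in> S" "\<And>s. s \<in> S \<Longrightarrow> (f has_real_derivative g s) (at s)"
    "(g has_real_derivative A) (at x)"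
  shows "d2_at f x A"
  unfolding d2_at_def using assms by (intro exI[of _ g]) (auto simp: eventually_nhds)

text \<open>If \<open>A\<close> were positive, the first derivative, zero at the maximum, would be
  positive just to the right of it, and the mean value theorem would produce a larger value.\<close>

lemma d2_at_local_max:
  assumes "d2_at f x A" "\<forall>\<^sub>F s in nhds x. f s \<le> f x"
  shows "A \<le> 0"
proof (rule ccontr)
  assume "\<not> A \<le> 0"
  then have A: "A > 0" by simp
  obtain g where g: "\<forall>\<^sub>F s in nhds x. (f has_real_derivative g s) (at s)" "(g has_real_derivative A) (at x)"
    using assms(1) unfolding d2_at_def by blast
  from eventually_conj[OF g(1) assms(2)] obtain e where e: "e > 0"
    "\<And>s. dist s x < e \<Longrightarrow> (f has_real_derivative g s) (at s) \<and> f s \<le> f x"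
    unfolding eventually_nhds_metric by blast
  have "g x = 0"
    using DERIV_local_max[of f "g x" x e] e by (auto simp: dist_real_def)
  obtain d where d: "d > 0" "\<And>h. 0 < h \<Longrightarrow> h < d \<Longrightarrow> g x < g (x + h)"
    using DERIV_pos_inc_right[OF g(2) A] by blast
  define h where "h = min d e / 2"
  have h: "0 < h" "h < d" "h < e" using d e unfolding h_def by (auto simp: min_def)
  obtain z where z: "x < z" "z < x + h" "f (x + h) - f x = (x + h - x) * g z"
    using MVT2[of x "x+h" f g] h e(2) by (auto simp: dist_real_def)
  have "g z > 0" using d(2)[of "z - x"] z h \<open>g x = 0\<close> by auto
  then have "f (x + h) > f x" using z h by (smt (verit) mult_pos_pos)
  then show False using e(2)[of "x + h"] h by (auto simp: dist_real_def)
qed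

lemma d2_at_affine:
  assumes "d2_at f (c * x + d) A"
  shows "d2_at (\<lambda>s. f (c * s + d)) x (c\<^sup>2 * A)"
proof -
  obtain g where g: "\<forall>\<^sub>F s in nhds (c * x + d). (f has_real_derivative g s) (at s)"
     "(g has_real_derivative A) (at (c * x + d))"
    using assms unfolding d2_at_def by blast
  have "filterlim (\<lambda>s. c * s + d) (nhds (c * x + d)) (nhds x)"
    by (intro tendsto_intros filterlim_ident)
  then have "\<forall>\<^sub>F s in nhds x. (f has_real_derivative g (c * s + d)) (at (c * s + d))"
    using g(1) by (rule eventually_compose_filterlim[rotated])
  then have 1: "\<forall>\<^sub>F s in nhds x. ((\<lambda>s. f (c * s + d)) has_real_derivative (c * g (c * s + d))) (at s)"
  proof (rule eventually_mono)
    fix s assume *: "(f has_real_derivative g (c * s + d)) (at (c * s + d))"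
    show "((\<lambda>s. f (c * s + d)) has_real_derivative (c * g (c * s + d))) (at s)"
    proof -
      have "((\<lambda>s. c * s + d) has_real_derivative c) (at s)"
        by (auto intro!: derivative_eq_intros)
      from DERIV_chain2[where f=f and g="\<lambda>s. c * s + d", OF * this]
      show ?thesis by (simp add: mult.commute)
    qed
  qed
  have 2: "((\<lambda>s. c * g (c * s + d)) has_real_derivative (c\<^sup>2 * A)) (at x)"
  proof -
    have "((\<lambda>s. c * s + d) has_real_derivative c) (at x)"
      by (auto intro!: derivative_eq_intros)
    from DERIV_cmult[OF DERIV_chain2[where f=g and g="\<lambda>s. c * s + d", OF g(2) this], of c]
    show ?thesis by (simp add: power2_eq_square ac_simps)
  qed
  show ?thesis unfolding d2_at_def using 1 2 by (intro exI[of _ "\<lambda>s. c * g (c * s + d)"]) simp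
qed

lemma lap_at_add: "lap_at v p l \<Longrightarrow> lap_at w p m \<Longrightarrow> lap_at (\<lambda>q. v q + w q) p (l + m)"
  unfolding lap_at_def
  apply (elim exE conjE)
  subgoal for A A' B B'
    by (intro exI[of _ "A + A'"] exI[of _ "B + B'"] conjI d2_at_add) auto
  done

lemma lap_at_cmult: "lap_at v p l \<Longrightarrow> lap_at (\<lambda>q. c * v q) p (c * l)"
  unfolding lap_at_def
  apply (elim exE conjE)
  subgoal for A B
    by (intro exI[of _ "c * A"] exI[of _ "c * B"] conjI d2_at_cmult) (auto simp: algebra_simps)
  done

lemma lap_at_diff: "lap_at v p l \<Longrightarrow> lap_at w p m \<Longrightarrow> lap_at (\<lambda>q. v q - w q) p (l - m)"
  using lap_at_add[OF _ lap_at_cmult[of w p m "-1"]] by auto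

lemma lap_at_minus: "lap_at v p l \<Longrightarrow> lap_at (\<lambda>q. - v q) p (- l)"
  using lap_at_cmult[of v p l "-1"] by auto

lemma lap_at_prod:
  assumes "d2_at f (fst p) A" "d2_at g (snd p) B"
  shows "lap_at (\<lambda>q. f (fst q) * g (snd q)) p (A * g (snd p) + f (fst p) * B)"
  unfolding lap_at_def
  apply (rule exI[of _ "g (snd p) * A"], rule exI[of _ "f (fst p) * B"])
  using d2_at_cmult[OF assms(1), of "g (snd p)"] d2_at_cmult[OF assms(2), of "f (fst p)"]
  by (simp add: mult.commute)

lemma lap_at_affine:
  assumes "lap_at v (\<sigma> * fst p + \<alpha>, \<rho> * snd p + \<beta>) l" "\<sigma>\<^sup>2 = 1" "\<rho>\<^sup>2 = 1"
  shows "lap_at (\<lambda>q. v (\<sigma> * fst q + \<alpha>, \<rho> * snd q + \<beta>)) p l"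
proof -
  obtain A B where AB: "d2_at (\<lambda>s. v (s, \<rho> * snd p + \<beta>)) (\<sigma> * fst p + \<alpha>) A"
    "d2_at (\<lambda>t. v (\<sigma> * fst p + \<alpha>, t)) (\<rho> * snd p + \<beta>) B" "l = A + B"
    using assms(1) unfolding lap_at_def by auto
  show ?thesis
    unfolding lap_at_def
    using d2_at_affine[OF AB(1)] d2_at_affine[OF AB(2)] assms(2,3) AB(3)
    by (intro exI[of _ A] exI[of _ B]) simp
qed

lemma lap_at_swap: "lap_at v (snd p, fst p) l \<Longrightarrow> lap_at (\<lambda>q. v (snd q, fst q)) p l"
  unfolding lap_at_def by (auto simp: add.commute)

lemma lap_at_local_max:
  assumes "lap_at v p l" "\<forall>\<^sub>F q in nhds p. v q \<le> v p"
  shows "l \<le> 0"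
proof -
  obtain A B where AB: "d2_at (\<lambda>s. v (s, snd p)) (fst p) A" "d2_at (\<lambda>t. v (fst p, t)) (snd p) B" "l = A + B"
    using assms(1) unfolding lap_at_def by blast
  have "filterlim (\<lambda>s. (s, snd p)) (nhds (fst p, snd p)) (nhds (fst p))"
    by (intro tendsto_intros filterlim_ident)
  then have "\<forall>\<^sub>F s in nhds (fst p). v (s, snd p) \<le> v p"
    using assms(2) by (auto intro: eventually_compose_filterlim)
  then have "A \<le> 0" using d2_at_local_max[OF AB(1)] by simp
  have "filterlim (\<lambda>s. (fst p, s)) (nhds (fst p, snd p)) (nhds (snd p))"
    by (intro tendsto_intros filterlim_ident)
  then have "\<forall>\<^sub>F s in nhds (snd p). v (fst p, s) \<le> v p"
    using assms(2) by (auto intro: eventually_compose_filterlim)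
  then have "B \<le> 0" using d2_at_local_max[OF AB(2)] by simp
  with \<open>A \<le> 0\<close> AB show ?thesis by simp
qed

text \<open>Where \<open>v / \<psi>\<close> has its maximum \<open>m > 1\<close>, the function \<open>v - m \<psi>\<close> has a local maximum.\<close>

lemma comparison_principle:
  fixes v \<psi> q :: "real \<times> real \<Rightarrow> real"
  assumes D: "open D" "bounded D"
    and cont: "continuous_on (closure D) v" "continuous_on (closure D) \<psi>"
    and pos: "\<And>p. p \<in> closure D \<Longrightarrow> \<psi> p > 0"
    and bd: "\<And>p. p \<in> closure D \<Longrightarrow> p \<notin> D \<Longrightarrow> v p \<le> \<psi> p"
    and sub: "\<And>p. p \<in> D \<Longrightarrow> \<exists>l. lap_at v p l \<and> l + q p * v p \<ge> 0"
    and super: "\<And>p. p \<in> D \<Longrightarrow> \<exists>l. lap_at \<psi> p l \<and> l + q p * \<psi> p < 0"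
    and p: "p \<in> closure D"
  shows "v p \<le> \<psi> p"
proof (rule ccontr)
  assume "\<not> v p \<le> \<psi> p"
  have "compact (closure D)" using D by simp
  moreover have "continuous_on (closure D) (\<lambda>p. v p / \<psi> p)"
    using cont by (intro continuous_on_divide) (use pos in fastforce)+
  moreover have "closure D \<noteq> {}" using p by (metis empty_iff)
  ultimately obtain z where z: "z \<in> closure D" "\<And>y. y \<in> closure D \<Longrightarrow> v y / \<psi> y \<le> v z / \<psi> z"
    using continuous_attains_sup[of "closure D" "\<lambda>p. v p / \<psi> p"] by metis
  define m where "m = v z / \<psi> z"
  have "v p / \<psi> p > 1" using \<open>\<not> v p \<le> \<psi> p\<close> pos[OF p] by (simp add: less_divide_eq_1)
  then have m: "m > 1" using z(2)[OF p] by (simp add: m_def)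
  then have "z \<in> D" using bd[OF z(1)] pos[OF z(1)] unfolding m_def by (auto simp: less_divide_eq_1)
  obtain l where l: "lap_at v z l" "l + q z * v z \<ge> 0" using sub[OF \<open>z \<in> D\<close>] by blast
  obtain k where k: "lap_at \<psi> z k" "k + q z * \<psi> z < 0" using super[OF \<open>z \<in> D\<close>] by blast
  have vz: "v z = m * \<psi> z" using pos[OF z(1)] by (simp add: m_def)
  have "\<forall>\<^sub>F y in nhds z. y \<in> D" using D \<open>z \<in> D\<close> by (simp add: eventually_nhds_in_open)
  then have "\<forall>\<^sub>F y in nhds z. v y - m * \<psi> y \<le> v z - m * \<psi> z"
  proof (rule eventually_mono)
    fix y assume "y \<in> D"
    then have "y \<in> closure D" using closure_subset by blast
    from z(2)[OF this] pos[OF this] have "v y \<le> m * \<psi> y" by (simp add: m_def[symmetric] pos_divide_le_eq)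
    then show "v y - m * \<psi> y \<le> v z - m * \<psi> z" using vz by simp
  qed
  from lap_at_local_max[OF lap_at_diff[OF l(1) lap_at_cmult[OF k(1)]] this]
  have "l - m * k \<le> 0" .
  moreover have "m * (k + q z * \<psi> z) < 0" using m k(2) by (simp add: mult_pos_neg)
  ultimately show False using l(2) vz by (simp add: algebra_simps)
qed

section \<open>Solutions of the Helmholtz equation\<close>

lemma eventually_slice:
  assumes "open U" "p \<in> U"
  shows "\<forall>\<^sub>F s in nhds (fst p). (s, snd p) \<in> U" "\<forall>\<^sub>F s in nhds (snd p). (fst p, s) \<in> U"
proof -
  have U: "\<forall>\<^sub>F q in nhds (fst p, snd p). q \<in> U" using assms by (simp add: eventually_nhds_in_open)
  have "filterlim (\<lambda>s. (s, snd p)) (nhds (fst p, snd p)) (nhds (fst p))"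
    by (intro tendsto_intros filterlim_ident)
  from eventually_compose_filterlim[OF U this] show "\<forall>\<^sub>F s in nhds (fst p). (s, snd p) \<in> U" by simp
  have "filterlim (\<lambda>s. (fst p, s)) (nhds (fst p, snd p)) (nhds (snd p))"
    by (intro tendsto_intros filterlim_ident)
  from eventually_compose_filterlim[OF U this] show "\<forall>\<^sub>F s in nhds (snd p). (fst p, s) \<in> U" by simp
qed

lemma dx_cong:
  assumes "open U" "p \<in> U" "\<And>q. q \<in> U \<Longrightarrow> u q = v q"
  shows "dx u p = dx v p"
  unfolding dx_def
  by (rule deriv_cong_ev) (use eventually_slice(1)[OF assms(1,2)] assms(3) in \<open>auto elim: eventually_mono\<close>)

lemma dy_cong:
  assumes "open U" "p \<in> U" "\<And>q. q \<in> U \<Longrightarrow> u q = v q"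
  shows "dy u p = dy v p"
  unfolding dy_def
  by (rule deriv_cong_ev) (use eventually_slice(2)[OF assms(1,2)] assms(3) in \<open>auto elim: eventually_mono\<close>)

lemma field_differentiable_cong_ev:
  fixes f g :: "real \<Rightarrow> real"
  assumes "f field_differentiable (at x)" "\<forall>\<^sub>F s in nhds x. f s = g s"
  shows "g field_differentiable (at x)"
  using assms DERIV_cong_ev[OF refl assms(2) refl] unfolding field_differentiable_def by blast

section \<open>Calculus of the classes \<open>Ck_on\<close>\<close>

lemma Ck_on_cont: "Ck_on k u U \<Longrightarrow> continuous_on U u"
  by (cases k) auto

lemma Ck_on_cong:
  assumes "open U" "Ck_on k u U" "\<And>q. q \<in> U \<Longrightarrow> u q = v q"
  shows "Ck_on k v U"
  using assms(2,3)
proof (induction k arbitrary: u v)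
  case 0
  then show ?case using continuous_on_eq by force
next
  case (Suc k)
  have "continuous_on U v"
    by (rule continuous_on_eq[OF Ck_on_cont[OF Suc.prems(1)] Suc.prems(2)])
  moreover have "(\<lambda>s. v (s, snd p)) field_differentiable (at (fst p))" if "p \<in> U" for p
    by (rule field_differentiable_cong_ev[where f="\<lambda>s. u (s, snd p)"])
      (use Suc.prems that eventually_slice[OF assms(1) that] in \<open>auto elim: eventually_mono\<close>)
  moreover have "(\<lambda>s. v (fst p, s)) field_differentiable (at (snd p))" if "p \<in> U" for p
    by (rule field_differentiable_cong_ev[where f="\<lambda>s. u (fst p, s)"])
      (use Suc.prems that eventually_slice[OF assms(1) that] in \<open>auto elim: eventually_mono\<close>)
  moreover have "Ck_on k (dx v) U" "Ck_on k (dy v) U"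
    using Suc.prems Suc.IH[of "dx u" "dx v"] Suc.IH[of "dy u" "dy v"]
      dx_cong[OF assms(1), of _ u v] dy_cong[OF assms(1), of _ u v] by auto
  ultimately show ?case by simp
qed

lemma Ck_on_subset: "Ck_on k u U \<Longrightarrow> V \<subseteq> U \<Longrightarrow> Ck_on k u V"
proof (induction k arbitrary: u)
  case 0
  then show ?case using continuous_on_subset[of U u V] by simp
next
  case (Suc k)
  then show ?case using continuous_on_subset[of U u V] by (auto simp del: split_paired_All)
qed

lemma Ck_on_Suc_D: "Ck_on (Suc k) u U \<Longrightarrow> Ck_on k u U"
proof (induction k arbitrary: u)
  case 0
  then show ?case by simp
next
  case (Suc k)
  then show ?case using Ck_on.simps(2)[of "Suc k" u U] Ck_on.simps(2)[of k u U] by blast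
qed

lemma Ck_on_dx:
  assumes "Ck_on (Suc k) v U" "(x, y) \<in> U"
  shows "((\<lambda>s. v (s, y)) has_real_derivative dx v (x, y)) (at x)"
  using assms unfolding dx_def by (force simp: DERIV_deriv_iff_field_differentiable)

lemma Ck_on_dy:
  assumes "Ck_on (Suc k) v U" "(x, y) \<in> U"
  shows "((\<lambda>s. v (x, s)) has_real_derivative dy v (x, y)) (at y)"
  using assms unfolding dy_def by (force simp: DERIV_deriv_iff_field_differentiable)

lemma dx_eqI: "((\<lambda>s. v (s, y)) has_real_derivative D) (at x) \<Longrightarrow> dx v (x, y) = D"
  unfolding dx_def by (simp add: DERIV_imp_deriv)

lemma dy_eqI: "((\<lambda>s. v (x, s)) has_real_derivative D) (at y) \<Longrightarrow> dy v (x, y) = D"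
  unfolding dy_def by (simp add: DERIV_imp_deriv)

text \<open>Explicit formulas for the partial derivatives agree with \<open>dx v\<close> and
  \<open>dy v\<close> only on the open set, hence the detour through
  \<open>Ck_on_cong\<close>.\<close>

lemma Ck_on_SucI:
  assumes "continuous_on U v" "open U"
    and "\<And>x y. (x, y) \<in> U \<Longrightarrow> ((\<lambda>s. v (s, y)) has_real_derivative F (x, y)) (at x)"
    and "\<And>x y. (x, y) \<in> U \<Longrightarrow> ((\<lambda>s. v (x, s)) has_real_derivative G (x, y)) (at y)"
    and "Ck_on k F U" "Ck_on k G U"
  shows "Ck_on (Suc k) v U"
proof -
  have "Ck_on k (dx v) U"
    by (rule Ck_on_cong[OF assms(2,5)]) (use dx_eqI assms(3) in force)
  moreover have "Ck_on k (dy v) U"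
    by (rule Ck_on_cong[OF assms(2,6)]) (use dy_eqI assms(4) in force)
  ultimately show ?thesis
    using assms by (force simp: field_differentiable_def)
qed

lemma Ck_on_add:
  assumes "open U" "Ck_on k u U" "Ck_on k v U" shows "Ck_on k (\<lambda>p. u p + v p) U"
  using assms(2,3)
proof (induction k arbitrary: u v)
  case 0 then show ?case by (auto intro: continuous_intros)
next
  case (Suc k)
  show ?case
    by (rule Ck_on_SucI[where F="\<lambda>p. dx u p + dx v p" and G="\<lambda>p. dy u p + dy v p"])
      (use Suc assms(1) in \<open>auto intro: DERIV_add Ck_on_dx[OF Suc.prems(1)] Ck_on_dx[OF Suc.prems(2)]
         Ck_on_dy[OF Suc.prems(1)] Ck_on_dy[OF Suc.prems(2)] continuous_intros\<close>)
qed

lemma Ck_on_cmult: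
  assumes "open U" "Ck_on k u U" shows "Ck_on k (\<lambda>p. c * u p) U"
  using assms(2)
proof (induction k arbitrary: u)
  case 0 then show ?case by (auto intro: continuous_intros)
next
  case (Suc k)
  show ?case
    by (rule Ck_on_SucI[where F="\<lambda>p. c * dx u p" and G="\<lambda>p. c * dy u p"])
      (use Suc assms(1) in \<open>auto intro: DERIV_cmult Ck_on_dx[OF Suc.prems] Ck_on_dy[OF Suc.prems] continuous_intros\<close>)
qed

lemma Ck_on_affine:
  assumes "open U" "Ck_on k v U"
    and V: "open V" "\<And>x y. (x, y) \<in> V \<Longrightarrow> (\<sigma> * x + \<alpha>, \<rho> * y + \<beta>) \<in> U"
  shows "Ck_on k (\<lambda>p. v (\<sigma> * fst p + \<alpha>, \<rho> * snd p + \<beta>)) V"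
  using assms(2)
proof (induction k arbitrary: v)
  case 0
  then show ?case
    using V by (auto intro!: continuous_on_compose2[of U v] continuous_intros)
next
  case (Suc k)
  show ?case
  proof (rule Ck_on_SucI)
    show "continuous_on V (\<lambda>p. v (\<sigma> * fst p + \<alpha>, \<rho> * snd p + \<beta>))"
      using V Ck_on_cont[OF Suc.prems] by (auto intro!: continuous_on_compose2[of U v] continuous_intros)
    fix x y assume xy: "(x, y) \<in> V"
    have "((\<lambda>s. \<sigma> * s + \<alpha>) has_real_derivative \<sigma>) (at x)" by (auto intro!: derivative_eq_intros)
    from DERIV_chain2[where f="\<lambda>s. v (s, \<rho> * y + \<beta>)" and g="\<lambda>s. \<sigma> * s + \<alpha>", OF Ck_on_dx[OF Suc.prems V(2)[OF xy]] this]
    show "((\<lambda>s. v (\<sigma> * fst (s, y) + \<alpha>, \<rho> * snd (s, y) + \<beta>)) has_real_derivative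
       (\<lambda>p. \<sigma> * dx v (\<sigma> * fst p + \<alpha>, \<rho> * snd p + \<beta>)) (x, y)) (at x)" by (simp add: mult.commute)
    have "((\<lambda>s. \<rho> * s + \<beta>) has_real_derivative \<rho>) (at y)" by (auto intro!: derivative_eq_intros)
    from DERIV_chain2[where f="\<lambda>s. v (\<sigma> * x + \<alpha>, s)" and g="\<lambda>s. \<rho> * s + \<beta>", OF Ck_on_dy[OF Suc.prems V(2)[OF xy]] this]
    show "((\<lambda>s. v (\<sigma> * fst (x, s) + \<alpha>, \<rho> * snd (x, s) + \<beta>)) has_real_derivative
       (\<lambda>p. \<rho> * dy v (\<sigma> * fst p + \<alpha>, \<rho> * snd p + \<beta>)) (x, y)) (at y)" by (simp add: mult.commute)
  qed (use Suc V Ck_on_cmult in auto)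
qed

lemma Ck_on_swap:
  assumes "open V" "Ck_on k v U" "\<And>x y. (x, y) \<in> V \<Longrightarrow> (y, x) \<in> U"
  shows "Ck_on k (\<lambda>p. v (snd p, fst p)) V"
  using assms(2)
proof (induction k arbitrary: v)
  case 0
  then show ?case using assms by (auto intro!: continuous_on_compose2[of U v] continuous_intros)
next
  case (Suc k)
  show ?case
  proof (rule Ck_on_SucI)
    show "continuous_on V (\<lambda>p. v (snd p, fst p))"
      using assms Ck_on_cont[OF Suc.prems] by (auto intro!: continuous_on_compose2[of U v] continuous_intros)
    fix x y assume xy: "(x, y) \<in> V"
    show "((\<lambda>s. v (snd (s, y), fst (s, y))) has_real_derivative (\<lambda>p. dy v (snd p, fst p)) (x, y)) (at x)"
      "((\<lambda>s. v (snd (x, s), fst (x, s))) has_real_derivative (\<lambda>p. dx v (snd p, fst p)) (x, y)) (at y)"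
      using Ck_on_dx[OF Suc.prems] Ck_on_dy[OF Suc.prems] assms(3)[OF xy] by auto
  qed (use Suc assms in auto)
qed

lemma dx_swap: "dx (\<lambda>p. v (snd p, fst p)) (x, y) = dy v (y, x)"
  unfolding dx_def dy_def by simp

lemma dy_swap: "dy (\<lambda>p. v (snd p, fst p)) (x, y) = dx v (y, x)"
  unfolding dx_def dy_def by simp

lemma d2_at_dx:
  assumes "open U" "Ck_on 2 v U" "p \<in> U"
  shows "d2_at (\<lambda>s. v (s, snd p)) (fst p) (dx (dx v) p)"
  unfolding d2_at_def
proof (intro exI conjI)
  have C: "Ck_on (Suc 1) v U" "Ck_on (Suc 0) (dx v) U"
    using assms(2) by (auto simp: eval_nat_numeral)
  show "\<forall>\<^sub>F s in nhds (fst p). ((\<lambda>s. v (s, snd p)) has_real_derivative dx v (s, snd p)) (at s)"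
    using eventually_slice(1)[OF assms(1,3)] by (rule eventually_mono) (rule Ck_on_dx[OF C(1)])
  show "((\<lambda>s. dx v (s, snd p)) has_real_derivative dx (dx v) p) (at (fst p))"
    using Ck_on_dx[OF C(2), of "fst p" "snd p"] assms(3) by simp
qed

lemma d2_at_dy:
  assumes "open U" "Ck_on 2 v U" "p \<in> U"
  shows "d2_at (\<lambda>s. v (fst p, s)) (snd p) (dy (dy v) p)"
  unfolding d2_at_def
proof (intro exI conjI)
  have C: "Ck_on (Suc 1) v U" "Ck_on (Suc 0) (dy v) U"
    using assms(2) by (auto simp: eval_nat_numeral)
  show "\<forall>\<^sub>F s in nhds (snd p). ((\<lambda>s. v (fst p, s)) has_real_derivative dy v (fst p, s)) (at s)"
    using eventually_slice(2)[OF assms(1,3)] by (rule eventually_mono) (rule Ck_on_dy[OF C(1)])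
  show "((\<lambda>s. dy v (fst p, s)) has_real_derivative dy (dy v) p) (at (snd p))"
    using Ck_on_dy[OF C(2), of "fst p" "snd p"] assms(3) by simp
qed

lemma lap_at_laplacian: "open U \<Longrightarrow> Ck_on 2 v U \<Longrightarrow> p \<in> U \<Longrightarrow> lap_at v p (laplacian v p)"
  unfolding lap_at_def laplacian_def using d2_at_dx d2_at_dy by blast

definition sol :: "real \<Rightarrow> (real \<times> real \<Rightarrow> real) \<Rightarrow> (real \<times> real) set \<Rightarrow> bool" where
  "sol \<mu> v U \<longleftrightarrow> open U \<and> Ck_on 2 v U \<and> (\<forall>p\<in>U. laplacian v p = - \<mu> * v p)"

lemma sol_Ck: "sol \<mu> v U \<Longrightarrow> Ck_on 2 v U" "sol \<mu> v U \<Longrightarrow> open U"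
  unfolding sol_def by auto

lemma sol_Suc: "sol \<mu> v U \<Longrightarrow> Ck_on (Suc 1) v U"
  unfolding sol_def by (auto simp: eval_nat_numeral)

lemma sol_cont: "sol \<mu> v U \<Longrightarrow> continuous_on U v"
  using Ck_on_cont sol_Ck by blast

lemma sol_cont_dx: "sol \<mu> v U \<Longrightarrow> continuous_on U (dx v)"
  "sol \<mu> v U \<Longrightarrow> continuous_on U (dy v)"
  using sol_Suc[of \<mu> v U] by auto

lemma sol_dx: "sol \<mu> v U \<Longrightarrow> (x, y) \<in> U \<Longrightarrow> ((\<lambda>s. v (s, y)) has_real_derivative dx v (x, y)) (at x)"
  using Ck_on_dx sol_Suc by blast

lemma sol_dy: "sol \<mu> v U \<Longrightarrow> (x, y) \<in> U \<Longrightarrow> ((\<lambda>s. v (x, s)) has_real_derivative dy v (x, y)) (at y)"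
  using Ck_on_dy sol_Suc by blast

lemma sol_lap_at: "sol \<mu> v U \<Longrightarrow> p \<in> U \<Longrightarrow> lap_at v p (- \<mu> * v p)"
  using lap_at_laplacian[of U v p] unfolding sol_def by auto

text \<open>The zero function \<open>v - v\<close> has Laplacian \<open>l - m\<close> and a local
  maximum everywhere; the same holds with the roles exchanged.\<close>

lemma lap_at_unique: "lap_at v p l \<Longrightarrow> lap_at v p m \<Longrightarrow> l = m"
proof (rule antisym)
  have *: "l \<le> m" if "lap_at v p l" "lap_at v p m" for l m
    using lap_at_local_max[OF lap_at_diff[OF that]] by simp
  assume "lap_at v p l" "lap_at v p m"
  then show "l \<le> m" "m \<le> l" using * by blast+
qed

lemma solI:
  assumes "open U" "Ck_on 2 v U" "\<And>p. p \<in> U \<Longrightarrow> lap_at v p (- \<mu> * v p)"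
  shows "sol \<mu> v U"
  using assms lap_at_unique[OF lap_at_laplacian[OF assms(1,2)] assms(3)] unfolding sol_def by auto

lemma sol_subset: "sol \<mu> v U \<Longrightarrow> V \<subseteq> U \<Longrightarrow> open V \<Longrightarrow> sol \<mu> v V"
  unfolding sol_def using Ck_on_subset by blast

lemma sol_add:
  assumes "sol \<mu> v U" "sol \<mu> w U" shows "sol \<mu> (\<lambda>p. v p + w p) U"
  by (rule solI) (use assms lap_at_add[OF sol_lap_at[OF assms(1)] sol_lap_at[OF assms(2)]] in
     \<open>auto simp: sol_def algebra_simps intro: Ck_on_add\<close>)

lemma sol_cmult:
  assumes "sol \<mu> v U" shows "sol \<mu> (\<lambda>p. c * v p) U"
  by (rule solI) (use assms lap_at_cmult[OF sol_lap_at[OF assms(1)], of _ c] in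
     \<open>auto simp: sol_def algebra_simps intro: Ck_on_cmult\<close>)

lemma sol_affine:
  assumes "sol \<mu> v U" "\<sigma>\<^sup>2 = 1" "\<rho>\<^sup>2 = 1" "open V"
    "\<And>x y. (x, y) \<in> V \<Longrightarrow> (\<sigma> * x + \<alpha>, \<rho> * y + \<beta>) \<in> U"
  shows "sol \<mu> (\<lambda>p. v (\<sigma> * fst p + \<alpha>, \<rho> * snd p + \<beta>)) V"
proof (rule solI)
  show "Ck_on 2 (\<lambda>p. v (\<sigma> * fst p + \<alpha>, \<rho> * snd p + \<beta>)) V"
    using assms sol_Ck[OF assms(1)] by (intro Ck_on_affine[where U=U]) auto
  fix p assume "p \<in> V"
  then have "(\<sigma> * fst p + \<alpha>, \<rho> * snd p + \<beta>) \<in> U" using assms(5)[of "fst p" "snd p"] by simp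
  from lap_at_affine[OF sol_lap_at[OF assms(1) this] assms(2,3)]
  show "lap_at (\<lambda>p. v (\<sigma> * fst p + \<alpha>, \<rho> * snd p + \<beta>)) p (- \<mu> * v (\<sigma> * fst p + \<alpha>, \<rho> * snd p + \<beta>))" .
qed (use assms in auto)

lemma sol_swap:
  assumes "sol \<mu> v U" "open V" "\<And>x y. (x, y) \<in> V \<Longrightarrow> (y, x) \<in> U"
  shows "sol \<mu> (\<lambda>p. v (snd p, fst p)) V"
proof (rule solI)
  show "Ck_on 2 (\<lambda>p. v (snd p, fst p)) V"
    using assms sol_Ck[OF assms(1)] by (intro Ck_on_swap[where U=U]) auto
  fix p assume "p \<in> V"
  then have "(snd p, fst p) \<in> U" using assms(3)[of "fst p" "snd p"] by simp
  from lap_at_swap[OF sol_lap_at[OF assms(1) this]]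
  show "lap_at (\<lambda>p. v (snd p, fst p)) p (- \<mu> * v (snd p, fst p))" .
qed (use assms in auto)

section \<open>Interior gradient estimates\<close>

lemma lap_at_sum:
  assumes "d2_at f (fst p) A" "d2_at g (snd p) B"
  shows "lap_at (\<lambda>q. f (fst q) + g (snd q)) p (A + B)"
  unfolding lap_at_def
  using d2_at_add[OF assms(1) d2_at_const[of "g (snd p)"]] d2_at_add[OF d2_at_const[of "f (fst p)"] assms(2)]
  by (intro exI[of _ A] exI[of _ B]) simp

lemma d2_at_quadratic: "d2_at (\<lambda>s::real. \<alpha> + \<beta> * (s - c) + \<gamma> * (s - c)\<^sup>2) x (2 * \<gamma>)"
  by (rule d2_atI[where g="\<lambda>s. \<beta> + 2 * \<gamma> * (s - c)"]) (auto intro!: derivative_eq_intros)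

text \<open>The odd part of \<open>v\<close> in \<open>b - y\<close> vanishes on the midline, so a barrier vanishing there bounds
  its slope (Gilbarg and Trudinger, Section 3.4).\<close>

lemma grad_bound_aux:
  fixes v :: "real \<times> real \<Rightarrow> real"
  assumes d: "d > 0"
    and cont: "continuous_on ({x-d..x+d} \<times> {y-d..y+d}) v"
    and M: "\<And>p. p \<in> {x-d..x+d} \<times> {y-d..y+d} \<Longrightarrow> \<bar>v p\<bar> \<le> M"
    and F: "\<And>p. p \<in> {x-d<..<x+d} \<times> {y-d<..<y+d} \<Longrightarrow> \<exists>l. lap_at v p l \<and> \<bar>l\<bar> \<le> F"
    and D: "((\<lambda>s. v (x, s)) has_real_derivative D) (at y)"
  shows "D \<le> 2 * M / d + d * F / 2"
proof -
  define T where "T = {x-d<..<x+d} \<times> {y<..<y+d}"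
  have clT: "closure T = {x-d..x+d} \<times> {y..y+d}"
    using d unfolding T_def by (simp add: closure_Times)
  have M0: "M \<ge> 0" using M[of "(x,y)"] d by fastforce
  have F0: "F \<ge> 0" using F[of "(x,y)"] d by fastforce
  \<comment> \<open>The odd part has Laplacian at least \<open>- F\<close>. The subtracted parabola
    \<open>F / 2 * t * (d - t)\<close>, t being the height above the midline, has Laplacian
    \<open>- F\<close> and is nonnegative for t in [0, d], so \<open>f\<close> is subharmonic. The
    factors 1 and summands 0 match the form of \<open>lap_at_affine\<close>.\<close>
  define f where "f p = (1/2) * (v p - v (1 * fst p + 0, - 1 * snd p + 2 * y))
      - (0 * fst p + (0 + F * d / 2 * (snd p - y) + (- F / 2) * (snd p - y)\<^sup>2))" for p
  \<comment> \<open>Apart from the terms in \<open>e\<close> this is the harmonic function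
    \<open>M / d\<^sup>2 * (s\<^sup>2 + t * (2 * d - t))\<close>, s and t being the coordinates
    relative to the centre: at least \<open>M\<close> on the three outer sides, zero at the centre.
    The terms in \<open>e\<close> make it positive and its Laplacian equal to
    \<open>- 2 * e\<close>.\<close>
  define \<psi> where "\<psi> e p = ((e * (1 + 2 * d\<^sup>2) + 0 * (fst p - x) + (M / d\<^sup>2 - e) * (fst p - x)\<^sup>2)
      + (0 + 2 * M / d * (snd p - y) + (- M / d\<^sup>2) * (snd p - y)\<^sup>2))" for e and p :: "real \<times> real"
  have key: "f p \<le> \<psi> e p" if e: "e > 0" and p: "p \<in> closure T" for e p
  proof (rule comparison_principle[where D=T and q="\<lambda>_. 0"])
    show "open T" "bounded T" unfolding T_def by (auto intro: open_Times bounded_Times)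
    show "continuous_on (closure T) f"
      unfolding f_def clT using d
      by (intro continuous_intros continuous_on_compose2[OF cont]) auto
    show "continuous_on (closure T) (\<psi> e)"
      unfolding \<psi>_def by (intro continuous_intros)
    have Mnn: "2 * M / d * t - M / d\<^sup>2 * t\<^sup>2 \<ge> 0" if "0 \<le> t" "t \<le> d" for t
    proof -
      have "2 * M / d * t - M / d\<^sup>2 * t\<^sup>2 = M / d\<^sup>2 * (t * (2 * d - t))"
        using d by (simp add: field_simps power2_eq_square)
      also have "\<dots> \<ge> 0" using that M0 d by (intro mult_nonneg_nonneg) auto
      finally show ?thesis .
    qed
    have Fnn: "F * d / 2 * t + (- F / 2) * t\<^sup>2 \<ge> 0" if "0 \<le> t" "t \<le> d" for t
    proof -
      have "F * d / 2 * t + (- F / 2) * t\<^sup>2 = F / 2 * (t * (d - t))"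
        by (simp add: field_simps power2_eq_square)
      also have "\<dots> \<ge> 0" using that F0 by (intro mult_nonneg_nonneg) auto
      finally show ?thesis .
    qed
    have sq: "(a - x)\<^sup>2 \<le> d\<^sup>2" if "x - d \<le> a" "a \<le> x + d" for a
      by (rule abs_le_square_iff[THEN iffD1]) (use that in auto)
    have esq: "e * (a - x)\<^sup>2 \<le> e * d\<^sup>2" if "x - d \<le> a" "a \<le> x + d" for a
      using sq[OF that] e by simp
    show "\<psi> e p > 0" if "p \<in> closure T" for p
    proof -
      have 1: "x - d \<le> fst p" "fst p \<le> x + d" "0 \<le> snd p - y" "snd p - y \<le> d"
        using that unfolding clT by (auto simp: mem_Times_iff)
      have "\<psi> e p = e + (e * d\<^sup>2 - e * (fst p - x)\<^sup>2) + e * d\<^sup>2 + M / d\<^sup>2 * (fst p - x)\<^sup>2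
          + (2 * M / d * (snd p - y) - M / d\<^sup>2 * (snd p - y)\<^sup>2)"
        unfolding \<psi>_def by (simp add: algebra_simps)
      moreover have "e * d\<^sup>2 \<ge> 0" "M / d\<^sup>2 * (fst p - x)\<^sup>2 \<ge> 0" using e M0 by auto
      ultimately show ?thesis using e esq[OF 1(1,2)] Mnn[OF 1(3,4)] by linarith
    qed
    show "f p \<le> \<psi> e p" if in_cl: "p \<in> closure T" and not_in: "p \<notin> T" for p
    proof -
      obtain a b where p: "p = (a, b)" by (cases p)
      have 1: "x - d \<le> a" "a \<le> x + d" "0 \<le> b - y" "b - y \<le> d"
        using in_cl unfolding clT p by auto
      have "\<psi> e p = e + (e * d\<^sup>2 - e * (a - x)\<^sup>2) + e * d\<^sup>2 + M / d\<^sup>2 * (a - x)\<^sup>2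
          + (2 * M / d * (b - y) - M / d\<^sup>2 * (b - y)\<^sup>2)"
        unfolding \<psi>_def p by (simp add: algebra_simps)
      moreover have "e * d\<^sup>2 \<ge> 0" using e by auto
      ultimately have \<psi>: "\<psi> e p \<ge> M / d\<^sup>2 * (a - x)\<^sup>2 + (2 * M / d * (b - y) - M / d\<^sup>2 * (b - y)\<^sup>2)"
        using e esq[OF 1(1,2)] by linarith
      have nn: "M / d\<^sup>2 * (a - x)\<^sup>2 \<ge> 0" using M0 by auto
      have f: "f p = (v (a, b) - v (a, 2 * y - b)) / 2 - (F * d / 2 * (b - y) + (- F / 2) * (b - y)\<^sup>2)"
        unfolding f_def p by (simp add: add.commute)
      have "\<bar>v (a, b)\<bar> \<le> M" "\<bar>v (a, 2 * y - b)\<bar> \<le> M" using M 1 by auto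
      then have fM: "f p \<le> M" using f Fnn[OF 1(3,4)] by argo
      have "b = y \<or> b = y + d \<or> a - x = d \<or> a - x = - d"
        using not_in 1 unfolding T_def p by auto
      then consider "b = y" | "b = y + d" | "(a - x)\<^sup>2 = d\<^sup>2"
        by (auto simp: power2_eq_iff)
      then show ?thesis
      proof cases
        case 1
        then have "f p = 0" using f by simp
        moreover have "\<psi> e p \<ge> 0" using \<psi> nn 1 by simp
        ultimately show ?thesis by simp
      next
        case 2
        have "2 * M / d * (b - y) - M / d\<^sup>2 * (b - y)\<^sup>2 = M" using 2 d by (simp add: field_simps)
        then show ?thesis using fM \<psi> nn by linarith
      next
        case 3
        then have "M / d\<^sup>2 * (a - x)\<^sup>2 = M" using d by simp
        then show ?thesis using fM \<psi> Mnn[OF 1(3,4)] by linarith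
      qed
    qed
    show "\<exists>l. lap_at f p l \<and> l + 0 * f p \<ge> 0" if "p \<in> T" for p
    proof -
      have p: "p \<in> {x-d<..<x+d} \<times> {y-d<..<y+d}" "(1 * fst p + 0, - 1 * snd p + 2 * y) \<in> {x-d<..<x+d} \<times> {y-d<..<y+d}"
        using that d unfolding T_def by auto
      obtain l m where l: "lap_at v p l" "\<bar>l\<bar> \<le> F"
        and m: "lap_at v (1 * fst p + 0, - 1 * snd p + 2 * y) m" "\<bar>m\<bar> \<le> F"
        using F[OF p(1)] F[OF p(2)] by auto
      have m': "lap_at (\<lambda>q. v (1 * fst q + 0, - 1 * snd q + 2 * y)) p m"
        by (rule lap_at_affine[OF m(1)]) auto
      have z: "d2_at (\<lambda>s. 0 * s) (fst p) 0" using d2_at_const[of 0] by simp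
      have "lap_at f p ((1/2) * (l - m) - (0 + 2 * (- F / 2)))"
        unfolding f_def
        by (intro lap_at_diff lap_at_cmult lap_at_sum l m' z d2_at_quadratic)
      moreover have "(1/2) * (l - m) - (0 + 2 * (- F / 2)) + 0 * f p \<ge> 0" using l(2) m(2) by argo
      ultimately show ?thesis by blast
    qed
    show "\<exists>l. lap_at (\<psi> e) p l \<and> l + 0 * \<psi> e p < 0" if "p \<in> T" for p
    proof -
      have "lap_at (\<psi> e) p (2 * (M / d\<^sup>2 - e) + 2 * (- M / d\<^sup>2))"
        unfolding \<psi>_def by (intro lap_at_sum d2_at_quadratic)
      moreover have "2 * (M / d\<^sup>2 - e) + 2 * (- M / d\<^sup>2) + 0 * \<psi> e p < 0" using e by argo
      ultimately show ?thesis by blast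
    qed
  qed (use p in auto)
  have bound: "(v (x, y + h) - v (x, y - h)) / (2 * h) \<le> 2 * M / d + d * F / 2" if h: "0 < h" "h < d" for h
  proof -
    have in_T: "(x, y + h) \<in> closure T" unfolding clT using h d by auto
    have "(v (x, y + h) - v (x, y - h)) / 2 - (F * d / 2 * h - F / 2 * h\<^sup>2)
      \<le> e * (1 + 2 * d\<^sup>2) + (2 * M / d * h - M / d\<^sup>2 * h\<^sup>2)" if "e > 0" for e
      using key[OF that in_T] unfolding f_def \<psi>_def by (simp add: algebra_simps diff_divide_distrib)
    then have *: "((v (x, y + h) - v (x, y - h)) / 2 - (F * d / 2 * h - F / 2 * h\<^sup>2)
        - (2 * M / d * h - M / d\<^sup>2 * h\<^sup>2)) / (1 + 2 * d\<^sup>2) \<le> e" if "e > 0" for e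
      using that d by (simp add: pos_divide_le_eq add_pos_nonneg algebra_simps)
    have "((v (x, y + h) - v (x, y - h)) / 2 - (F * d / 2 * h - F / 2 * h\<^sup>2)
        - (2 * M / d * h - M / d\<^sup>2 * h\<^sup>2)) / (1 + 2 * d\<^sup>2) \<le> 0"
      by (rule field_le_epsilon) (use * in auto)
    moreover have "1 + 2 * d\<^sup>2 > 0" by (simp add: add_pos_nonneg)
    ultimately have "(v (x, y + h) - v (x, y - h)) / 2 \<le> (F * d / 2 * h - F / 2 * h\<^sup>2)
        + (2 * M / d * h - M / d\<^sup>2 * h\<^sup>2)"
      unfolding divide_le_0_iff by linarith
    also have "\<dots> \<le> F * d / 2 * h + 2 * M / d * h" using F0 M0 by (simp add: add_mono)
    also have "\<dots> = (2 * M / d + d * F / 2) * h" by (simp add: algebra_simps)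
    finally show ?thesis using h by (simp add: pos_divide_le_eq field_simps)
  qed
  \<comment> \<open>The odd part controls symmetric difference quotients, whose limit is the same
    derivative.\<close>
  have D': "((\<lambda>h. (v (x, y + h) - v (x, y - h)) / 2) has_real_derivative D) (at 0)"
  proof -
    have "((\<lambda>h. v (x, y + h)) has_real_derivative D * 1) (at 0)"
      by (rule DERIV_chain2[where f="\<lambda>s. v (x, s)"]) (use D in \<open>auto intro!: derivative_eq_intros\<close>)
    moreover have "((\<lambda>h. v (x, y - h)) has_real_derivative D * (-1)) (at 0)"
      by (rule DERIV_chain2[where f="\<lambda>s. v (x, s)"]) (use D in \<open>auto intro!: derivative_eq_intros\<close>)
    ultimately show ?thesis by (auto intro!: derivative_eq_intros)
  qed
  then have "((\<lambda>h. (v (x, y + h) - v (x, y - h)) / (2 * h)) \<longlongrightarrow> D) (at 0)"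
    unfolding DERIV_def by simp
  then have "((\<lambda>h. (v (x, y + h) - v (x, y - h)) / (2 * h)) \<longlongrightarrow> D) (at_right 0)"
    by (rule tendsto_within_subset) auto
  then show ?thesis
    by (rule tendsto_upperbound)
      (use bound d in \<open>auto simp: eventually_at_right_field intro!: exI[of _ d]\<close>)
qed

lemma grad_bound_dy:
  fixes v :: "real \<times> real \<Rightarrow> real"
  assumes d: "d > 0"
    and cont: "continuous_on ({x-d..x+d} \<times> {y-d..y+d}) v"
    and M: "\<And>p. p \<in> {x-d..x+d} \<times> {y-d..y+d} \<Longrightarrow> \<bar>v p\<bar> \<le> M"
    and F: "\<And>p. p \<in> {x-d<..<x+d} \<times> {y-d<..<y+d} \<Longrightarrow> \<exists>l. lap_at v p l \<and> \<bar>l\<bar> \<le> F"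
    and D: "((\<lambda>s. v (x, s)) has_real_derivative D) (at y)"
  shows "\<bar>D\<bar> \<le> 2 * M / d + d * F / 2"
proof -
  have "D \<le> 2 * M / d + d * F / 2"
    by (rule grad_bound_aux[OF assms]) auto
  moreover have "- D \<le> 2 * M / d + d * F / 2"
  proof (rule grad_bound_aux[where v="\<lambda>p. - v p"])
    show "\<exists>l. lap_at (\<lambda>p. - v p) p l \<and> \<bar>l\<bar> \<le> F" if "p \<in> {x-d<..<x+d} \<times> {y-d<..<y+d}" for p
      using F[OF that] lap_at_minus by fastforce
  qed (use assms in \<open>auto intro: continuous_intros DERIV_minus\<close>)
  ultimately show ?thesis by linarith
qed

lemma sol_grad_bound_dy:
  assumes "sol \<mu> v U" "d > 0" "{x-d..x+d} \<times> {y-d..y+d} \<subseteq> U"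
    and M: "\<And>p. p \<in> {x-d..x+d} \<times> {y-d..y+d} \<Longrightarrow> \<bar>v p\<bar> \<le> M"
  shows "\<bar>dy v (x, y)\<bar> \<le> 2 * M / d + d * (\<bar>\<mu>\<bar> * M) / 2"
proof (rule grad_bound_dy[where v=v])
  show "continuous_on ({x-d..x+d} \<times> {y-d..y+d}) v"
    using sol_cont[OF assms(1)] assms(3) continuous_on_subset by blast
  show "\<exists>l. lap_at v p l \<and> \<bar>l\<bar> \<le> \<bar>\<mu>\<bar> * M" if "p \<in> {x-d<..<x+d} \<times> {y-d<..<y+d}" for p
  proof -
    have p: "p \<in> {x-d..x+d} \<times> {y-d..y+d}" using that by (auto simp: mem_Times_iff)
    then have "p \<in> U" using assms(3) by auto
    then show ?thesis using sol_lap_at[OF assms(1), of p] M[OF p]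
      by (intro exI[of _ "- \<mu> * v p"]) (simp add: abs_mult mult_left_mono)
  qed
  show "((\<lambda>s. v (x, s)) has_real_derivative dy v (x, y)) (at y)"
    by (rule sol_dy[OF assms(1)]) (use assms(2,3) in auto)
qed (use assms in auto)

lemma sol_grad_bound_dx:
  assumes "sol \<mu> v U" "d > 0" "{x-d..x+d} \<times> {y-d..y+d} \<subseteq> U"
    and M: "\<And>p. p \<in> {x-d..x+d} \<times> {y-d..y+d} \<Longrightarrow> \<bar>v p\<bar> \<le> M"
  shows "\<bar>dx v (x, y)\<bar> \<le> 2 * M / d + d * (\<bar>\<mu>\<bar> * M) / 2"
proof -
  define V where "V = (\<lambda>p. (snd p, fst p)) -` U"
  have "open V" unfolding V_def
    using sol_Ck(2)[OF assms(1)] by (intro open_vimage continuous_intros) auto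
  then have s: "sol \<mu> (\<lambda>p. v (snd p, fst p)) V"
    by (rule sol_swap[OF assms(1)]) (auto simp: V_def)
  have "\<bar>dy (\<lambda>p. v (snd p, fst p)) (y, x)\<bar> \<le> 2 * M / d + d * (\<bar>\<mu>\<bar> * M) / 2"
    by (rule sol_grad_bound_dy[OF s assms(2)]) (use assms(3) M in \<open>auto simp: V_def\<close>)
  then show ?thesis by (simp add: dy_swap)
qed

text \<open>For \<open>d \<le> 1\<close> the contribution of the right-hand side, of order
  \<open>d\<close>, is absorbed into the term of order \<open>1 / d\<close>, which leaves one
  scale-invariant bound.\<close>

lemma sol_grad_bound:
  assumes "sol \<mu> v U" "0 < d" "d \<le> 1" "{x-d..x+d} \<times> {y-d..y+d} \<subseteq> U"
    and M: "\<And>p. p \<in> {x-d..x+d} \<times> {y-d..y+d} \<Longrightarrow> \<bar>v p\<bar> \<le> M"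
  shows "\<bar>dx v (x, y)\<bar> \<le> (2 + \<bar>\<mu>\<bar>) * M / d" "\<bar>dy v (x, y)\<bar> \<le> (2 + \<bar>\<mu>\<bar>) * M / d"
proof -
  have "M \<ge> 0" using M[of "(x, y)"] assms(2) by force
  have "d * d \<le> 2 * 1" using assms(2,3) mult_mono[of d 1 d 1] by simp
  then have "d / 2 \<le> 1 / d" using assms(2) by (simp add: field_simps)
  then have "d / 2 * (\<bar>\<mu>\<bar> * M) \<le> 1 / d * (\<bar>\<mu>\<bar> * M)"
    by (rule mult_right_mono) (use \<open>M \<ge> 0\<close> in auto)
  moreover have "(2 + \<bar>\<mu>\<bar>) * M / d = 2 * M / d + 1 / d * (\<bar>\<mu>\<bar> * M)"
    by (simp add: algebra_simps add_divide_distrib)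
  ultimately have "2 * M / d + d * (\<bar>\<mu>\<bar> * M) / 2 \<le> (2 + \<bar>\<mu>\<bar>) * M / d"
    by simp
  then show "\<bar>dx v (x, y)\<bar> \<le> (2 + \<bar>\<mu>\<bar>) * M / d" "\<bar>dy v (x, y)\<bar> \<le> (2 + \<bar>\<mu>\<bar>) * M / d"
    using sol_grad_bound_dx[OF assms(1,2,4) M] sol_grad_bound_dy[OF assms(1,2,4) M] by auto
qed

text \<open>The equation cannot be differentiated yet, since \<open>v\<close> is only twice
  differentiable. Its difference quotients in x, however, solve the same equation, are bounded by
  the gradient estimate and the mean value theorem, and have gradients that converge to the second
  derivatives.\<close>

lemma sol_hess_bound_aux:
  assumes s: "sol \<mu> v U" and d: "0 < d" "d \<le> 1" and sub: "{x-d..x+d} \<times> {y-d..y+d} \<subseteq> U"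
    and M: "\<And>p. p \<in> {x-d..x+d} \<times> {y-d..y+d} \<Longrightarrow> \<bar>v p\<bar> \<le> M"
  shows "\<bar>dx (dx v) (x, y)\<bar> \<le> 8 * (2 + \<bar>\<mu>\<bar>)\<^sup>2 * M / d\<^sup>2" (is "_ \<le> ?B")
    and "\<bar>dx (dy v) (x, y)\<bar> \<le> 8 * (2 + \<bar>\<mu>\<bar>)\<^sup>2 * M / d\<^sup>2"
proof -
  define K where "K = 2 + \<bar>\<mu>\<bar>"
  have M0: "M \<ge> 0" using M[of "(x, y)"] d by force
  have g: "\<bar>dx v (a, b)\<bar> \<le> 2 * K * M / d" if "\<bar>a - x\<bar> \<le> d / 2" "\<bar>b - y\<bar> \<le> d / 2" for a b
  proof -
    have "{a-d/2..a+d/2} \<times> {b-d/2..b+d/2} \<subseteq> {x-d..x+d} \<times> {y-d..y+d}"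
      using that d unfolding abs_le_iff by auto
    then have "\<bar>dx v (a, b)\<bar> \<le> (2 + \<bar>\<mu>\<bar>) * M / (d / 2)"
      using sub M d by (intro sol_grad_bound(1)[OF s]) (auto simp: subset_iff)
    then show ?thesis by (simp add: K_def algebra_simps)
  qed
  have k: "\<bar>(v (a + \<tau>, b) - v (a, b)) / \<tau>\<bar> \<le> 2 * K * M / d"
    if "\<bar>a - x\<bar> \<le> d / 4" "\<bar>b - y\<bar> \<le> d / 4" "0 < \<tau>" "\<tau> < d / 4" for a b \<tau>
  proof -
    have "\<exists>z. a < z \<and> z < a + \<tau> \<and> v (a + \<tau>, b) - v (a, b) = (a + \<tau> - a) * dx v (z, b)"
    proof (rule MVT2)
      fix z assume z: "a \<le> z" "z \<le> a + \<tau>"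
      have "x - d \<le> z" "z \<le> x + d" "y - d \<le> b" "b \<le> y + d" using that z by linarith+
      then have "(z, b) \<in> U" using sub by auto
      then show "((\<lambda>a. v (a, b)) has_real_derivative dx v (z, b)) (at z)" by (rule sol_dx[OF s])
    qed (use that in auto)
    then obtain z where z: "a < z" "z < a + \<tau>" "v (a + \<tau>, b) - v (a, b) = \<tau> * dx v (z, b)" by auto
    moreover have "\<bar>z - x\<bar> \<le> d / 2" "\<bar>b - y\<bar> \<le> d / 2" using that z by linarith+
    ultimately show ?thesis using that g[of z b] by simp
  qed
  define V where "V = {x-d/2<..<x+d/2} \<times> {y-d/2<..<y+d/2}"
  have main: "\<bar>(dx v (x + \<tau>, y) - dx v (x, y)) / \<tau>\<bar> \<le> ?B \<and> \<bar>(dy v (x + \<tau>, y) - dy v (x, y)) / \<tau>\<bar> \<le> ?B"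
    if \<tau>: "0 < \<tau>" "\<tau> < d / 4" for \<tau>
  proof -
    have VU: "V \<subseteq> U" "\<And>a b. (a, b) \<in> V \<Longrightarrow> (1 * a + \<tau>, 1 * b + 0) \<in> U"
      using sub \<tau> d unfolding V_def by (auto simp: subset_iff)
    have oV: "open V" unfolding V_def by (simp add: open_Times)
    have s1: "sol \<mu> (\<lambda>p. v (1 * fst p + \<tau>, 1 * snd p + 0)) V"
      by (rule sol_affine[OF s]) (use VU oV in auto)
    have s0: "sol \<mu> v V" by (rule sol_subset[OF s VU(1) oV])
    define q where "q p = 1/\<tau> * (v (1 * fst p + \<tau>, 1 * snd p + 0) + (-1) * v p)" for p
    have sq: "sol \<mu> q V" unfolding q_def by (intro sol_cmult sol_add s1 s0)
    have sb: "{x-d/4..x+d/4} \<times> {y-d/4..y+d/4} \<subseteq> V" unfolding V_def using d by auto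
    have qb: "\<bar>q p\<bar> \<le> 2 * K * M / d" if "p \<in> {x-d/4..x+d/4} \<times> {y-d/4..y+d/4}" for p
    proof -
      have "\<bar>fst p - x\<bar> \<le> d / 4" "\<bar>snd p - y\<bar> \<le> d / 4"
        using that by (simp_all only: mem_Times_iff atLeastAtMost_iff abs_le_iff) linarith+
      from k[OF this \<tau>] show ?thesis unfolding q_def by simp
    qed
    have xyV: "(x, y) \<in> V" using d unfolding V_def by auto
    have "dx q (x, y) = 1/\<tau> * (dx v (x + \<tau>, y) + (-1) * dx v (x, y))"
    proof (rule dx_eqI)
      have "((\<lambda>s. v (1 * fst (s, y) + \<tau>, 1 * snd (s, y) + 0)) has_real_derivative dx v (x + \<tau>, y)) (at x)"
        using sol_dx[OF s, of "x + \<tau>" y] VU(2)[OF xyV] DERIV_shift[of "\<lambda>s. v (s, y)" _ x \<tau>]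
        by (simp add: add.commute)
      from DERIV_cmult[OF DERIV_add[OF this DERIV_cmult[OF sol_dx[OF s0 xyV], of "-1"]], of "1/\<tau>"]
      show "((\<lambda>s. q (s, y)) has_real_derivative 1/\<tau> * (dx v (x + \<tau>, y) + (-1) * dx v (x, y))) (at x)"
        unfolding q_def .
    qed
    moreover have "dy q (x, y) = 1/\<tau> * (dy v (x + \<tau>, y) + (-1) * dy v (x, y))"
    proof (rule dy_eqI)
      have "((\<lambda>s. v (1 * fst (x, s) + \<tau>, 1 * snd (x, s) + 0)) has_real_derivative dy v (x + \<tau>, y)) (at y)"
        using sol_dy[OF s, of "x + \<tau>" y] VU(2)[OF xyV] by simp
      from DERIV_cmult[OF DERIV_add[OF this DERIV_cmult[OF sol_dy[OF s0 xyV], of "-1"]], of "1/\<tau>"]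
      show "((\<lambda>s. q (x, s)) has_real_derivative 1/\<tau> * (dy v (x + \<tau>, y) + (-1) * dy v (x, y))) (at y)"
        unfolding q_def .
    qed
    \<comment> \<open>The factor 8 is 2 * 4: half of the square is spent on bounding the quotient, a
      quarter on bounding its gradient.\<close>
    moreover have "(2 + \<bar>\<mu>\<bar>) * (2 * K * M / d) / (d / 4) = ?B"
      by (simp add: K_def power2_eq_square)
    ultimately show ?thesis
      using sol_grad_bound[OF sq _ _ sb qb] d by (simp add: diff_divide_distrib)
  qed
  have S: "(x, y) \<in> U" using sub d by auto
  have C: "Ck_on (Suc 0) (dx v) U" "Ck_on (Suc 0) (dy v) U" using sol_Suc[OF s] by auto
  have lim: "\<bar>D\<bar> \<le> ?B" if D: "((\<lambda>s. f (s, y)) has_real_derivative D) (at x)"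
    and b: "\<And>\<tau>. 0 < \<tau> \<Longrightarrow> \<tau> < d / 4 \<Longrightarrow> \<bar>(f (x + \<tau>, y) - f (x, y)) / \<tau>\<bar> \<le> ?B" for f D
  proof -
    have "((\<lambda>\<tau>. (f (x + \<tau>, y) - f (x, y)) / \<tau>) \<longlongrightarrow> D) (at 0)" using D unfolding DERIV_def .
    then have "((\<lambda>\<tau>. \<bar>(f (x + \<tau>, y) - f (x, y)) / \<tau>\<bar>) \<longlongrightarrow> \<bar>D\<bar>) (at_right 0)"
      by (intro tendsto_rabs) (rule tendsto_within_subset, auto)
    then show ?thesis
      by (rule tendsto_upperbound)
        (use b d in \<open>auto simp: eventually_at_right_field simp del: abs_divide intro!: exI[of _ "d/4"]\<close>)
  qed
  show "\<bar>dx (dx v) (x, y)\<bar> \<le> ?B" "\<bar>dx (dy v) (x, y)\<bar> \<le> ?B"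
    by (rule lim[OF Ck_on_dx[OF C(1) S]] lim[OF Ck_on_dx[OF C(2) S]]; use main in blast)+
qed

lemma sol_hess_bound:
  assumes s: "sol \<mu> v U" and d: "0 < d" "d \<le> 1" and sub: "{x-d..x+d} \<times> {y-d..y+d} \<subseteq> U"
    and M: "\<And>p. p \<in> {x-d..x+d} \<times> {y-d..y+d} \<Longrightarrow> \<bar>v p\<bar> \<le> M"
  shows "\<bar>dx (dx v) (x, y)\<bar> \<le> 8 * (2 + \<bar>\<mu>\<bar>)\<^sup>2 * M / d\<^sup>2"
    and "\<bar>dx (dy v) (x, y)\<bar> \<le> 8 * (2 + \<bar>\<mu>\<bar>)\<^sup>2 * M / d\<^sup>2"
    and "\<bar>dy (dx v) (x, y)\<bar> \<le> 8 * (2 + \<bar>\<mu>\<bar>)\<^sup>2 * M / d\<^sup>2"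
    and "\<bar>dy (dy v) (x, y)\<bar> \<le> 8 * (2 + \<bar>\<mu>\<bar>)\<^sup>2 * M / d\<^sup>2"
proof -
  define V where "V = (\<lambda>p. (snd p, fst p)) -` U"
  define w where "w = (\<lambda>p. v (snd p, fst p))"
  have "open V" unfolding V_def
    using sol_Ck(2)[OF s] by (intro open_vimage continuous_intros) auto
  then have sw: "sol \<mu> w V" unfolding w_def
    by (rule sol_swap[OF s]) (auto simp: V_def)
  have "dx w = (\<lambda>p. dy v (snd p, fst p))" "dy w = (\<lambda>p. dx v (snd p, fst p))"
    unfolding w_def using dx_swap dy_swap by (auto simp: fun_eq_iff)
  then have "dx (dx w) (y, x) = dy (dy v) (x, y)" "dx (dy w) (y, x) = dy (dx v) (x, y)"
    by (simp_all add: dx_swap)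
  moreover have "\<bar>dx (dx w) (y, x)\<bar> \<le> 8 * (2 + \<bar>\<mu>\<bar>)\<^sup>2 * M / d\<^sup>2" "\<bar>dx (dy w) (y, x)\<bar> \<le> 8 * (2 + \<bar>\<mu>\<bar>)\<^sup>2 * M / d\<^sup>2"
    by (rule sol_hess_bound_aux[OF sw d]; use sub M in \<open>auto simp: V_def w_def\<close>)+
  ultimately show "\<bar>dy (dx v) (x, y)\<bar> \<le> 8 * (2 + \<bar>\<mu>\<bar>)\<^sup>2 * M / d\<^sup>2"
    and "\<bar>dy (dy v) (x, y)\<bar> \<le> 8 * (2 + \<bar>\<mu>\<bar>)\<^sup>2 * M / d\<^sup>2" by auto
qed (use sol_hess_bound_aux[OF assms] in auto)

section \<open>Uniform limits of solutions\<close>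

lemma has_real_derivative_uniform_limit:
  fixes f g :: "nat \<Rightarrow> real \<Rightarrow> real"
  assumes S: "open S" "convex S" "x \<in> S"
    and d: "\<And>n s. s \<in> S \<Longrightarrow> (f n has_real_derivative g n s) (at s)"
    and g: "uniform_limit S g G sequentially"
    and f: "\<And>s. s \<in> S \<Longrightarrow> (\<lambda>n. f n s) \<longlonglongrightarrow> F s"
  shows "(F has_real_derivative G x) (at x)"
proof -
  have "\<exists>h. \<forall>s\<in>S. (\<lambda>n. f n s) \<longlonglongrightarrow> h s \<and> (h has_derivative (*) (G s)) (at s within S)"
  proof (rule has_derivative_sequence[where f=f and f'="\<lambda>n s. (*) (g n s)"])
    show "convex S" "x \<in> S" "(\<lambda>n. f n x) \<longlonglongrightarrow> F x" using S f by auto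
    show "(f n has_derivative (*) (g n s)) (at s within S)" if "s \<in> S" for n s
      using d[OF that] by (simp add: has_field_derivative_def has_derivative_at_withinI)
    show "\<forall>\<^sub>F n in sequentially. \<forall>s\<in>S. \<forall>h. norm (g n s * h - G s * h) \<le> e * norm h" if "e > 0" for e
      using uniform_limitD[OF g that]
      by (rule eventually_mono)
        (simp add: dist_real_def left_diff_distrib[symmetric] abs_mult mult_right_mono less_imp_le)
  qed
  then obtain h where h: "\<And>s. s \<in> S \<Longrightarrow> (\<lambda>n. f n s) \<longlonglongrightarrow> h s"
    "\<And>s. s \<in> S \<Longrightarrow> (h has_derivative (*) (G s)) (at s within S)" by blast
  have "h s = F s" if "s \<in> S" for s using LIMSEQ_unique[OF h(1) f] that by blast
  then have "(F has_derivative (*) (G x)) (at x within S)"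
    using has_derivative_transform[OF S(3) _ h(2)[OF S(3)], of F] by simp
  then show ?thesis
    using S at_within_open[of x S] by (simp add: has_field_derivative_def)
qed

text \<open>On a product of open convex sets every slice is open and convex, so a uniform limit may
  be differentiated along it.\<close>

lemma Ck1_uniform_limit:
  fixes f :: "nat \<Rightarrow> real \<times> real \<Rightarrow> real"
  assumes A: "open A" "convex A" and B: "open B" "convex B"
    and f: "\<And>n. Ck_on (Suc 0) (f n) (A \<times> B)" and g: "uniform_limit (A \<times> B) f g sequentially"
    and cx: "uniformly_Cauchy_on (A \<times> B) (\<lambda>n. dx (f n))"
    and cy: "uniformly_Cauchy_on (A \<times> B) (\<lambda>n. dy (f n))"
  shows "Ck_on (Suc 0) g (A \<times> B)"
    and "uniform_limit (A \<times> B) (\<lambda>n. dx (f n)) (dx g) sequentially"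
    and "uniform_limit (A \<times> B) (\<lambda>n. dy (f n)) (dy g) sequentially"
proof -
  obtain G H where G: "uniform_limit (A \<times> B) (\<lambda>n. dx (f n)) G sequentially"
    and H: "uniform_limit (A \<times> B) (\<lambda>n. dy (f n)) H sequentially"
    using Cauchy_uniformly_convergent[OF cx] Cauchy_uniformly_convergent[OF cy]
    unfolding uniformly_convergent_on_def by blast
  have conv: "(\<lambda>n. f n p) \<longlonglongrightarrow> g p" if "p \<in> A \<times> B" for p
    using tendsto_uniform_limitI[OF g that] .
  have gx: "((\<lambda>s. g (s, y)) has_real_derivative G (x, y)) (at x)" if "x \<in> A" "y \<in> B" for x y
  proof (rule has_real_derivative_uniform_limit[OF A that(1)])
    show "((\<lambda>s. f n (s, y)) has_real_derivative dx (f n) (s, y)) (at s)" if "s \<in> A" for n s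
      using Ck_on_dx[OF f] that \<open>y \<in> B\<close> by auto
    show "uniform_limit A (\<lambda>n s. dx (f n) (s, y)) (\<lambda>s. G (s, y)) sequentially"
      by (rule uniform_limit_compose'[OF G]) (use that in auto)
  qed (use conv that in auto)
  have gy: "((\<lambda>s. g (x, s)) has_real_derivative H (x, y)) (at y)" if "x \<in> A" "y \<in> B" for x y
  proof (rule has_real_derivative_uniform_limit[OF B that(2)])
    show "((\<lambda>s. f n (x, s)) has_real_derivative dy (f n) (x, s)) (at s)" if "s \<in> B" for n s
      using Ck_on_dy[OF f] that \<open>x \<in> A\<close> by auto
    show "uniform_limit B (\<lambda>n s. dy (f n) (x, s)) (\<lambda>s. H (x, s)) sequentially"
      by (rule uniform_limit_compose'[OF H]) (use that in auto)
  qed (use conv that in auto)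
  have cont: "continuous_on (A \<times> B) g" "continuous_on (A \<times> B) G" "continuous_on (A \<times> B) H"
    using f by (auto intro!: uniform_limit_theorem[OF _ g] uniform_limit_theorem[OF _ G] uniform_limit_theorem[OF _ H])
  show "Ck_on (Suc 0) g (A \<times> B)"
    by (rule Ck_on_SucI[where F=G and G=H]) (use A B gx gy cont in \<open>auto intro: open_Times\<close>)
  show "uniform_limit (A \<times> B) (\<lambda>n. dx (f n)) (dx g) sequentially"
    using G by (rule uniform_limit_cong'[THEN iffD1, rotated 2]) (use gx dx_eqI in force)+
  show "uniform_limit (A \<times> B) (\<lambda>n. dy (f n)) (dy g) sequentially"
    using H by (rule uniform_limit_cong'[THEN iffD1, rotated 2]) (use gy dy_eqI in force)+
qed

lemma Ck_on_local:
  assumes "\<And>p. p \<in> U \<Longrightarrow> \<exists>S. open S \<and> p \<in> S \<and> Ck_on k v S"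
  shows "Ck_on k v U"
  using assms
proof (induction k arbitrary: v)
  case 0
  have "isCont v p" if p: "p \<in> U" for p
    using 0[OF p] by (auto simp: continuous_on_eq_continuous_at)
  then show ?case by (auto intro: continuous_at_imp_continuous_on)
next
  case (Suc k)
  have "isCont v p" if p: "p \<in> U" for p
    using Suc.prems[OF p] by (auto simp: continuous_on_eq_continuous_at)
  then have "continuous_on U v" by (auto intro: continuous_at_imp_continuous_on)
  moreover have "Ck_on k (dx v) U" "Ck_on k (dy v) U"
    by (rule Suc.IH; use Suc.prems in fastforce)+
  moreover have "(\<lambda>s. v (s, snd p)) field_differentiable at (fst p) \<and> (\<lambda>t. v (fst p, t)) field_differentiable at (snd p)"
    if "p \<in> U" for p
    using Suc.prems[OF that] by (elim exE conjE) simp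
  ultimately show ?case by simp
qed

lemma dx_diff:
  assumes "Ck_on (Suc k) v U" "Ck_on (Suc l) w U" "p \<in> U"
  shows "dx (\<lambda>q. v q + (-1) * w q) p = dx v p - dx w p" "dy (\<lambda>q. v q + (-1) * w q) p = dy v p - dy w p"
proof -
  obtain x y where p: "p = (x, y)" by (cases p)
  show "dx (\<lambda>q. v q + (-1) * w q) p = dx v p - dx w p"
    unfolding p
    using DERIV_add[OF Ck_on_dx[OF assms(1)] DERIV_cmult[OF Ck_on_dx[OF assms(2)], of _ _ "-1"]] assms(3) p
    by (intro dx_eqI) fastforce
  show "dy (\<lambda>q. v q + (-1) * w q) p = dy v p - dy w p"
    unfolding p
    using DERIV_add[OF Ck_on_dy[OF assms(1)] DERIV_cmult[OF Ck_on_dy[OF assms(2)], of _ _ "-1"]] assms(3) p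
    by (intro dy_eqI) fastforce
qed

text \<open>Meant for \<open>F n\<close> a derivative of \<open>f n\<close>, where
  \<open>dom\<close> is an interior estimate for the difference of two solutions. Dividing by
  \<open>K + 1\<close> covers \<open>K = 0\<close>.\<close>

lemma uniformly_Cauchy_on_dominated:
  fixes f :: "nat \<Rightarrow> 'a \<Rightarrow> real" and F :: "nat \<Rightarrow> 'b \<Rightarrow> real"
  assumes f: "uniformly_Cauchy_on U f" and K: "K \<ge> 0"
    and dom: "\<And>n m e p. (\<And>q. q \<in> U \<Longrightarrow> \<bar>f n q - f m q\<bar> \<le> e) \<Longrightarrow> p \<in> S \<Longrightarrow> \<bar>F n p - F m p\<bar> \<le> K * e"
  shows "uniformly_Cauchy_on S F"
  unfolding uniformly_Cauchy_on_def
proof (intro allI impI)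
  fix e :: real assume e: "e > 0"
  then have "e / (K + 1) > 0" using K by simp
  then obtain N where N: "\<And>x m n. x \<in> U \<Longrightarrow> m \<ge> N \<Longrightarrow> n \<ge> N \<Longrightarrow> dist (f m x) (f n x) < e / (K + 1)"
    using f unfolding uniformly_Cauchy_on_def by blast
  have "K * (e / (K + 1)) < e" using e K by (simp add: field_simps)
  moreover have "\<bar>F m p - F n p\<bar> \<le> K * (e / (K + 1))" if "p \<in> S" "m \<ge> N" "n \<ge> N" for p m n
    by (rule dom[OF _ that(1)]) (use N that in \<open>force simp: dist_real_def intro: less_imp_le\<close>)
  ultimately show "\<exists>M. \<forall>p\<in>S. \<forall>m\<ge>M. \<forall>n\<ge>M. dist (F m p) (F n p) < e"
    unfolding dist_real_def by (meson le_less_trans)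
qed

lemma open_contains_square:
  fixes U :: "(real \<times> real) set"
  assumes "open U" "(x, y) \<in> U"
  obtains r where "r > 0" "r \<le> 1" "{x-r..x+r} \<times> {y-r..y+r} \<subseteq> U"
proof -
  obtain e where e: "e > 0" "cball (x, y) e \<subseteq> U" using assms open_contains_cball by blast
  define r where "r = min (e / 2) 1"
  have "{x-r..x+r} \<times> {y-r..y+r} \<subseteq> cball (x, y) e"
  proof
    fix p assume "p \<in> {x-r..x+r} \<times> {y-r..y+r}"
    then have "\<bar>fst p - x\<bar> \<le> r" "\<bar>snd p - y\<bar> \<le> r" by (auto simp: mem_Times_iff)
    moreover have "r \<le> e / 2" by (simp add: r_def)
    ultimately have "\<bar>fst p - x\<bar> \<le> e / 2" "\<bar>snd p - y\<bar> \<le> e / 2" by linarith+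
    then have "norm (p - (x, y)) \<le> e"
      using norm_Pair_le[of "fst p - x" "snd p - y"] by (cases p) simp
    then show "p \<in> cball (x, y) e" by (simp add: dist_norm norm_minus_commute)
  qed
  then show ?thesis using that[of r] e by (auto simp: r_def)
qed

text \<open>Differences of solutions are solutions, so the interior estimates for gradient and
  Hessian make all derivatives up to order two uniformly Cauchy on smaller squares, and the equation
  passes to the limit.\<close>

lemma sol_uniform_limit:
  assumes U: "open U" and h: "\<And>n. sol \<mu> (h n) U" and lim: "uniform_limit U h g sequentially"
  shows "sol \<mu> g U" "\<And>p. p \<in> U \<Longrightarrow> (\<lambda>n. dx (h n) p) \<longlonglongrightarrow> dx g p"
    "\<And>p. p \<in> U \<Longrightarrow> (\<lambda>n. dy (h n) p) \<longlonglongrightarrow> dy g p"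
proof -
  have Cau: "uniformly_Cauchy_on U h"
    using lim uniformly_convergent_Cauchy uniformly_convergentI by blast
  have main: "\<exists>S. open S \<and> p \<in> S \<and> S \<subseteq> U \<and> Ck_on 2 g S \<and> laplacian g p = - \<mu> * g p \<and>
      (\<lambda>n. dx (h n) p) \<longlonglongrightarrow> dx g p \<and> (\<lambda>n. dy (h n) p) \<longlonglongrightarrow> dy g p" if p: "p \<in> U" for p
  proof -
    obtain x y where xy: "p = (x, y)" by (cases p)
    obtain r where r: "r > 0" "r \<le> 1" "{x-r..x+r} \<times> {y-r..y+r} \<subseteq> U"
      using open_contains_square[OF U] p unfolding xy by blast
    define A B where "A = {x-r/2<..<x+r/2}" and "B = {y-r/2<..<y+r/2}"
    have AB: "open A" "convex A" "open B" "convex B" unfolding A_def B_def by auto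
    have S: "p \<in> A \<times> B" "A \<times> B \<subseteq> U" "open (A \<times> B)"
      using r AB unfolding A_def B_def xy by (auto intro!: open_Times simp: subset_iff)
    have sq: "{a-r/2..a+r/2} \<times> {b-r/2..b+r/2} \<subseteq> U" if "(a, b) \<in> A \<times> B" for a b
      using that r unfolding A_def B_def by (force simp: subset_iff)
    define K where "K = (2 + \<bar>\<mu>\<bar>) / (r/2)"
    define K2 where "K2 = 8 * (2 + \<bar>\<mu>\<bar>)\<^sup>2 / (r/2)\<^sup>2"
    have K: "K \<ge> 0" "K2 \<ge> 0" unfolding K_def K2_def using r by auto
    have C: "Ck_on (Suc 1) (h n) U" "Ck_on (Suc 0) (dx (h n)) U" "Ck_on (Suc 0) (dy (h n)) U" for n
      using sol_Suc[OF h[of n]] by auto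
    have sd: "sol \<mu> (\<lambda>q. h n q + (-1) * h m q) U" for n m
      by (intro sol_add sol_cmult h)
    have dxd: "dx (\<lambda>q. h n q + (-1) * h m q) q = dx (h n) q - dx (h m) q"
      "dy (\<lambda>q. h n q + (-1) * h m q) q = dy (h n) q - dy (h m) q" if "q \<in> U" for n m q
      by (rule dx_diff[OF C(1) C(1) that])+
    have d2: "dx (dx (\<lambda>q. h n q + (-1) * h m q)) q = dx (dx (h n)) q - dx (dx (h m)) q"
      "dy (dx (\<lambda>q. h n q + (-1) * h m q)) q = dy (dx (h n)) q - dy (dx (h m)) q"
      "dx (dy (\<lambda>q. h n q + (-1) * h m q)) q = dx (dy (h n)) q - dx (dy (h m)) q"
      "dy (dy (\<lambda>q. h n q + (-1) * h m q)) q = dy (dy (h n)) q - dy (dy (h m)) q" if "q \<in> U" for n m q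
      using dx_diff[OF C(2) C(2) that, of n m] dx_diff[OF C(3) C(3) that, of n m]
        dx_cong[OF U that dxd(1)[of _ n m, unfolded minus_mult_left[symmetric]]]
        dx_cong[OF U that, of "dx (\<lambda>q. h n q + (-1) * h m q)" "\<lambda>q. dx (h n) q + (-1) * dx (h m) q"]
        dy_cong[OF U that, of "dx (\<lambda>q. h n q + (-1) * h m q)" "\<lambda>q. dx (h n) q + (-1) * dx (h m) q"]
        dx_cong[OF U that, of "dy (\<lambda>q. h n q + (-1) * h m q)" "\<lambda>q. dy (h n) q + (-1) * dy (h m) q"]
        dy_cong[OF U that, of "dy (\<lambda>q. h n q + (-1) * h m q)" "\<lambda>q. dy (h n) q + (-1) * dy (h m) q"]
        dxd by simp_all
    have e1: "\<bar>dx (h n) q - dx (h m) q\<bar> \<le> K * e" "\<bar>dy (h n) q - dy (h m) q\<bar> \<le> K * e"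
      "\<bar>dx (dx (h n)) q - dx (dx (h m)) q\<bar> \<le> K2 * e" "\<bar>dy (dx (h n)) q - dy (dx (h m)) q\<bar> \<le> K2 * e"
      "\<bar>dx (dy (h n)) q - dx (dy (h m)) q\<bar> \<le> K2 * e" "\<bar>dy (dy (h n)) q - dy (dy (h m)) q\<bar> \<le> K2 * e"
      if e: "\<And>q. q \<in> U \<Longrightarrow> \<bar>h n q - h m q\<bar> \<le> e" and q: "q \<in> A \<times> B" for n m e q
    proof -
      obtain a b where ab: "q = (a, b)" by (cases q)
      have sq': "{a-r/2..a+r/2} \<times> {b-r/2..b+r/2} \<subseteq> U" using sq q ab by blast
      have e': "\<bar>h n q' + (-1) * h m q'\<bar> \<le> e" if "q' \<in> {a-r/2..a+r/2} \<times> {b-r/2..b+r/2}" for q'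
        using e[of q'] sq' that by auto
      have qU: "q \<in> U" using q S by blast
      have Ke: "K * e = (2 + \<bar>\<mu>\<bar>) * e / (r/2)" and K2e: "K2 * e = 8 * (2 + \<bar>\<mu>\<bar>)\<^sup>2 * e / (r/2)\<^sup>2"
        by (simp_all add: K_def K2_def)
      show "\<bar>dx (h n) q - dx (h m) q\<bar> \<le> K * e" "\<bar>dy (h n) q - dy (h m) q\<bar> \<le> K * e"
        using sol_grad_bound[OF sd _ _ sq' e'] r(1,2) dxd[OF qU, of n m] unfolding ab Ke by simp_all
      show "\<bar>dx (dx (h n)) q - dx (dx (h m)) q\<bar> \<le> K2 * e" "\<bar>dy (dx (h n)) q - dy (dx (h m)) q\<bar> \<le> K2 * e"
        "\<bar>dx (dy (h n)) q - dx (dy (h m)) q\<bar> \<le> K2 * e" "\<bar>dy (dy (h n)) q - dy (dy (h m)) q\<bar> \<le> K2 * e"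
        using sol_hess_bound[OF sd _ _ sq' e'] r(1,2) d2[OF qU, of n m] unfolding ab K2e by simp_all
    qed
    have cau: "uniformly_Cauchy_on (A \<times> B) (\<lambda>n. dx (h n))" "uniformly_Cauchy_on (A \<times> B) (\<lambda>n. dy (h n))"
      "uniformly_Cauchy_on (A \<times> B) (\<lambda>n. dx (dx (h n)))" "uniformly_Cauchy_on (A \<times> B) (\<lambda>n. dy (dx (h n)))"
      "uniformly_Cauchy_on (A \<times> B) (\<lambda>n. dx (dy (h n)))" "uniformly_Cauchy_on (A \<times> B) (\<lambda>n. dy (dy (h n)))"
      by (rule uniformly_Cauchy_on_dominated[OF Cau K(1) e1(1)] uniformly_Cauchy_on_dominated[OF Cau K(1) e1(2)]
          uniformly_Cauchy_on_dominated[OF Cau K(2) e1(3)] uniformly_Cauchy_on_dominated[OF Cau K(2) e1(4)]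
          uniformly_Cauchy_on_dominated[OF Cau K(2) e1(5)] uniformly_Cauchy_on_dominated[OF Cau K(2) e1(6)]; assumption)+
    have limS: "uniform_limit (A \<times> B) h g sequentially" using uniform_limit_on_subset[OF lim S(2)] .
    have CS: "Ck_on (Suc 0) (h n) (A \<times> B)" "Ck_on (Suc 0) (dx (h n)) (A \<times> B)" "Ck_on (Suc 0) (dy (h n)) (A \<times> B)" for n
      using Ck_on_subset[OF _ S(2)] Ck_on_Suc_D[of "Suc 0"] C by (metis One_nat_def)+
    note L0 = Ck1_uniform_limit[OF AB CS(1) limS cau(1,2)]
    note Lx = Ck1_uniform_limit[OF AB CS(2) L0(2) cau(3,4)]
    note Ly = Ck1_uniform_limit[OF AB CS(3) L0(3) cau(5,6)]
    have "Ck_on 2 g (A \<times> B)" using L0(1) Lx(1) Ly(1) by (simp add: eval_nat_numeral)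
    moreover have "laplacian g p = - \<mu> * g p"
    proof (rule LIMSEQ_unique)
      show "(\<lambda>n. laplacian (h n) p) \<longlonglongrightarrow> laplacian g p"
        unfolding laplacian_def
        by (intro tendsto_add tendsto_uniform_limitI[OF Lx(2) S(1)] tendsto_uniform_limitI[OF Ly(3) S(1)])
      have "(\<lambda>n. - \<mu> * h n p) \<longlonglongrightarrow> - \<mu> * g p"
        by (intro tendsto_mult tendsto_const tendsto_uniform_limitI[OF limS S(1)])
      then show "(\<lambda>n. laplacian (h n) p) \<longlonglongrightarrow> - \<mu> * g p"
        using h p unfolding sol_def by simp
    qed
    moreover have "(\<lambda>n. dx (h n) p) \<longlonglongrightarrow> dx g p" "(\<lambda>n. dy (h n) p) \<longlonglongrightarrow> dy g p"
      by (rule tendsto_uniform_limitI[OF L0(2) S(1)] tendsto_uniform_limitI[OF L0(3) S(1)])+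
    ultimately show ?thesis using S by blast
  qed
  show "sol \<mu> g U" unfolding sol_def
    using U main Ck_on_local[of U 2 g] by blast
  show "\<And>p. p \<in> U \<Longrightarrow> (\<lambda>n. dx (h n) p) \<longlonglongrightarrow> dx g p"
    "\<And>p. p \<in> U \<Longrightarrow> (\<lambda>n. dy (h n) p) \<longlonglongrightarrow> dy g p"
    using main by blast+
qed

section \<open>Smoothness of solutions\<close>

lemma sol_local:
  assumes "open U" "\<And>p. p \<in> U \<Longrightarrow> \<exists>S. p \<in> S \<and> sol \<mu> v S"
  shows "sol \<mu> v U"
proof -
  have "Ck_on 2 v U"
  proof (rule Ck_on_local)
    fix p assume "p \<in> U"
    then obtain S where "p \<in> S" "sol \<mu> v S" using assms(2) by blast
    then show "\<exists>S. open S \<and> p \<in> S \<and> Ck_on 2 v S" using sol_Ck by (intro exI[of _ S]) simp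
  qed
  moreover have "laplacian v p = - \<mu> * v p" if p: "p \<in> U" for p
  proof -
    obtain S where "p \<in> S" "sol \<mu> v S" using assms(2)[OF p] by blast
    then show ?thesis by (simp add: sol_def)
  qed
  ultimately show ?thesis using assms(1) by (simp add: sol_def)
qed

text \<open>The difference quotients in x are solutions that converge uniformly to
  \<open>dx v\<close>, which is therefore a solution and gains a derivative. Their y-derivatives
  converge to \<open>dy (dx v)\<close> and, being difference quotients of \<open>dy v\<close>, also
  to \<open>dx (dy v)\<close>.\<close>

lemma difference_quotients_near:
  assumes s: "sol \<mu> v U" and p: "(x, y) \<in> U"
  shows "\<exists>S. open S \<and> (x, y) \<in> S \<and> S \<subseteq> U \<and> sol \<mu> (dx v) S \<and> dy (dx v) (x, y) = dx (dy v) (x, y)"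
proof -
  obtain r where r: "r > 0" "r \<le> 1" "{x-r..x+r} \<times> {y-r..y+r} \<subseteq> U"
    using open_contains_square[OF sol_Ck(2)[OF s] p] by blast
  define S where "S = {x-r/2<..<x+r/2} \<times> {y-r/2<..<y+r/2}"
  define \<tau> where "\<tau> n = r / 4 * inverse (real (Suc n))" for n
  have \<tau>: "0 < \<tau> n" "\<tau> n \<le> r / 4" for n
    unfolding \<tau>_def using r(1) by (auto simp: field_simps)
  have \<tau>0: "\<tau> \<longlonglongrightarrow> 0"
    unfolding \<tau>_def using tendsto_mult[OF tendsto_const[of "r/4"] LIMSEQ_inverse_real_of_nat] by simp
  have S: "open S" "(x, y) \<in> S" "S \<subseteq> U" using r unfolding S_def by (auto intro: open_Times simp: subset_iff)
  have seg: "(a + t, b) \<in> {x-r..x+r} \<times> {y-r..y+r}" if "(a, b) \<in> S" "0 \<le> t" "t \<le> \<tau> n" for a b t n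
    using that \<tau>[of n] unfolding S_def by auto
  define h where "h n q = 1 / \<tau> n * (v (1 * fst q + \<tau> n, 1 * snd q + 0) + (-1) * v q)" for n q
  have hs: "sol \<mu> (h n) S" for n
    unfolding h_def
  proof (intro sol_cmult sol_add)
    show "sol \<mu> (\<lambda>p. v (1 * fst p + \<tau> n, 1 * snd p + 0)) S"
      by (rule sol_affine[OF s]) (use S seg[of _ _ "\<tau> n" n] \<tau>[of n] r(3) in \<open>auto simp: less_imp_le subset_iff\<close>)
    show "sol \<mu> v S" using sol_subset[OF s S(3,1)] .
  qed
  have lim: "uniform_limit S h (dx v) sequentially"
  proof (rule uniform_limitI)
    fix e :: real assume e: "e > 0"
    \<comment> \<open>Each quotient is a value of \<open>dx v\<close> at a point within
      \<open>\<tau> n\<close>, so uniform continuity on the compact square yields uniform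
      convergence.\<close>
    have "uniformly_continuous_on ({x-r..x+r} \<times> {y-r..y+r}) (dx v)"
      by (intro compact_uniformly_continuous continuous_on_subset[OF sol_cont_dx(1)[OF s] r(3)] compact_Times) auto
    then obtain \<delta> where \<delta>: "\<delta> > 0" "\<And>p q. p \<in> {x-r..x+r} \<times> {y-r..y+r} \<Longrightarrow> q \<in> {x-r..x+r} \<times> {y-r..y+r} \<Longrightarrow>
        dist q p < \<delta> \<Longrightarrow> dist (dx v q) (dx v p) < e"
      using e unfolding uniformly_continuous_on_def by metis
    have "\<forall>\<^sub>F n in sequentially. \<tau> n < \<delta>" using \<tau>0 \<delta>(1) by (rule order_tendstoD)
    then show "\<forall>\<^sub>F n in sequentially. \<forall>q\<in>S. dist (h n q) (dx v q) < e"
    proof (rule eventually_mono, intro ballI)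
      fix n q assume n: "\<tau> n < \<delta>" and q: "q \<in> S"
      obtain a b where ab: "q = (a, b)" by (cases q)
      have "\<exists>z. a < z \<and> z < a + \<tau> n \<and> v (a + \<tau> n, b) - v (a, b) = (a + \<tau> n - a) * dx v (z, b)"
      proof (rule MVT2)
        fix z assume z: "a \<le> z" "z \<le> a + \<tau> n"
        have "(z, b) \<in> U" using seg[of a b "z - a" n] z q r(3) ab by auto
        then show "((\<lambda>a. v (a, b)) has_real_derivative dx v (z, b)) (at z)" by (rule sol_dx[OF s])
      qed (use \<tau>[of n] in auto)
      then obtain z where z: "a < z" "z < a + \<tau> n" "v (a + \<tau> n, b) - v (a, b) = \<tau> n * dx v (z, b)" by auto
      have "h n q = dx v (z, b)" unfolding h_def ab using z(3) \<tau>[of n] by simp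
      moreover have "dist (z, b) (a, b) < \<delta>" using z n by (simp add: dist_Pair_Pair dist_real_def)
      then have "dist (dx v (z, b)) (dx v (a, b)) < e"
        using \<delta>(2)[of "(a, b)" "(z, b)"] seg[of a b "z - a" n] seg[of a b 0 n] z q ab \<tau>[of n] by simp
      ultimately show "dist (h n q) (dx v q) < e" using ab by simp
    qed
  qed
  have "dy (h n) (x, y) = (dy v (x + \<tau> n, y) - dy v (x, y)) / \<tau> n" for n
  proof (rule dy_eqI)
    have 1: "(1 * x + \<tau> n, 1 * y + 0) \<in> U" using seg[of x y "\<tau> n" n] S(2) \<tau>[of n] r(3) by auto
    have 2: "((\<lambda>s. v (1 * fst (x, s) + \<tau> n, 1 * snd (x, s) + 0)) has_real_derivative dy v (x + \<tau> n, y)) (at y)"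
      using sol_dy[OF s 1] by simp
    have "((\<lambda>s. h n (x, s)) has_real_derivative 1 / \<tau> n * (dy v (x + \<tau> n, y) + (-1) * dy v (x, y))) (at y)"
      unfolding h_def by (rule DERIV_cmult[OF DERIV_add[OF 2 DERIV_cmult[OF sol_dy[OF s p]]]])
    then show "((\<lambda>s. h n (x, s)) has_real_derivative (dy v (x + \<tau> n, y) - dy v (x, y)) / \<tau> n) (at y)" by simp
  qed
  then have "(\<lambda>n. (dy v (x + \<tau> n, y) - dy v (x, y)) / \<tau> n) \<longlonglongrightarrow> dy (dx v) (x, y)"
    using sol_uniform_limit(3)[OF S(1) hs lim S(2)] by simp
  moreover have "(\<lambda>n. (dy v (x + \<tau> n, y) - dy v (x, y)) / \<tau> n) \<longlonglongrightarrow> dx (dy v) (x, y)"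
  proof -
    have "Ck_on (Suc 0) (dy v) U" using sol_Suc[OF s] by simp
    from Ck_on_dx[OF this p] have "((\<lambda>t. (dy v (x + t, y) - dy v (x, y)) / t) \<longlongrightarrow> dx (dy v) (x, y)) (at 0)"
      unfolding DERIV_def .
    moreover have "filterlim \<tau> (at 0) sequentially"
      using \<tau>0 \<tau>(1) by (auto simp: filterlim_at less_imp_neq[symmetric])
    ultimately show ?thesis by (rule filterlim_compose)
  qed
  ultimately have "dy (dx v) (x, y) = dx (dy v) (x, y)" by (rule LIMSEQ_unique)
  then show ?thesis using S sol_uniform_limit(1)[OF S(1) hs lim] by blast
qed

text \<open>As \<open>sol\<close> contains two continuous derivatives, iterating this and its
  analogue in y makes derivatives of every order available.\<close>

lemma sol_dx_sol:
  assumes "sol \<mu> v U" shows "sol \<mu> (dx v) U"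
proof (rule sol_local)
  show "\<exists>S. p \<in> S \<and> sol \<mu> (dx v) S" if "p \<in> U" for p
    using difference_quotients_near[OF assms, of "fst p" "snd p"] that by auto
qed (use assms sol_Ck in blast)

lemma dy_dx_commute: "sol \<mu> v U \<Longrightarrow> (x, y) \<in> U \<Longrightarrow> dy (dx v) (x, y) = dx (dy v) (x, y)"
  using difference_quotients_near by blast

lemma sol_dy_sol:
  assumes s: "sol \<mu> v U" shows "sol \<mu> (dy v) U"
proof -
  define V where "V = (\<lambda>p. (snd p, fst p)) -` U"
  define w where "w = (\<lambda>p. v (snd p, fst p))"
  have "open V" unfolding V_def
    using sol_Ck(2)[OF s] by (intro open_vimage continuous_intros) auto
  then have "sol \<mu> w V" unfolding w_def
    by (rule sol_swap[OF s]) (auto simp: V_def)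
  then have "sol \<mu> (dx w) V" by (rule sol_dx_sol)
  then have "sol \<mu> (\<lambda>p. dx w (snd p, fst p)) U"
    by (rule sol_swap) (use sol_Ck(2)[OF s] in \<open>auto simp: V_def\<close>)
  moreover have "(\<lambda>p. dx w (snd p, fst p)) = dy v"
    unfolding w_def using dx_swap by (auto simp: fun_eq_iff)
  ultimately show ?thesis by simp
qed

section \<open>The Darboux transform\<close>

text \<open>\<open>ctg\<close> is the logarithmic derivative of \<open>sin (\<pi> y)\<close>, hence its factor \<open>\<pi>\<close>, which \<open>csc\<close> lacks.\<close>

definition ctg :: "real \<Rightarrow> real" where "ctg y = pi * cos (pi * y) / sin (pi * y)"

definition csc :: "real \<Rightarrow> real" where "csc y = 1 / sin (pi * y)"

lemma sin_pi_pos: "0 < y \<Longrightarrow> y < 1 \<Longrightarrow> sin (pi * y) > 0"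
  by (rule sin_gt_zero) (use mult_strict_left_mono[of y 1 pi] in auto)

lemma ctg_csc: assumes "0 < y" "y < 1" shows "pi\<^sup>2 * (csc y)\<^sup>2 = pi\<^sup>2 + (ctg y)\<^sup>2"
proof -
  have "sin (pi * y) > 0" using sin_pi_pos[OF assms] .
  moreover have "(cos (pi * y))\<^sup>2 = 1 - (sin (pi * y))\<^sup>2" by (simp add: cos_squared_eq)
  ultimately show ?thesis unfolding ctg_def csc_def
    by (simp add: power_divide power_mult_distrib divide_simps) (simp add: algebra_simps)
qed

lemma ctg_deriv: assumes "0 < y" "y < 1"
  shows "(ctg has_real_derivative (- pi\<^sup>2 - (ctg y)\<^sup>2)) (at y)"
proof -
  have s: "sin (pi * y) \<noteq> 0" using sin_pi_pos[OF assms] by simp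
  have "((\<lambda>y. pi * cos (pi * y) / sin (pi * y)) has_real_derivative
     ((pi * (- sin (pi * y) * pi)) * sin (pi * y) - (pi * cos (pi * y)) * (cos (pi * y) * pi)) / (sin (pi * y) * sin (pi * y))) (at y)"
    using s by (auto intro!: derivative_eq_intros)
  moreover have "((pi * (- sin (pi * y) * pi)) * sin (pi * y) - (pi * cos (pi * y)) * (cos (pi * y) * pi)) / (sin (pi * y) * sin (pi * y))
    = - pi\<^sup>2 - (ctg y)\<^sup>2"
    using s unfolding ctg_def by (simp add: field_simps power2_eq_square)
  ultimately show ?thesis unfolding ctg_def[abs_def] by simp
qed

lemma csc_deriv: assumes "0 < y" "y < 1"
  shows "(csc has_real_derivative (- ctg y * csc y)) (at y)"
proof -
  have s: "sin (pi * y) \<noteq> 0" using sin_pi_pos[OF assms] by simp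
  have "((\<lambda>y. 1 / sin (pi * y)) has_real_derivative - (cos (pi * y) * pi) / (sin (pi * y) * sin (pi * y))) (at y)"
    using s by (auto intro!: derivative_eq_intros)
  then show ?thesis unfolding ctg_def csc_def[abs_def] using s by (simp add: field_simps)
qed

lemma d2_at_csc: assumes "0 < y" "y < 1"
  shows "d2_at csc y ((pi\<^sup>2 + 2 * (ctg y)\<^sup>2) * csc y)"
proof (rule d2_atI_open[where S="{0<..<1}" and g="\<lambda>y. - ctg y * csc y"])
  have "((\<lambda>y. - ctg y * csc y) has_real_derivative
     (- (- pi\<^sup>2 - (ctg y)\<^sup>2) * csc y + (- ctg y * csc y) * - ctg y)) (at y)"
    by (rule DERIV_mult[OF DERIV_minus[OF ctg_deriv[OF assms]] csc_deriv[OF assms]])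
  then show "((\<lambda>y. - ctg y * csc y) has_real_derivative (pi\<^sup>2 + 2 * (ctg y)\<^sup>2) * csc y) (at y)"
    by (simp add: algebra_simps power2_eq_square)
qed (use assms csc_deriv in auto)

lemma d2_at_mult:
  assumes "open S" "x \<in> S"
    and "\<And>s. s \<in> S \<Longrightarrow> (f has_real_derivative f' s) (at s)" "(f' has_real_derivative f'') (at x)"
    and "\<And>s. s \<in> S \<Longrightarrow> (g has_real_derivative g' s) (at s)" "(g' has_real_derivative g'') (at x)"
  shows "d2_at (\<lambda>s. f s * g s) x (f'' * g x + 2 * f' x * g' x + f x * g'')"
proof (rule d2_atI_open[OF assms(1,2)])
  show "((\<lambda>s. f s * g s) has_real_derivative f' s * g s + f s * g' s) (at s)" if "s \<in> S" for s
    using DERIV_mult[OF assms(3)[OF that] assms(5)[OF that]] by (simp add: algebra_simps)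
  have "((\<lambda>s. f' s * g s + f s * g' s) has_real_derivative
     (f'' * g x + g' x * f' x + (f' x * g' x + g'' * f x))) (at x)"
    by (rule DERIV_add[OF DERIV_mult[OF assms(4) assms(5)[OF assms(2)]]
          DERIV_mult[OF assms(3)[OF assms(2)] assms(6)]])
  then show "((\<lambda>s. f' s * g s + f s * g' s) has_real_derivative
     f'' * g x + 2 * f' x * g' x + f x * g'') (at x)" by (simp add: algebra_simps)
qed

lemma lap_at_mult_snd:
  assumes s: "sol \<mu> v U" and p: "(x, y) \<in> U"
    and c: "open S" "y \<in> S" "\<And>t. t \<in> S \<Longrightarrow> (c has_real_derivative c' t) (at t)" "(c' has_real_derivative c'') (at y)"
  shows "lap_at (\<lambda>q. c (snd q) * v q) (x, y) (c y * (- \<mu> * v (x, y)) + 2 * c' y * dy v (x, y) + c'' * v (x, y))"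
proof -
  obtain e where e: "e > 0" "\<And>t. dist t y < e \<Longrightarrow> (x, t) \<in> U"
    using eventually_slice(2)[OF sol_Ck(2)[OF s] p] unfolding eventually_nhds_metric by auto
  have C: "Ck_on (Suc 0) (dy v) U" using sol_Suc[OF s] by simp
  have lap: "dx (dx v) (x, y) + dy (dy v) (x, y) = - \<mu> * v (x, y)"
    using s p unfolding sol_def laplacian_def by auto
  have "d2_at (\<lambda>t. c t * v (x, t)) y (c'' * v (x, y) + 2 * c' y * dy v (x, y) + c y * dy (dy v) (x, y))"
  proof (rule d2_at_mult[where S="S \<inter> ball y e"])
    show "((\<lambda>t. v (x, t)) has_real_derivative dy v (x, t)) (at t)" if "t \<in> S \<inter> ball y e" for t
      by (rule sol_dy[OF s]) (use that e in \<open>auto simp: dist_commute\<close>)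
    show "((\<lambda>t. dy v (x, t)) has_real_derivative dy (dy v) (x, y)) (at y)" using Ck_on_dy[OF C p] .
  qed (use c e in auto)
  moreover have "d2_at (\<lambda>t. c y * v (t, y)) x (c y * dx (dx v) (x, y))"
    using d2_at_cmult[OF d2_at_dx[OF sol_Ck(2)[OF s] sol_Ck(1)[OF s] p]] by simp
  moreover have "c y * dx (dx v) (x, y) + (c'' * v (x, y) + 2 * c' y * dy v (x, y) + c y * dy (dy v) (x, y))
     = c y * (- \<mu> * v (x, y)) + 2 * c' y * dy v (x, y) + c'' * v (x, y)"
    unfolding lap[symmetric] by (simp add: algebra_simps)
  ultimately show ?thesis unfolding lap_at_def by force
qed

text \<open>The Darboux transform of \<open>v\<close> with respect to the first mode \<open>sin (\<pi> y)\<close>, which it annihilates: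
  the potential \<open>2 \<pi>\<^sup>2 / sin\<^sup>2\<close> it creates makes positive constants strict supersolutions.\<close>

definition darboux :: "(real \<times> real \<Rightarrow> real) \<Rightarrow> real \<times> real \<Rightarrow> real" where
  "darboux v q = dy v q - ctg (snd q) * v q"

text \<open>The function c = \<open>ctg\<close> satisfies the Riccati equation c' = - \<pi>^2 - c^2,
  hence c'' = - 2 c c'. The terms - 2 c' v_y and - c'' v produced by the product rule therefore
  combine to - 2 c' (v_y - c v), a multiple of the transform itself.\<close>

lemma lap_at_darboux:
  assumes s: "sol \<mu> v U" and p: "(x, y) \<in> U" and y: "0 < y" "y < 1"
  shows "lap_at (darboux v) (x, y) (- (\<mu> - 2 * pi\<^sup>2 - 2 * (ctg y)\<^sup>2) * darboux v (x, y))"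
proof -
  have "((\<lambda>y. - pi\<^sup>2 - (ctg y)\<^sup>2) has_real_derivative - (2 * ctg y * (- pi\<^sup>2 - (ctg y)\<^sup>2))) (at y)"
    by (auto intro!: derivative_eq_intros ctg_deriv y)
  from lap_at_mult_snd[OF s p, of "{0<..<1}", OF _ _ ctg_deriv this]
  have "lap_at (\<lambda>q. ctg (snd q) * v q) (x, y) (ctg y * (- \<mu> * v (x, y)) + 2 * (- pi\<^sup>2 - (ctg y)\<^sup>2) * dy v (x, y) +
      - (2 * ctg y * (- pi\<^sup>2 - (ctg y)\<^sup>2)) * v (x, y))" using y by auto
  from lap_at_diff[OF sol_lap_at[OF sol_dy_sol[OF s] p] this]
  show ?thesis unfolding darboux_def[abs_def] by (simp add: algebra_simps)
qed

lemma csc_ge_1: assumes "0 < y" "y < 1" shows "csc y \<ge> 1"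
  unfolding csc_def using sin_pi_pos[OF assms] by (simp add: le_divide_eq)

lemma pi_sq_gt_9: "pi\<^sup>2 > 9" "pi\<^sup>2 < 16"
proof -
  have "3 * 3 < pi * pi" using pi_gt3 by (intro mult_strict_mono) auto
  then show "pi\<^sup>2 > 9" by (simp add: power2_eq_square)
  have "pi * pi < 4 * 4" using pi_less_4 by (intro mult_strict_mono) auto
  then show "pi\<^sup>2 < 16" by (simp add: power2_eq_square)
qed

lemma d2_at_cosh: "d2_at (\<lambda>s. cosh (s - x0)) x (cosh (x - x0 :: real))"
  by (rule d2_atI[where g="\<lambda>s. sinh (s - x0)"]) (auto intro!: derivative_eq_intros)

text \<open>Since sin (\<pi> \<delta>) \<le> 4 \<delta>, the function
  \<open>4 * A * \<delta> * csc\<close> dominates \<open>A\<close> on the horizontal sides although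
  it is only of size \<open>A * \<delta>\<close> inside. The term in cosh carries the lateral data
  and decays exponentially towards the centre.\<close>

lemma darboux_le:
  assumes s: "sol \<mu> v U" and \<sigma>: "\<sigma> = 1 \<or> \<sigma> = -1"
    and R: "{x0-X..x0+X} \<times> {\<delta>..1-\<delta>} \<subseteq> U"
    and X: "X > 0" and \<delta>: "0 < \<delta>" "\<delta> < 1/2" and \<mu>: "\<bar>\<mu> - pi\<^sup>2\<bar> \<le> 1"
    and A: "\<And>x. x \<in> {x0-X..x0+X} \<Longrightarrow> \<bar>darboux v (x, \<delta>)\<bar> \<le> A \<and> \<bar>darboux v (x, 1-\<delta>)\<bar> \<le> A"
    and B: "\<And>y. y \<in> {\<delta>..1-\<delta>} \<Longrightarrow> \<bar>darboux v (x0-X, y)\<bar> \<le> B \<and> \<bar>darboux v (x0+X, y)\<bar> \<le> B"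
    and p: "(x, y) \<in> {x0-X..x0+X} \<times> {\<delta>..1-\<delta>}"
  shows "\<sigma> * darboux v (x, y) \<le> 4 * A * \<delta> * (csc y + 1) + B / cosh X * cosh (x - x0)"
proof (rule field_le_epsilon)
  fix e :: real assume e: "e > 0"
  define D where "D = {x0-X<..<x0+X} \<times> {\<delta><..<1-\<delta>}"
  have clD: "closure D = {x0-X..x0+X} \<times> {\<delta>..1-\<delta>}"
    using X \<delta> unfolding D_def by (simp add: closure_Times)
  have A0: "A \<ge> 0" using A[of x0] X by auto
  have B0: "B \<ge> 0" using B[of \<delta>] \<delta> by auto
  define \<psi> where "\<psi> q = B / cosh X * cosh (fst q - x0) + (4 * A * \<delta> * (csc (snd q) + 1) + e)" for q :: "real \<times> real"
  have \<psi>pos: "4 * A * \<delta> * (csc b + 1) \<ge> 0" if "\<delta> \<le> b" "b \<le> 1 - \<delta>" for b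
    using A0 \<delta> csc_ge_1[of b] that by auto
  have \<psi>pos': "B / cosh X * cosh (a - x0) \<ge> 0" for a
    using B0 by auto
  have "\<sigma> * darboux v (x, y) \<le> \<psi> (x, y)"
  proof (rule comparison_principle[where D=D and v="\<lambda>q. \<sigma> * darboux v q" and \<psi>=\<psi> and q="\<lambda>q. \<mu> - 2 * pi\<^sup>2 - 2 * (ctg (snd q))\<^sup>2"])
    show "open D" "bounded D" unfolding D_def by (auto intro: open_Times bounded_Times)
    have nz: "sin (pi * b) \<noteq> 0" if "\<delta> \<le> b" "b \<le> 1 - \<delta>" for b
      using sin_pi_pos[of b] that \<delta> by simp
    show "continuous_on (closure D) (\<lambda>q. \<sigma> * darboux v q)"
      unfolding darboux_def ctg_def clD using nz R
      by (intro continuous_intros continuous_on_subset[OF sol_cont_dx(2)[OF s]] continuous_on_subset[OF sol_cont[OF s]]) auto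
    show "continuous_on (closure D) \<psi>"
      unfolding \<psi>_def csc_def clD using nz
      by (intro continuous_intros continuous_on_compose2[OF continuous_on_cosh[OF continuous_on_id]]) auto
    show "\<psi> q > 0" if "q \<in> closure D" for q
      using that \<psi>pos[of "snd q"] \<psi>pos'[of "fst q"] e unfolding \<psi>_def clD by (auto simp: mem_Times_iff)
    show "\<sigma> * darboux v q \<le> \<psi> q" if q: "q \<in> closure D" "q \<notin> D" for q
    proof -
      obtain a b where ab: "q = (a, b)" by (cases q)
      have 1: "a \<in> {x0-X..x0+X}" "b \<in> {\<delta>..1-\<delta>}" using q(1) unfolding clD ab by auto
      have le: "\<sigma> * darboux v q \<le> \<bar>darboux v q\<bar>" using \<sigma> by auto
      have "a = x0 - X \<or> a = x0 + X \<or> b = \<delta> \<or> b = 1 - \<delta>"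
        using q(2) 1 unfolding D_def ab by auto
      then consider "a = x0 - X \<or> a = x0 + X" | "b = \<delta> \<or> b = 1 - \<delta>" by blast
      then show ?thesis
      proof cases
        case 1
        then have "cosh (a - x0) = cosh X" by auto
        then have "B / cosh X * cosh (a - x0) = B" using cosh_real_nonzero[of X] by (simp only: times_divide_eq_left) simp
        then have "\<psi> q \<ge> B" using \<psi>pos[of b] \<open>b \<in> _\<close> e unfolding \<psi>_def ab by simp
        moreover have "\<bar>darboux v q\<bar> \<le> B" using 1 B \<open>b \<in> _\<close> unfolding ab by auto
        ultimately show ?thesis using le by linarith
      next
        case 2
        then have "sin (pi * b) = sin (pi * \<delta>)"
          using sin_pi_minus[of "pi * \<delta>"] by (auto simp: right_diff_distrib)
        moreover have "sin (pi * \<delta>) \<le> 4 * \<delta>"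
        proof -
          have "sin (pi * \<delta>) \<le> pi * \<delta>" using \<delta> by (intro sin_x_le_x) simp
          also have "\<dots> \<le> 4 * \<delta>" using \<delta> pi_less_4 by (intro mult_right_mono) auto
          finally show ?thesis .
        qed
        ultimately have "4 * \<delta> * csc b \<ge> 1"
          unfolding csc_def using sin_pi_pos[of \<delta>] \<delta> by simp
        then have "A * 1 \<le> A * (4 * \<delta> * csc b)" using A0 by (rule mult_left_mono)
        moreover have "A * \<delta> \<ge> 0" using A0 \<delta> by simp
        ultimately have "\<psi> q \<ge> A" using \<psi>pos'[of a] \<open>b \<in> _\<close> e unfolding \<psi>_def ab
          by (simp add: algebra_simps)
        moreover have "\<bar>darboux v q\<bar> \<le> A" using 2 A \<open>a \<in> _\<close> unfolding ab by auto
        ultimately show ?thesis using le by linarith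
      qed
    qed
    fix q assume q: "q \<in> D"
    obtain a b where ab: "q = (a, b)" by (cases q)
    have b: "0 < b" "b < 1" "\<delta> \<le> b" "b \<le> 1 - \<delta>" and "q \<in> U"
      using q \<delta> R unfolding ab D_def by auto
    show "\<exists>l. lap_at (\<lambda>q. \<sigma> * darboux v q) q l \<and> l + (\<mu> - 2 * pi\<^sup>2 - 2 * (ctg (snd q))\<^sup>2) * (\<sigma> * darboux v q) \<ge> 0"
      using lap_at_cmult[OF lap_at_darboux[OF s, of a b], of \<sigma>] b \<open>q \<in> U\<close> unfolding ab
      by (intro exI conjI) (auto simp: algebra_simps)
    define k where "k = \<mu> - 2 * pi\<^sup>2 - 2 * (ctg b)\<^sup>2"
    have "d2_at (\<lambda>y. 4 * A * \<delta> * csc y + (4 * A * \<delta> + e)) b (4 * A * \<delta> * ((pi\<^sup>2 + 2 * (ctg b)\<^sup>2) * csc b) + 0)"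
      by (intro d2_at_add d2_at_cmult d2_at_csc d2_at_const b)
    moreover have "d2_at (\<lambda>s. B / cosh X * cosh (s - x0)) a (B / cosh X * cosh (a - x0))"
      by (intro d2_at_cmult d2_at_cosh)
    ultimately have L: "lap_at \<psi> q (B / cosh X * cosh (a - x0) + (4 * A * \<delta> * ((pi\<^sup>2 + 2 * (ctg b)\<^sup>2) * csc b) + 0))"
      using lap_at_sum[of "\<lambda>s. B / cosh X * cosh (s - x0)" q _ "\<lambda>y. 4 * A * \<delta> * csc y + (4 * A * \<delta> + e)"]
      unfolding \<psi>_def ab by (simp add: algebra_simps)
    have k: "k < -1" using \<mu> pi_sq_gt_9 unfolding k_def by (smt (verit) zero_le_power2)
    have c: "csc b \<le> 1 + (ctg b)\<^sup>2"
    proof -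
      have "csc b * 1 \<le> csc b * csc b" using csc_ge_1[OF b(1,2)] by (intro mult_left_mono) auto
      moreover have "pi\<^sup>2 * (csc b)\<^sup>2 \<le> pi\<^sup>2 * (1 + (ctg b)\<^sup>2)"
        unfolding ctg_csc[OF b(1,2)] using pi_sq_gt_9(1) mult_right_mono[of 1 "pi\<^sup>2" "(ctg b)\<^sup>2"] by (simp add: algebra_simps)
      then have "(csc b)\<^sup>2 \<le> 1 + (ctg b)\<^sup>2" by simp
      ultimately show ?thesis by (simp add: power2_eq_square)
    qed
    have "(pi\<^sup>2 + 2 * (ctg b)\<^sup>2) * csc b + k * (csc b + 1) = (\<mu> - pi\<^sup>2) * csc b + k"
      unfolding k_def by (simp add: algebra_simps)
    also have "\<dots> \<le> 1 * csc b + k"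
      using \<mu> csc_ge_1[OF b(1,2)] by (intro add_mono mult_right_mono) auto
    also have "\<dots> \<le> 0" using c \<mu> pi_sq_gt_9(1) zero_le_power2[of "ctg b"] unfolding k_def by linarith
    finally have "4 * A * \<delta> * ((pi\<^sup>2 + 2 * (ctg b)\<^sup>2) * csc b + k * (csc b + 1)) \<le> 0"
      using A0 \<delta> by (simp add: mult_nonneg_nonpos)
    moreover have "B / cosh X * cosh (a - x0) * (1 + k) \<le> 0"
      using k B0 by (intro mult_nonneg_nonpos) auto
    moreover have "e * k < 0" using e k by (simp add: mult_pos_neg)
    ultimately have "B / cosh X * cosh (a - x0) + (4 * A * \<delta> * ((pi\<^sup>2 + 2 * (ctg b)\<^sup>2) * csc b) + 0) + k * \<psi> q < 0"
      unfolding \<psi>_def ab by (simp add: algebra_simps add_divide_distrib)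
    then show "\<exists>l. lap_at \<psi> q l \<and> l + (\<mu> - 2 * pi\<^sup>2 - 2 * (ctg (snd q))\<^sup>2) * \<psi> q < 0"
      using L unfolding k_def ab by auto
  qed (use p clD in auto)
  then show "\<sigma> * darboux v (x, y) \<le> 4 * A * \<delta> * (csc y + 1) + B / cosh X * cosh (x - x0) + e"
    unfolding \<psi>_def by simp
qed

lemma darboux_abs_le:
  assumes s: "sol \<mu> v U"
    and R: "{x0-X..x0+X} \<times> {\<delta>..1-\<delta>} \<subseteq> U"
    and X: "X > 0" and \<delta>: "0 < \<delta>" "\<delta> < 1/2" and \<mu>: "\<bar>\<mu> - pi\<^sup>2\<bar> \<le> 1"
    and A: "\<And>x. x \<in> {x0-X..x0+X} \<Longrightarrow> \<bar>darboux v (x, \<delta>)\<bar> \<le> A \<and> \<bar>darboux v (x, 1-\<delta>)\<bar> \<le> A"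
    and B: "\<And>y. y \<in> {\<delta>..1-\<delta>} \<Longrightarrow> \<bar>darboux v (x0-X, y)\<bar> \<le> B \<and> \<bar>darboux v (x0+X, y)\<bar> \<le> B"
    and p: "(x, y) \<in> {x0-X..x0+X} \<times> {\<delta>..1-\<delta>}"
  shows "\<bar>darboux v (x, y)\<bar> \<le> 4 * A * \<delta> * (csc y + 1) + B / cosh X * cosh (x - x0)"
  using darboux_le[OF s _ R X \<delta> \<mu> A B p, of 1] darboux_le[OF s _ R X \<delta> \<mu> A B p, of "-1"] by simp

text \<open>Jordan's inequality: the sine is concave on [0, \<pi>/2] and lies above its
  chord.\<close>

lemma sin_pi_ge: assumes "0 \<le> t" "t \<le> 1/2" shows "sin (pi * t) \<ge> 2 * t"
proof -
  have "convex_on {0..pi/2} (\<lambda>x. - sin x)"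
  proof (rule f''_ge0_imp_convex)
    show "((\<lambda>x. - sin x) has_real_derivative - cos x) (at x)" for x
      by (auto intro!: derivative_eq_intros)
    show "((\<lambda>x. - cos x) has_real_derivative sin x) (at x)" for x
      by (auto intro!: derivative_eq_intros)
    show "0 \<le> sin x" if "x \<in> {0..pi/2}" for x using that by (intro sin_ge_zero) auto
  qed auto
  from convex_onD[OF this, of "2 * t" 0 "pi/2"] assms
  show ?thesis by (simp add: mult.commute)
qed

lemma csc_le_16: assumes "1/32 \<le> y" "y \<le> 31/32" shows "csc y \<le> 16"
proof -
  have "sin (pi * y) \<ge> 1 / 16"
  proof (cases "y \<le> 1/2")
    case True
    then show ?thesis using sin_pi_ge[of y] assms by simp
  next
    case False
    then show ?thesis using sin_pi_ge[of "1 - y"] sin_pi_minus[of "pi * y"] assms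
      by (simp add: right_diff_distrib)
  qed
  then show ?thesis unfolding csc_def by (simp add: divide_le_eq)
qed

lemma cosh_ratio_le:
  fixes a X :: real
  assumes "\<bar>a\<bar> \<le> b"
  shows "cosh a / cosh X \<le> 2 * exp (b - X)"
proof -
  have "cosh a \<le> exp b"
  proof -
    have "a \<le> b" "- a \<le> b" using assms by auto
    then have "exp a \<le> exp b" "exp (- a) \<le> exp b" by (simp_all only: exp_le_cancel_iff)
    then have "(exp a + exp (- a)) / 2 \<le> exp b" by argo
    then show ?thesis unfolding cosh_def by simp
  qed
  moreover have "cosh X \<ge> exp X / 2" unfolding cosh_def by simp
  ultimately have "cosh a / cosh X \<le> exp b / (exp X / 2)"
    by (intro frac_le) auto
  then show ?thesis by (simp add: exp_diff mult.commute)
qed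

text \<open>Away from the walls \<open>v\<^sub>x\<^sub>x = - (\<mu> - \<pi>\<^sup>2) v - z\<^sub>y - \<pi> cot (\<pi> y) z\<close> for the Darboux transform \<open>z\<close>.\<close>

lemma dxx_bound:
  assumes s: "sol \<mu> v U"
    and R: "{x0-X..x0+X} \<times> {\<delta>..1-\<delta>} \<subseteq> U"
    and X: "X \<ge> 1" and \<delta>: "0 < \<delta>" "\<delta> \<le> 1/32" and \<mu>: "\<bar>\<mu> - pi\<^sup>2\<bar> \<le> 1"
    and A: "\<And>x. x \<in> {x0-X..x0+X} \<Longrightarrow> \<bar>darboux v (x, \<delta>)\<bar> \<le> A \<and> \<bar>darboux v (x, 1-\<delta>)\<bar> \<le> A"
    and B: "\<And>y. y \<in> {\<delta>..1-\<delta>} \<Longrightarrow> \<bar>darboux v (x0-X, y)\<bar> \<le> B \<and> \<bar>darboux v (x0+X, y)\<bar> \<le> B"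
    and x: "\<bar>x - x0\<bar> \<le> X / 2" and y: "1/16 \<le> y" "y \<le> 15/16"
  shows "\<bar>dx (dx v) (x, y)\<bar> \<le> \<bar>\<mu> - pi\<^sup>2\<bar> * \<bar>v (x, y)\<bar> + 300 * (68 * A * \<delta> + 4 * B * exp (- X / 2))"
proof -
  \<comment> \<open>A bound for the transform on the square \<open>Q\<close>: 68 = 4 * 17 because
    \<open>csc + 1\<close> is at most 17 there, and the ratio of the hyperbolic cosines is at most
    \<open>4 * exp (- X / 2)\<close>.\<close>
  define E where "E = 68 * A * \<delta> + 4 * B * exp (- X / 2)"
  have A0: "A \<ge> 0" using A[of x0] X by auto
  have B0: "B \<ge> 0" using B[of \<delta>] \<delta> by auto
  define Q where "Q = {x-1/32..x+1/32} \<times> {y-1/32..y+1/32}"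
  have Q: "Q \<subseteq> {x0-X..x0+X} \<times> {\<delta>..1-\<delta>}"
  proof -
    have "x0 - X \<le> x - 1/32" "x + 1/32 \<le> x0 + X" using x X by linarith+
    then show ?thesis using y \<delta> unfolding Q_def by auto
  qed
  have Qy: "1/32 \<le> b" "b \<le> 31/32" "0 < b" "b < 1" if "(a, b) \<in> Q" for a b
    using that y unfolding Q_def by auto
  have zE: "\<bar>darboux v q\<bar> \<le> E" if q: "q \<in> Q" for q
  proof -
    obtain a b where ab: "q = (a, b)" by (cases q)
    have "\<bar>darboux v (a, b)\<bar> \<le> 4 * A * \<delta> * (csc b + 1) + B / cosh X * cosh (a - x0)"
      by (rule darboux_abs_le[OF s R _ _ _ \<mu> A B]) (use q Q ab X \<delta> in auto)
    also have "4 * A * \<delta> * (csc b + 1) \<le> 4 * A * \<delta> * 17"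
      using csc_le_16[OF Qy(1,2)] q ab A0 \<delta> by (intro mult_left_mono) auto
    also have "B / cosh X * cosh (a - x0) \<le> B * (4 * exp (- X / 2))"
    proof -
      have "x - 1/32 \<le> a" "a \<le> x + 1/32" using q unfolding Q_def ab by auto
      then have "\<bar>a - x\<bar> \<le> 1/32" by linarith
      then have "\<bar>a - x0\<bar> \<le> X / 2 + 1/32" using x by linarith
      from cosh_ratio_le[OF this, of X] have "cosh (a - x0) / cosh X \<le> 2 * exp (1/32 + - X / 2)"
        by (simp add: algebra_simps)
      also have "\<dots> = 2 * (exp (1/32) * exp (- X / 2))" by (simp only: exp_add)
      also have "\<dots> \<le> 2 * (2 * exp (- X / 2))"
        using exp_bound[of "1/32"] by (intro mult_left_mono mult_right_mono) (auto simp: power2_eq_square)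
      finally have "cosh (a - x0) / cosh X \<le> 4 * exp (- X / 2)" by simp
      from mult_left_mono[OF this B0] show ?thesis by simp
    qed
    finally show ?thesis unfolding E_def ab by simp
  qed
  have pQ: "(x, y) \<in> Q" unfolding Q_def by auto
  have E0: "E \<ge> 0" unfolding E_def using A0 B0 \<delta> by simp
  have pU: "(x, y) \<in> U" and QU: "Q \<subseteq> U" using pQ Q R by auto
  have y01: "0 < y" "y < 1" using y by auto
  have C: "Ck_on (Suc 0) (dy v) U" using sol_Suc[OF s] by simp
  define D where "D = dy (dy v) (x, y) - ((- pi\<^sup>2 - (ctg y)\<^sup>2) * v (x, y) + dy v (x, y) * ctg y)"
  \<comment> \<open>From \<open>csc b \<le> 16\<close> and \<pi>^2 < 16 one has \<pi>^2 + ctg^2 =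
    \<pi>^2 csc^2 \<le> 16 * 16^2 = 4096 = 64^2.\<close>
  have kb: "\<bar>\<mu> - 2 * pi\<^sup>2 - 2 * (ctg b)\<^sup>2\<bar> \<le> 8192" "\<bar>ctg b\<bar> \<le> 64" if "(a, b) \<in> Q" for a b
  proof -
    note b = Qy[OF that]
    have "(csc b)\<^sup>2 \<le> 16\<^sup>2" using csc_le_16[OF b(1,2)] csc_ge_1[OF b(3,4)] by (intro power_mono) auto
    then have "pi\<^sup>2 * (csc b)\<^sup>2 \<le> 16 * 16\<^sup>2" using pi_sq_gt_9 by (intro mult_mono) auto
    then have c: "pi\<^sup>2 + (ctg b)\<^sup>2 \<le> 4096" unfolding ctg_csc[OF b(3,4)] by simp
    show "\<bar>\<mu> - 2 * pi\<^sup>2 - 2 * (ctg b)\<^sup>2\<bar> \<le> 8192"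
      using c \<mu> pi_sq_gt_9 zero_le_power2[of "ctg b"] by linarith
    have "(ctg b)\<^sup>2 \<le> 64\<^sup>2" using c by (simp add: add_increasing) (smt (verit) zero_le_power2)
    then show "\<bar>ctg b\<bar> \<le> 64" using power2_le_iff_abs_le[of "64::real" "ctg b"] by simp
  qed
  have "\<bar>D\<bar> \<le> 2 * E / (1/32) + (1/32) * (8192 * E) / 2"
  proof (rule grad_bound_dy[where v="darboux v" and x=x and y=y])
    show "continuous_on ({x-1/32..x+1/32} \<times> {y-1/32..y+1/32}) (darboux v)"
      unfolding darboux_def ctg_def Q_def[symmetric] using sin_pi_pos Qy QU
      by (intro continuous_intros continuous_on_subset[OF sol_cont_dx(2)[OF s]] continuous_on_subset[OF sol_cont[OF s]])
         (auto, force)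
    fix q assume q: "q \<in> {x-1/32<..<x+1/32} \<times> {y-1/32<..<y+1/32}"
    obtain a b where ab: "q = (a, b)" by (cases q)
    have qQ: "(a, b) \<in> Q" using q unfolding Q_def ab by auto
    have "\<bar>- (\<mu> - 2 * pi\<^sup>2 - 2 * (ctg b)\<^sup>2) * darboux v (a, b)\<bar> \<le> 8192 * E"
      using kb(1)[OF qQ] zE[OF qQ] by (simp add: abs_mult mult_mono)
    then show "\<exists>l. lap_at (darboux v) q l \<and> \<bar>l\<bar> \<le> 8192 * E"
      using lap_at_darboux[OF s _ Qy(3,4)[OF qQ]] qQ QU unfolding ab by blast
  next
    show "((\<lambda>t. darboux v (x, t)) has_real_derivative D) (at y)"
      unfolding darboux_def D_def snd_conv
      by (rule DERIV_diff[OF Ck_on_dy[OF C pU] DERIV_mult[OF ctg_deriv[OF y01] sol_dy[OF s pU]]])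
  qed (use zE in \<open>auto simp: Q_def\<close>)
  then have "\<bar>D\<bar> \<le> 192 * E" by simp
  then have "\<bar>D\<bar> \<le> 200 * E" using E0 by linarith
  moreover have "\<bar>ctg y * darboux v (x, y)\<bar> \<le> 64 * E"
    using kb(2)[OF pQ] zE[OF pQ] by (simp add: abs_mult mult_mono)
  \<comment> \<open>Substituting z + ctg v for v_y makes the terms in ctg^2 v cancel, which leaves
    \<open>v\<close> itself only with the small factor \<mu> - \<pi>^2.\<close>
  moreover have "dx (dx v) (x, y) = - ((\<mu> - pi\<^sup>2) * v (x, y)) - D - ctg y * darboux v (x, y)"
  proof -
    have "dx (dx v) (x, y) = - \<mu> * v (x, y) - dy (dy v) (x, y)"
      using s pU unfolding sol_def laplacian_def by force
    then show ?thesis unfolding D_def darboux_def by (simp add: algebra_simps power2_eq_square)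
  qed
  moreover have "\<bar>(\<mu> - pi\<^sup>2) * v (x, y)\<bar> = \<bar>\<mu> - pi\<^sup>2\<bar> * \<bar>v (x, y)\<bar>" by (rule abs_mult)
  ultimately have "\<bar>dx (dx v) (x, y)\<bar> \<le> \<bar>\<mu> - pi\<^sup>2\<bar> * \<bar>v (x, y)\<bar> + 300 * E" using E0 by linarith
  then show ?thesis unfolding E_def .
qed

section \<open>Boundary behaviour of the ground state\<close>

text \<open>The extension by zero makes \<open>w\<close> continuous on the whole plane, so that
  difference quotients make sense across the boundary; convexity supplies the supporting lines for
  barriers.\<close>

locale ground_state =
  fixes U :: "(real \<times> real) set" and w :: "real \<times> real \<Rightarrow> real" and \<mu> :: real
  assumes U: "open U" "convex U" "bounded U" "U \<noteq> {}"
    and strip: "\<And>x y. (x, y) \<in> U \<Longrightarrow> 0 < y \<and> y < 1"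
    and cont: "continuous_on UNIV w"
    and off: "\<And>p. p \<notin> U \<Longrightarrow> w p = 0"
    and pos: "\<And>p. p \<in> U \<Longrightarrow> 0 < w p"
    and le1: "\<And>p. p \<in> U \<Longrightarrow> w p \<le> 1"
    and sol: "sol \<mu> w U"
begin

lemma nonneg: "0 \<le> w p" and le_1: "w p \<le> 1"
  using off[of p] pos[of p] le1[of p] by force+

lemma continuous_on_w: "continuous_on S w"
  using cont continuous_on_subset by blast

text \<open>At a point \<open>z\<close> outside \<open>U\<close> there is a supporting line; a parabola in the distance to it is a
  barrier.\<close>

lemma w_le_dist:
  assumes d: "d > 0" "\<mu> * d\<^sup>2 < 1" and z: "z \<notin> U"
  shows "w q \<le> 2 / d * norm (q - z)"
proof (cases "q \<in> U")
  case False
  then show ?thesis using off d by simp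
next
  case q: True
  obtain a b where ab: "a \<noteq> 0" "\<And>x. x \<in> {z} \<Longrightarrow> inner a x \<le> b" "\<And>x. x \<in> U \<Longrightarrow> b \<le> inner a x"
    using separating_hyperplane_sets[of "{z}" U] U z by auto
  define n where "n = a /\<^sub>R norm a"
  obtain n1 n2 where n12: "n = (n1, n2)" by (cases n)
  have "norm n = 1" unfolding n_def using ab(1) by simp
  then have n1n2: "n1\<^sup>2 + n2\<^sup>2 = 1" unfolding n12 by (simp add: norm_Pair)
  obtain z1 z2 where z12: "z = (z1, z2)" by (cases z)
  define t where "t p = n1 * (fst p - z1) + n2 * (snd p - z2)" for p :: "real \<times> real"
  have t_inner: "t p = inner n (p - z)" for p unfolding t_def n12 z12 by (cases p) simp
  have tU: "t p \<ge> 0" if "p \<in> U" for p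
  proof -
    have "inner a z \<le> inner a p" using ab(2)[of z] ab(3)[OF that] by simp
    then have "inner n z \<le> inner n p" unfolding n_def using ab(1) by (simp add: divide_inverse mult_left_mono)
    then show ?thesis unfolding t_inner by (simp add: inner_diff_right)
  qed
  have t_cont: "continuous_on S t" for S unfolding t_def by (intro continuous_intros)
  have "t q \<le> norm n * norm (q - z)" unfolding t_inner by (rule norm_cauchy_schwarz)
  then have tq: "t q \<le> norm (q - z)" using \<open>norm n = 1\<close> by simp
  show ?thesis
  proof (cases "t q < d")
    case False
    then have "1 \<le> t q / d" using d by simp
    also have "\<dots> \<le> norm (q - z) / d" using tq d by (simp add: divide_right_mono)
    also have "\<dots> \<le> 2 / d * norm (q - z)" using d by (simp add: divide_right_mono)
    finally show ?thesis using le_1[of q] by linarith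
  next
    case True
    define D where "D = U \<inter> {p. t p < d}"
    have clD: "0 \<le> t p" "t p \<le> d" if "p \<in> closure D" for p
    proof -
      have "closure D \<subseteq> {p. 0 \<le> t p \<and> t p \<le> d}"
        by (rule closure_minimal) (use tU t_cont in \<open>auto simp: D_def intro!: closed_Collect_conj closed_Collect_le\<close>)
      then show "0 \<le> t p" "t p \<le> d" using that by auto
    qed
    have "w q \<le> 2 / d * t q + e" if e: "0 < e" "e \<le> 1" for e
    proof -
      \<comment> \<open>The parabola rises from 0 on the supporting line to 1 at distance
        \<open>d\<close>. Its Laplacian \<open>- 2 / d\<^sup>2\<close> outweighs
        \<open>\<mu> * \<psi>\<close> because \<open>\<psi> \<le> 1 + e \<le> 2\<close> and
        \<open>\<mu> * d\<^sup>2 < 1\<close>.\<close>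
      define \<psi> where "\<psi> p = 2 / d * t p - (t p)\<^sup>2 / d\<^sup>2 + e" for p
      have \<psi>_range: "e \<le> \<psi> p" "\<psi> p \<le> 1 + e" if "p \<in> closure D" for p
      proof -
        have "t p / d * (2 - t p / d) \<ge> 0" using clD[OF that] d by (intro mult_nonneg_nonneg) (auto simp: field_simps)
        then show "e \<le> \<psi> p" unfolding \<psi>_def by (simp add: algebra_simps power2_eq_square)
        have "(t p / d - 1)\<^sup>2 \<ge> 0" by simp
        then show "\<psi> p \<le> 1 + e" unfolding \<psi>_def by (simp add: power2_eq_square algebra_simps)
      qed
      have "w q \<le> \<psi> q"
      proof (rule comparison_principle[where D=D and q="\<lambda>_. \<mu>"])
        show "open D" unfolding D_def using U t_cont by (intro open_Int open_Collect_less) auto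
        show "bounded D" unfolding D_def using U bounded_subset by blast
        show "continuous_on (closure D) w" by (rule continuous_on_w)
        show "continuous_on (closure D) \<psi>" unfolding \<psi>_def using d by (intro continuous_intros t_cont) auto
        show "0 < \<psi> p" if "p \<in> closure D" for p using \<psi>_range[OF that] e by simp
        show "w p \<le> \<psi> p" if "p \<in> closure D" "p \<notin> D" for p
        proof (cases "p \<in> U")
          case True
          then have "t p = d" using that clD[OF that(1)] unfolding D_def by auto
          then have "\<psi> p = 1 + e" unfolding \<psi>_def using d by simp
          then show ?thesis using le_1[of p] e by simp
        next
          case False
          then show ?thesis using off \<psi>_range(1)[OF that(1)] e by simp
        qed
        show "\<exists>l. lap_at w p l \<and> 0 \<le> l + \<mu> * w p" if "p \<in> D" for p
          using sol_lap_at[OF sol, of p] that unfolding D_def by (intro exI[of _ "- \<mu> * w p"]) simp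
        fix p assume p: "p \<in> D"
        define c1 c2 where "c1 = 2 / d" and "c2 = 1 / d\<^sup>2"
        have \<psi>_alt: "\<psi> = (\<lambda>p. c1 * t p - c2 * (t p)\<^sup>2 + e)"
          unfolding \<psi>_def c1_def c2_def by (simp add: fun_eq_iff)
        have "d2_at (\<lambda>s. \<psi> (s, snd p)) (fst p) (- 2 * n1\<^sup>2 * c2)"
          unfolding \<psi>_alt t_def
          by (rule d2_atI[where g="\<lambda>s. c1 * n1 - c2 * (2 * n1 * (n1 * (s - z1) + n2 * (snd p - z2)))"])
            (auto intro!: derivative_eq_intros simp: power2_eq_square algebra_simps)
        then have 1: "d2_at (\<lambda>s. \<psi> (s, snd p)) (fst p) (- 2 * n1\<^sup>2 / d\<^sup>2)" by (simp add: c2_def)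
        have "d2_at (\<lambda>s. \<psi> (fst p, s)) (snd p) (- 2 * n2\<^sup>2 * c2)"
          unfolding \<psi>_alt t_def
          by (rule d2_atI[where g="\<lambda>s. c1 * n2 - c2 * (2 * n2 * (n1 * (fst p - z1) + n2 * (s - z2)))"])
            (auto intro!: derivative_eq_intros simp: power2_eq_square algebra_simps)
        then have 2: "d2_at (\<lambda>s. \<psi> (fst p, s)) (snd p) (- 2 * n2\<^sup>2 / d\<^sup>2)" by (simp add: c2_def)
        have "- 2 * n1\<^sup>2 / d\<^sup>2 + - 2 * n2\<^sup>2 / d\<^sup>2 = - 2 * (n1\<^sup>2 + n2\<^sup>2) / d\<^sup>2"
          by (simp add: algebra_simps add_divide_distrib diff_divide_distrib)
        then have "lap_at \<psi> p (- 2 / d\<^sup>2)" using 1 2 n1n2 unfolding lap_at_def by force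
        moreover have "- 2 / d\<^sup>2 + \<mu> * \<psi> p < 0"
        proof -
          have "\<mu> < 1 / d\<^sup>2" using d by (simp add: field_simps)
          have "p \<in> closure D" using p closure_subset by blast
          then have \<psi>p: "0 < \<psi> p" "\<psi> p \<le> 2" using \<psi>_range[of p] e by linarith+
          then have "\<mu> * \<psi> p < 1 / d\<^sup>2 * \<psi> p" using \<open>\<mu> < 1 / d\<^sup>2\<close> by (intro mult_strict_right_mono)
          also have "\<dots> \<le> 1 / d\<^sup>2 * 2" using \<psi>p by (intro mult_left_mono) auto
          finally show ?thesis by simp
        qed
        ultimately show "\<exists>l. lap_at \<psi> p l \<and> l + \<mu> * \<psi> p < 0" by blast
      next
        have "q \<in> D" using q True by (simp add: D_def)
        then show "q \<in> closure D" using closure_subset[of D] by auto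
      qed
      also have "\<dots> \<le> 2 / d * t q + e" unfolding \<psi>_def by simp
      finally show ?thesis .
    qed
    note * = this
    have "w q \<le> 2 / d * t q + e" if "0 < e" for e
      using that * by (cases "e \<le> 1") (force, use *[of 1] in linarith)
    then have "w q \<le> 2 / d * t q" by (rule field_le_epsilon)
    also have "\<dots> \<le> 2 / d * norm (q - z)" using tq d by (intro mult_left_mono) auto
    finally show ?thesis .
  qed
qed

lemma w_le_wall:
  assumes "d > 0" "\<mu> * d\<^sup>2 < 1"
  shows "w (x, y) \<le> 2 / d * \<bar>y\<bar>" "w (x, y) \<le> 2 / d * \<bar>1 - y\<bar>"
  using w_le_dist[OF assms, of "(x, 0)" "(x, y)"] w_le_dist[OF assms, of "(x, 1)" "(x, y)"]
    strip[of x 0] strip[of x 1] by (auto simp: norm_Pair abs_minus_commute)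

text \<open>Here \<open>r\<close> is the distance to the complement and \<open>z\<close> a nearest
  point of it; \<open>r \<le> 1\<close> because (x, 0) lies outside. Half-side \<open>r/3\<close>
  keeps the square in the open ball of radius \<open>r\<close>.\<close>

lemma square_in_U:
  assumes "(x, y) \<in> U"
  obtains r z where "0 < r" "r \<le> 1" "z \<notin> U" "norm ((x, y) - z) \<le> r"
    "{x-r/3..x+r/3} \<times> {y-r/3..y+r/3} \<subseteq> U"
proof -
  have "closed (- U)" "- U \<noteq> {}" using U strip[of x 0] by (auto simp: closed_Compl)
  then obtain z where z: "z \<in> - U" "\<And>q. q \<in> - U \<Longrightarrow> dist (x, y) z \<le> dist (x, y) q"
    using distance_attains_inf[of "- U" "(x, y)"] by blast
  define r where "r = dist (x, y) z"
  have r0: "r > 0" unfolding r_def using z(1) assms by auto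
  have "(x, 0) \<in> - U" using strip by auto
  then have "r \<le> dist (x, y) (x, 0)" using z(2) unfolding r_def by blast
  then have r1: "r \<le> 1" using strip[OF assms] by (simp add: dist_Pair_Pair dist_real_def)
  have "{x-r/3..x+r/3} \<times> {y-r/3..y+r/3} \<subseteq> U"
  proof
    fix q assume q: "q \<in> {x-r/3..x+r/3} \<times> {y-r/3..y+r/3}"
    then have "\<bar>x - fst q\<bar> \<le> r/3" "\<bar>y - snd q\<bar> \<le> r/3"
      by (simp_all only: mem_Times_iff atLeastAtMost_iff abs_le_iff) linarith+
    then have "dist (x, y) q \<le> r/3 + r/3"
      using norm_Pair_le[of "x - fst q" "y - snd q"] by (cases q) (simp add: dist_norm)
    then have "dist (x, y) q < r" using r0 by simp
    then show "q \<in> U" using z(2)[of q] unfolding r_def by force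
  qed
  then show ?thesis using that[of r z] r0 r1 z(1) unfolding r_def by (simp add: dist_norm)
qed

text \<open>At distance \<open>r\<close> from the complement, \<open>w\<close> is O(r) on a square
  of size comparable to \<open>r\<close>. The interior estimate divides by this size, so
  \<open>r\<close> cancels and the bound holds up to the boundary.\<close>

lemma gradient_le:
  assumes d: "d > 0" "\<mu> * d\<^sup>2 < 1" and p: "(x, y) \<in> U"
  shows "\<bar>dx w (x, y)\<bar> \<le> 12 * (2 + \<bar>\<mu>\<bar>) / d" "\<bar>dy w (x, y)\<bar> \<le> 12 * (2 + \<bar>\<mu>\<bar>) / d"
proof -
  obtain r z where r: "0 < r" "r \<le> 1" "z \<notin> U" "norm ((x, y) - z) \<le> r"
    "{x-r/3..x+r/3} \<times> {y-r/3..y+r/3} \<subseteq> U" using square_in_U[OF p] .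
  have "\<bar>w q\<bar> \<le> 4 * r / d" if q: "q \<in> {x-r/3..x+r/3} \<times> {y-r/3..y+r/3}" for q
  proof -
    have "\<bar>fst q - x\<bar> \<le> r/3" "\<bar>snd q - y\<bar> \<le> r/3"
      using q by (simp_all only: mem_Times_iff atLeastAtMost_iff abs_le_iff) linarith+
    then have "\<bar>fst q - x\<bar> + \<bar>snd q - y\<bar> \<le> r" using r(1) by linarith
    then have "norm (q - (x, y)) \<le> r"
      using order_trans[OF norm_Pair_le[of "fst q - x" "snd q - y"]] by (cases q) simp
    then have "norm (q - z) \<le> 2 * r" using r(4) norm_triangle_ineq[of "q - (x, y)" "(x, y) - z"] by simp
    then have "2 / d * norm (q - z) \<le> 2 / d * (2 * r)" using d by (intro mult_left_mono) auto
    then show ?thesis using w_le_dist[OF d r(3), of q] nonneg[of q] by simp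
  qed
  from sol_grad_bound[OF sol _ _ r(5) this] r
  show "\<bar>dx w (x, y)\<bar> \<le> 12 * (2 + \<bar>\<mu>\<bar>) / d" "\<bar>dy w (x, y)\<bar> \<le> 12 * (2 + \<bar>\<mu>\<bar>) / d"
    by (simp_all add: mult.commute)
qed

text \<open>If one of the two points lies outside \<open>U\<close>, it serves as the point
  \<open>z\<close> in \<open>w_le_dist\<close>; otherwise convexity puts the segment into
  \<open>U\<close> and the gradient bound applies.\<close>

lemma lipschitz_x:
  assumes d: "d > 0" "\<mu> * d\<^sup>2 < 1" and t: "0 < t"
  shows "\<bar>w (x + t, y) - w (x, y)\<bar> \<le> 12 * (2 + \<bar>\<mu>\<bar>) / d * t"
proof -
  have K: "2 / d * t \<le> 12 * (2 + \<bar>\<mu>\<bar>) / d * t" using d t by (intro mult_right_mono divide_right_mono) auto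
  show ?thesis
  proof (cases "(x, y) \<in> U \<and> (x + t, y) \<in> U")
    case True
    have seg: "(s, y) \<in> U" if "x \<le> s" "s \<le> x + t" for s
    proof -
      define a where "a = (s - x) / t"
      have a: "0 \<le> a" "a \<le> 1" "s = x + a * t" using that t unfolding a_def by (auto simp: field_simps)
      have "(1 - a) *\<^sub>R (x, y) + a *\<^sub>R (x + t, y) \<in> U"
        using U(2) True a by (intro convexD) auto
      also have "(1 - a) *\<^sub>R (x, y) + a *\<^sub>R (x + t, y) = (s, y)" using a(3) by (simp add: algebra_simps)
      finally show ?thesis .
    qed
    have "\<exists>s. x < s \<and> s < x + t \<and> w (x + t, y) - w (x, y) = (x + t - x) * dx w (s, y)"
      by (rule MVT2) (use t sol_dx[OF sol seg] in auto)
    then obtain s where s: "x < s" "s < x + t" "w (x + t, y) - w (x, y) = t * dx w (s, y)" by auto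
    have "\<bar>t * dx w (s, y)\<bar> \<le> t * (12 * (2 + \<bar>\<mu>\<bar>) / d)"
      using mult_left_mono[OF gradient_le(1)[OF d seg[of s]], of t] s t by (simp add: abs_mult)
    then show ?thesis using s(3) by (simp add: mult.commute)
  next
    case False
    then consider "(x, y) \<notin> U" | "(x + t, y) \<notin> U" by blast
    then show ?thesis
    proof cases
      case 1
      then have "\<bar>w (x + t, y) - w (x, y)\<bar> \<le> 2 / d * t"
        using w_le_dist[OF d 1, of "(x + t, y)"] off[OF 1] nonneg t by (simp add: norm_Pair)
      then show ?thesis using K by linarith
    next
      case 2
      then have "\<bar>w (x + t, y) - w (x, y)\<bar> \<le> 2 / d * t"
        using w_le_dist[OF d 2, of "(x, y)"] off[OF 2] nonneg t by (simp add: norm_Pair)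
      then show ?thesis using K by linarith
    qed
  qed
qed

end

section \<open>The derivative along a nearly horizontal wall\<close>

context ground_state
begin

text \<open>A barrier for the difference quotients of \<open>w\<close> in \<open>x\<close>: the slope \<open>\<kappa>\<close> of the wall bounds them on the
  wall, \<open>\<beta>\<close> on the line \<open>y = 1/8\<close>, and the influence of the lateral sides decays exponentially. As
  \<open>\<mu> \<le> 23\<close>, parabolas in \<open>y\<close> are sufficiently concave.\<close>

lemma near_wall:
  assumes d: "d > 0" "\<mu> * d\<^sup>2 < 1" and \<mu>: "\<mu> \<le> 23"
    and graph: "\<And>x y. \<bar>x - x0\<bar> \<le> X + 1 \<Longrightarrow> y \<le> 1/8 \<Longrightarrow> (x, y) \<in> U \<longleftrightarrow> f x < y"
    and f8: "\<And>x. \<bar>x - x0\<bar> \<le> X + 1 \<Longrightarrow> f x < 1/8"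
    and slope: "\<And>x x'. \<bar>x - x0\<bar> \<le> X + 1 \<Longrightarrow> \<bar>x' - x0\<bar> \<le> X + 1 \<Longrightarrow> \<bar>f x - f x'\<bar> \<le> \<kappa> * \<bar>x - x'\<bar>"
    and top: "\<And>x. \<bar>x - x0\<bar> \<le> X + 1 \<Longrightarrow> \<bar>dx w (x, 1/8)\<bar> \<le> \<beta>"
    and X: "X > 0" and x: "\<bar>x - x0\<bar> < X" and y: "y < 1/8" and p: "(x, y) \<in> U"
  shows "\<bar>dx w (x, y)\<bar> \<le> 4 * \<kappa> / d + 16 * \<beta> * y + 24 * (2 + \<bar>\<mu>\<bar>) / d * (cosh (x - x0) / cosh X)"
proof -
  define S where "S = 2 / d * \<kappa>"
  define K where "K = 12 * (2 + \<bar>\<mu>\<bar>) / d"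
  have K0: "K \<ge> 0" unfolding K_def using d by simp
  have \<beta>0: "\<beta> \<ge> 0" using top[of x0] X by simp
  have "\<bar>f x0 - f (x0 + X)\<bar> \<le> \<kappa> * X" using slope[of x0 "x0 + X"] X by simp
  then have "0 \<le> \<kappa> * X" by linarith
  then have \<kappa>0: "\<kappa> \<ge> 0" using X by (simp add: zero_le_mult_iff)
  have S0: "S \<ge> 0" unfolding S_def using \<kappa>0 d by simp
  have quotient_le: "\<sigma> * ((w (x + t, y) - w (x, y)) / t)
      \<le> (S + K / cosh X * cosh (x - x0) + e) * 2 + 16 * \<beta> * y"
    if t: "0 < t" "t \<le> 1" and in_U: "(x + t, y) \<in> U" and e: "e > 0" and \<sigma>: "\<sigma> = 1 \<or> \<sigma> = -1" for t e \<sigma>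
  proof -
    define v where "v p = \<sigma> / t * (w (1 * fst p + t, 1 * snd p + 0) + (-1) * w p)" for p
    define D where "D = (U \<inter> (\<lambda>p. (1 * fst p + t, 1 * snd p + 0)) -` U) \<inter> {x0-X<..<x0+X} \<times> {..<1/8}"
    \<comment> \<open>On [0, 1/8] the factor \<open>2 - 64 * y\<^sup>2\<close> stays between 1 and 2
      and \<open>16 * y - 64 * y\<^sup>2\<close> rises from 0 to 1; both have second derivative
      -128. \<open>S\<close> covers the wall, \<open>K\<close> with cosh the lateral sides,
      \<open>\<beta>\<close> the top.\<close>
    define \<psi> where "\<psi> p = (S + K / cosh X * cosh (fst p - x0) + e) * (2 - 64 * (snd p)\<^sup>2)
        + \<beta> * (16 * snd p - 64 * (snd p)\<^sup>2)" for p :: "real \<times> real"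
    have oU': "open ((\<lambda>p. (1 * fst p + t, 1 * snd p + 0)) -` U)"
      using U(1) by (intro open_vimage continuous_intros) auto
    have oD: "open D" unfolding D_def using U(1) oU' by (intro open_Int open_Times) auto
    have clD: "fst p \<in> {x0-X..x0+X}" "snd p \<in> {0..1/8}" if "p \<in> closure D" for p
    proof -
      have "closure D \<subseteq> {x0-X..x0+X} \<times> {0..1/8}"
        by (rule closure_minimal)
          (use strip in \<open>force simp: D_def\<close>, auto intro: closed_Times)
      then show "fst p \<in> {x0-X..x0+X}" "snd p \<in> {0..1/8}" using that by (auto simp: mem_Times_iff)
    qed
    have par: "1 \<le> 2 - 64 * b\<^sup>2" "2 - 64 * b\<^sup>2 \<le> 2" "0 \<le> 16 * b - 64 * b\<^sup>2" "16 * b - 64 * b\<^sup>2 \<le> 1"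
      if "b \<in> {0..1/8}" for b :: real
    proof -
      have "b * b \<le> 1/8 * (1/8)" using that by (intro mult_mono) auto
      then show "1 \<le> 2 - 64 * b\<^sup>2" by (simp add: power2_eq_square)
      show "2 - 64 * b\<^sup>2 \<le> 2" by simp
      have "b * b \<le> 1/8 * b" using that by (intro mult_right_mono) auto
      then show "0 \<le> 16 * b - 64 * b\<^sup>2" using that by (simp add: power2_eq_square)
      have "(8 * b - 1)\<^sup>2 \<ge> 0" by simp
      then show "16 * b - 64 * b\<^sup>2 \<le> 1" by (simp add: power2_eq_square algebra_simps)
    qed
    define g where "g s = S + K / cosh X * cosh (s - x0) + e" for s
    have g: "S \<le> g s" "K / cosh X * cosh (s - x0) \<le> g s" "e \<le> g s" "0 < g s" for s
      unfolding g_def using S0 K0 e by (auto simp: add_nonneg_pos intro: add_increasing)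
    have \<psi>_ge: "g (fst p) \<le> \<psi> p" "\<beta> * (16 * snd p - 64 * (snd p)\<^sup>2) \<le> \<psi> p" if "p \<in> closure D" for p
    proof -
      note b = par[OF clD(2)[OF that]]
      have 1: "g (fst p) * 1 \<le> g (fst p) * (2 - 64 * (snd p)\<^sup>2)"
        using b(1) g(4)[of "fst p"] by (intro mult_left_mono) auto
      moreover have "\<beta> * (16 * snd p - 64 * (snd p)\<^sup>2) \<ge> 0" using b(3) \<beta>0 by simp
      ultimately show "g (fst p) \<le> \<psi> p" "\<beta> * (16 * snd p - 64 * (snd p)\<^sup>2) \<le> \<psi> p"
        unfolding \<psi>_def g_def[symmetric] using g(4)[of "fst p"] by linarith+
    qed
    have v_abs: "v p \<le> \<bar>w (fst p + t, snd p) - w p\<bar> / t" for p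
    proof -
      have "v p \<le> \<bar>v p\<bar>" by simp
      also have "\<bar>v p\<bar> = \<bar>w (fst p + t, snd p) - w p\<bar> / t"
        unfolding v_def using \<sigma> t by (auto simp: abs_mult)
      finally show ?thesis .
    qed
    have "v (x, y) \<le> \<psi> (x, y)"
    proof (rule comparison_principle[where D=D and q="\<lambda>_. \<mu>"])
      show "open D" by (rule oD)
      show "bounded D" unfolding D_def using U bounded_subset by blast
      show "continuous_on (closure D) v" unfolding v_def
        by (intro continuous_intros continuous_on_compose2[OF cont] continuous_on_w) auto
      show "continuous_on (closure D) \<psi>" unfolding \<psi>_def
        by (intro continuous_intros continuous_on_compose2[OF continuous_on_cosh[OF continuous_on_id]]) auto
      show "0 < \<psi> p" if "p \<in> closure D" for p using \<psi>_ge(1)[OF that] g(4) by (rule order.strict_trans2[rotated])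
      show "v p \<le> \<psi> p" if cl: "p \<in> closure D" and nD: "p \<notin> D" for p
      proof -
        obtain a b where ab: "p = (a, b)" by (cases p)
        have a: "\<bar>a - x0\<bar> \<le> X" and b: "0 \<le> b" "b \<le> 1/8" using clD[OF cl] unfolding ab by auto
        have at: "\<bar>a - x0\<bar> \<le> X + 1" "\<bar>a + t - x0\<bar> \<le> X + 1" using a t by linarith+
        have lip: "\<bar>w (a + t, b) - w (a, b)\<bar> / t \<le> K"
          using lipschitz_x[OF d t(1), of a b] t unfolding K_def by (simp add: divide_le_eq)
        have dist_vert: "w (s, b) \<le> 2 / d * (\<kappa> * t)" if "\<bar>s - x0\<bar> \<le> X + 1" "b - f s \<le> \<kappa> * t" "f s < b" for s
        proof -
          have "(s, f s) \<notin> U" using graph[OF that(1), of "f s"] f8[OF that(1)] by simp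
          then have "w (s, b) \<le> 2 / d * norm ((s, b) - (s, f s))" by (rule w_le_dist[OF d])
          also have "norm ((s, b) - (s, f s)) = b - f s" using that(3) by (simp add: norm_Pair)
          also have "2 / d * (b - f s) \<le> 2 / d * (\<kappa> * t)" using that(2) d by (intro mult_left_mono) auto
          finally show ?thesis .
        qed
        consider "\<bar>a - x0\<bar> = X" | "b = 1/8" | "b < 1/8" "(a, b) \<notin> U" | "b < 1/8" "(a, b) \<in> U" "(a + t, b) \<notin> U"
          using nD a b unfolding D_def ab by force
        then show ?thesis
        proof cases
          case 1
          then have "cosh (a - x0) = cosh X" by (metis cosh_real_abs abs_of_pos X)
          then have "K / cosh X * cosh (a - x0) = K"
            using cosh_real_nonzero[of X] by (simp only: times_divide_eq_left) simp
          then have "K \<le> g a" using g(2)[of a] by simp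
          then show ?thesis using v_abs[of p] lip \<psi>_ge(1)[OF cl] unfolding ab fst_conv snd_conv by linarith
        next
          case 2
          have seg: "(s, b) \<in> U" "\<bar>s - x0\<bar> \<le> X + 1" if "a \<le> s" "s \<le> a + t" for s
          proof -
            show s: "\<bar>s - x0\<bar> \<le> X + 1" using that at by linarith
            show "(s, b) \<in> U" unfolding 2 using graph[OF s, of "1/8"] f8[OF s] by simp
          qed
          have "\<exists>s. a < s \<and> s < a + t \<and> w (a + t, b) - w (a, b) = (a + t - a) * dx w (s, b)"
            by (rule MVT2) (use t sol_dx[OF sol seg(1)] in auto)
          then obtain s where s: "a < s" "s < a + t" "w (a + t, b) - w (a, b) = t * dx w (s, b)" by auto
          have "\<bar>dx w (s, b)\<bar> \<le> \<beta>" unfolding 2 using top[OF seg(2)[of s]] s by simp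
          then have "\<bar>w (a + t, b) - w (a, b)\<bar> / t \<le> \<beta>"
            using s t by (simp add: abs_mult)
          moreover have "\<beta> * (16 * b - 64 * b\<^sup>2) = \<beta>" unfolding 2 by (simp add: power2_eq_square)
          ultimately show ?thesis using v_abs[of p] \<psi>_ge(2)[OF cl] unfolding ab fst_conv snd_conv by linarith
        next
          case 3
          \<comment> \<open>With (a, b) below the wall, the other point is also outside or at most
            \<open>\<kappa> * t\<close> above the wall, where \<open>w\<close> is at most
            \<open>2 / d * (\<kappa> * t)\<close>. The next case is the mirror image.\<close>
          have "\<bar>w (a + t, b) - w (a, b)\<bar> \<le> 2 / d * (\<kappa> * t)"
          proof (cases "(a + t, b) \<in> U")
            case True
            have "f (a + t) < b" "b \<le> f a" using True 3 graph[OF at(1), of b] graph[OF at(2), of b] by auto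
            moreover have "f a - f (a + t) \<le> \<kappa> * t" using slope[OF at] t by simp
            ultimately show ?thesis using dist_vert[OF at(2)] off[OF 3(2)] nonneg by simp
          next
            case False
            then show ?thesis using off 3 \<kappa>0 d t by simp
          qed
          then have "\<bar>w (a + t, b) - w (a, b)\<bar> / t \<le> S" unfolding S_def using t by (simp add: divide_le_eq)
          then show ?thesis using v_abs[of p] g(1)[of a] \<psi>_ge(1)[OF cl] unfolding ab fst_conv snd_conv by linarith
        next
          case 4
          have "f a < b" "b \<le> f (a + t)" using 4 graph[OF at(1), of b] graph[OF at(2), of b] by auto
          moreover have "f (a + t) - f a \<le> \<kappa> * t" using slope[OF at] t by simp
          ultimately have "\<bar>w (a + t, b) - w (a, b)\<bar> \<le> 2 / d * (\<kappa> * t)"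
            using dist_vert[OF at(1)] off[OF 4(3)] nonneg by simp
          then have "\<bar>w (a + t, b) - w (a, b)\<bar> / t \<le> S" unfolding S_def using t by (simp add: divide_le_eq)
          then show ?thesis using v_abs[of p] g(1)[of a] \<psi>_ge(1)[OF cl] unfolding ab fst_conv snd_conv by linarith
        qed
      qed
      fix p assume pD: "p \<in> D"
      have DU: "D \<subseteq> U" unfolding D_def by blast
      have "sol \<mu> v D"
        unfolding v_def
      proof (intro sol_cmult sol_add)
        show "sol \<mu> (\<lambda>p. w (1 * fst p + t, 1 * snd p + 0)) D"
          by (rule sol_affine[OF sol]) (use oD in \<open>auto simp: D_def\<close>)
        show "sol \<mu> w D" using sol_subset[OF sol DU oD] .
      qed
      from sol_lap_at[OF this pD] show "\<exists>l. lap_at v p l \<and> 0 \<le> l + \<mu> * v p" by (intro exI[of _ "- \<mu> * v p"]) simp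
      have g2: "d2_at g s (K / cosh X * cosh (s - x0))" for s
      proof -
        have "g = (\<lambda>s. K / cosh X * cosh (s - x0) + (S + e))" unfolding g_def by (simp add: fun_eq_iff)
        then show ?thesis using d2_at_add[OF d2_at_cmult[OF d2_at_cosh[of x0 s]] d2_at_const[of "S + e"], of "K / cosh X"] by simp
      qed
      have q2: "d2_at (\<lambda>s. 2 - 64 * s\<^sup>2) b (-128)" for b :: real
        using d2_at_quadratic[of 2 0 0 "-64" b] by simp
      have q3: "d2_at (\<lambda>s. 16 * s - 64 * s\<^sup>2) b (-128)" for b :: real
        using d2_at_quadratic[of 0 16 0 "-64" b] by simp
      have "lap_at (\<lambda>p. g (fst p) * (2 - 64 * (snd p)\<^sup>2) + (\<lambda>s. \<beta>) (fst p) * (16 * snd p - 64 * (snd p)\<^sup>2)) p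
        (K / cosh X * cosh (fst p - x0) * (2 - 64 * (snd p)\<^sup>2) + g (fst p) * (-128)
         + (0 * (16 * snd p - 64 * (snd p)\<^sup>2) + \<beta> * (-128)))"
        by (intro lap_at_add lap_at_prod[OF g2 q2] lap_at_prod[OF d2_at_const q3])
      then have L: "lap_at \<psi> p (K / cosh X * cosh (fst p - x0) * (2 - 64 * (snd p)\<^sup>2) - g (fst p) * 128 - \<beta> * 128)"
        unfolding \<psi>_def[abs_def] g_def[symmetric] by simp
      have "p \<in> closure D" using pD closure_subset by blast
      note b = par[OF clD(2)[OF this]]
      have 1: "K / cosh X * cosh (fst p - x0) * (2 - 64 * (snd p)\<^sup>2) \<le> g (fst p) * 2"
        using b(1,2) g[of "fst p"] K0 by (intro mult_mono) auto
      \<comment> \<open>The budget: \<open>g\<close> is lost 128 times against 2 from cosh and 2 *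
        23 from \<mu>, and \<open>\<beta>\<close> is lost 128 times against 23.\<close>
      have "\<mu> * \<psi> p \<le> 23 * \<psi> p"
        using \<mu> \<psi>_ge(1)[OF \<open>p \<in> closure D\<close>] g(4)[of "fst p"] by (intro mult_right_mono) auto
      also have "\<psi> p \<le> g (fst p) * 2 + \<beta> * 1"
        unfolding \<psi>_def g_def[symmetric] using b g(4)[of "fst p"] \<beta>0 by (intro add_mono mult_left_mono) auto
      finally have "\<mu> * \<psi> p \<le> 46 * g (fst p) + 23 * \<beta>" by simp
      then have "K / cosh X * cosh (fst p - x0) * (2 - 64 * (snd p)\<^sup>2) - g (fst p) * 128 - \<beta> * 128 + \<mu> * \<psi> p < 0"
        using 1 g(4)[of "fst p"] \<beta>0 by linarith
      with L show "\<exists>l. lap_at \<psi> p l \<and> l + \<mu> * \<psi> p < 0" by blast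
    next
      have "(x, y) \<in> D" unfolding D_def using p in_U x y by (auto simp: abs_less_iff)
      then show "(x, y) \<in> closure D" using closure_subset by blast
    qed
    also have "\<psi> (x, y) \<le> g x * 2 + \<beta> * (16 * y)"
      unfolding \<psi>_def g_def[symmetric] using g(4)[of x] \<beta>0 by (intro add_mono mult_left_mono) auto
    finally show ?thesis unfolding v_def g_def by (simp add: algebra_simps diff_divide_distrib)
  qed
  define B where "B = 4 * \<kappa> / d + 16 * \<beta> * y + 24 * (2 + \<bar>\<mu>\<bar>) / d * (cosh (x - x0) / cosh X)"
  have B: "(S + K / cosh X * cosh (x - x0)) * 2 + 16 * \<beta> * y = B"
    unfolding S_def K_def B_def using d(1) cosh_real_nonzero[of X] by (simp add: field_simps)
  have quot: "\<bar>(w (x + t, y) - w (x, y)) / t\<bar> \<le> B" if t: "0 < t" "t \<le> 1" "(x + t, y) \<in> U" for t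
  proof -
    have "\<sigma> * ((w (x + t, y) - w (x, y)) / t) \<le> B" if \<sigma>: "\<sigma> = 1 \<or> \<sigma> = -1" for \<sigma>
    proof (rule field_le_epsilon)
      fix e :: real assume "e > 0"
      then show "\<sigma> * ((w (x + t, y) - w (x, y)) / t) \<le> B + e"
        using quotient_le[OF t, of "e/2" \<sigma>] \<sigma> B by (simp add: algebra_simps)
    qed
    from this[of 1] this[of "-1"] show ?thesis by linarith
  qed
  have "((\<lambda>t. (w (x + t, y) - w (x, y)) / t) \<longlongrightarrow> dx w (x, y)) (at 0)"
    using sol_dx[OF sol p] unfolding DERIV_def .
  then have lim: "((\<lambda>t. \<bar>(w (x + t, y) - w (x, y)) / t\<bar>) \<longlongrightarrow> \<bar>dx w (x, y)\<bar>) (at_right 0)"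
    by (intro tendsto_rabs) (rule tendsto_within_subset, auto)
  obtain r where r: "r > 0" "r \<le> 1" "{x-r..x+r} \<times> {y-r..y+r} \<subseteq> U"
    using open_contains_square[OF U(1) p] .
  have quot_r: "\<bar>(w (x + t, y) - w (x, y)) / t\<bar> \<le> B" if "0 < t" "t < r" for t
    using that r by (intro quot) auto
  have "\<bar>dx w (x, y)\<bar> \<le> B"
    by (rule tendsto_upperbound[OF lim])
      (use quot_r r(1) in \<open>auto simp: eventually_at_right_field simp del: abs_divide intro!: exI[of _ r]\<close>)
  then show ?thesis unfolding B_def .
qed

end

section \<open>Bounds for the eigenvalue\<close>

lemma d2_at_cos: "d2_at (\<lambda>s. cos (m * (s - c))) x (- m\<^sup>2 * cos (m * (x - c)))"
  by (rule d2_atI[where g="\<lambda>s. - m * sin (m * (s - c))"])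
    (auto intro!: derivative_eq_intros simp: power2_eq_square)

lemma d2_at_sin: "d2_at (\<lambda>s. sin (m * (s - c))) x (- m\<^sup>2 * sin (m * (x - c)))"
  by (rule d2_atI[where g="\<lambda>s. m * cos (m * (s - c))"])
    (auto intro!: derivative_eq_intros simp: power2_eq_square)

lemma d2_at_exp: "d2_at (\<lambda>s. exp (m * (s - c))) x (m\<^sup>2 * exp (m * (x - c)))"
  by (rule d2_atI[where g="\<lambda>s. m * exp (m * (s - c))"])
    (auto intro!: derivative_eq_intros simp: power2_eq_square)

context ground_state
begin

text \<open>If \<mu> < m^2 < \<pi>^2, every positive multiple of cos (m (y - 1/2)) is a strict
  supersolution, positive on the closed strip; small multiples would force \<open>w\<close> to
  vanish.\<close>

lemma mu_ge: "pi\<^sup>2 \<le> \<mu>"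
proof (rule ccontr)
  assume "\<not> pi\<^sup>2 \<le> \<mu>"
  then have "max \<mu> 0 < pi\<^sup>2" by simp
  then have "sqrt (max \<mu> 0) < pi" by (intro real_less_lsqrt) auto
  then obtain m where m: "sqrt (max \<mu> 0) < m" "m < pi" using dense by blast
  have m0: "m > 0" using m(1) by (meson max.cobounded2 real_sqrt_ge_zero le_less_trans)
  have "(sqrt (max \<mu> 0))\<^sup>2 < m\<^sup>2" using m(1) by (intro power_strict_mono) auto
  then have "max \<mu> 0 < m\<^sup>2" by simp
  then have m2: "\<mu> < m\<^sup>2" by simp
  have cpos: "cos (m * (y - 1/2)) > 0" if "0 \<le> y" "y \<le> 1" for y
  proof (rule cos_gt_zero_pi)
    have "\<bar>y - 1/2\<bar> \<le> 1/2" using that by linarith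
    then have "m * \<bar>y - 1/2\<bar> \<le> m * (1/2)" using m0 by (intro mult_left_mono) auto
    moreover have "\<bar>m * (y - 1/2)\<bar> = m * \<bar>y - 1/2\<bar>" using m0 by (simp add: abs_mult)
    ultimately have "\<bar>m * (y - 1/2)\<bar> < pi / 2" using m by linarith
    then show "- (pi / 2) < m * (y - 1/2)" "m * (y - 1/2) < pi / 2" by auto
  qed
  have cl: "0 \<le> snd p" "snd p \<le> 1" if "p \<in> closure U" for p
  proof -
    have "closure U \<subseteq> UNIV \<times> {0..1}"
      by (rule closure_minimal) (use strip in \<open>force\<close>, auto intro: closed_Times)
    then show "0 \<le> snd p" "snd p \<le> 1" using that by (auto simp: mem_Times_iff)
  qed
  obtain p where p: "p \<in> U" using U by blast
  have "w p \<le> k" if k: "k > 0" for k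
  proof -
    define \<psi> where "\<psi> p = k * cos (m * (snd p - 1/2))" for p :: "real \<times> real"
    have "w p \<le> \<psi> p"
    proof (rule comparison_principle[where D=U and q="\<lambda>_. \<mu>"])
      show "continuous_on (closure U) \<psi>" unfolding \<psi>_def by (intro continuous_intros)
      show "0 < \<psi> p" if "p \<in> closure U" for p unfolding \<psi>_def using k cpos cl[OF that] by simp
      then show "w p \<le> \<psi> p" if "p \<in> closure U" "p \<notin> U" for p using off[OF that(2)] that by (simp add: less_imp_le)
      show "\<exists>l. lap_at w p l \<and> 0 \<le> l + \<mu> * w p" if "p \<in> U" for p
        using sol_lap_at[OF sol that] by (intro exI[of _ "- \<mu> * w p"]) simp
      fix p assume p: "p \<in> U"
      have c: "cos (m * (snd p - 1/2)) > 0" using strip[of "fst p" "snd p"] p by (intro cpos) auto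
      have "lap_at (\<lambda>p. (\<lambda>s. k) (fst p) * cos (m * (snd p - 1/2))) p
         (0 * cos (m * (snd p - 1/2)) + k * (- m\<^sup>2 * cos (m * (snd p - 1/2))))"
        by (intro lap_at_prod d2_at_const d2_at_cos)
      then have L: "lap_at \<psi> p (k * (- m\<^sup>2 * cos (m * (snd p - 1/2))))" unfolding \<psi>_def by simp
      have "k * (- m\<^sup>2 * cos (m * (snd p - 1/2))) + \<mu> * \<psi> p = (\<mu> - m\<^sup>2) * (k * cos (m * (snd p - 1/2)))"
        unfolding \<psi>_def by (simp add: algebra_simps)
      also have "\<dots> < 0" using m2 k c by (intro mult_neg_pos) auto
      finally show "\<exists>l. lap_at \<psi> p l \<and> l + \<mu> * \<psi> p < 0" using L by blast
    next
      show "p \<in> closure U" using p closure_subset by blast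
    qed (use U continuous_on_w in auto)
    also have "\<dots> \<le> k" unfolding \<psi>_def using k by simp
    finally show ?thesis .
  qed
  from this[of "w p / 2"] pos[OF p] show False by simp
qed

text \<open>Domain monotonicity by comparison: if \<mu> exceeded the eigenvalue of the rectangle,
  each positive multiple of \<open>w\<close> would be a strict supersolution of the equation of the
  rectangle and would dominate its eigenfunction.\<close>

lemma mu_le_rectangle:
  assumes a: "x1 < x2" "y1 < y2" and R: "{x1..x2} \<times> {y1..y2} \<subseteq> U"
  shows "\<mu> \<le> (pi / (x2 - x1))\<^sup>2 + (pi / (y2 - y1))\<^sup>2"
proof (rule ccontr)
  define \<alpha> \<beta> where "\<alpha> = pi / (x2 - x1)" and "\<beta> = pi / (y2 - y1)"
  assume "\<not> \<mu> \<le> (pi / (x2 - x1))\<^sup>2 + (pi / (y2 - y1))\<^sup>2"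
  then have lt: "\<alpha>\<^sup>2 + \<beta>\<^sup>2 < \<mu>" unfolding \<alpha>_def \<beta>_def by simp
  define D where "D = {x1<..<x2} \<times> {y1<..<y2}"
  have clD: "closure D = {x1..x2} \<times> {y1..y2}" unfolding D_def using a by (simp add: closure_Times)
  define v where "v p = sin (\<alpha> * (fst p - x1)) * sin (\<beta> * (snd p - y1))" for p :: "real \<times> real"
  define c where "c = ((x1 + x2) / 2, (y1 + y2) / 2)"
  have cD: "c \<in> D" unfolding c_def D_def using a by auto
  have "\<alpha> * (fst c - x1) = pi / 2" "\<beta> * (snd c - y1) = pi / 2"
    unfolding c_def \<alpha>_def \<beta>_def using a by (auto simp: field_simps)
  then have vc: "v c = 1" unfolding v_def by (simp only: sin_pi_half)
  have "v c \<le> k" if k: "k > 0" for k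
  proof -
    have "v c \<le> k * w c"
    proof (rule comparison_principle[where D=D and q="\<lambda>_. \<alpha>\<^sup>2 + \<beta>\<^sup>2"])
      show "open D" "bounded D" unfolding D_def by (auto intro: open_Times bounded_Times)
      show "continuous_on (closure D) v" unfolding v_def by (intro continuous_intros)
      show "continuous_on (closure D) (\<lambda>p. k * w p)" by (intro continuous_intros continuous_on_w)
      show "0 < k * w p" if "p \<in> closure D" for p using pos R k that unfolding clD by auto
      show "v p \<le> k * w p" if "p \<in> closure D" "p \<notin> D" for p
      proof -
        have "\<alpha> * (x2 - x1) = pi" "\<beta> * (y2 - y1) = pi" unfolding \<alpha>_def \<beta>_def using a by auto
        moreover have "fst p = x1 \<or> fst p = x2 \<or> snd p = y1 \<or> snd p = y2"
          using that(2) that(1)[unfolded clD] unfolding D_def mem_Times_iff by auto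
        ultimately have "v p = 0" unfolding v_def by auto
        then show ?thesis using nonneg[of p] k by simp
      qed
      fix p assume p: "p \<in> D"
      have "lap_at v p (- \<alpha>\<^sup>2 * sin (\<alpha> * (fst p - x1)) * sin (\<beta> * (snd p - y1)) +
           sin (\<alpha> * (fst p - x1)) * (- \<beta>\<^sup>2 * sin (\<beta> * (snd p - y1))))"
        unfolding v_def by (intro lap_at_prod d2_at_sin)
      moreover have "- \<alpha>\<^sup>2 * sin (\<alpha> * (fst p - x1)) * sin (\<beta> * (snd p - y1)) +
           sin (\<alpha> * (fst p - x1)) * (- \<beta>\<^sup>2 * sin (\<beta> * (snd p - y1))) + (\<alpha>\<^sup>2 + \<beta>\<^sup>2) * v p \<ge> 0"
        unfolding v_def by (simp add: algebra_simps)
      ultimately show "\<exists>l. lap_at v p l \<and> 0 \<le> l + (\<alpha>\<^sup>2 + \<beta>\<^sup>2) * v p" by blast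
      have "p \<in> U" using p R clD closure_subset[of D] by auto
      have "k * (- \<mu> * w p) + (\<alpha>\<^sup>2 + \<beta>\<^sup>2) * (k * w p) = (\<alpha>\<^sup>2 + \<beta>\<^sup>2 - \<mu>) * (k * w p)" by (simp add: algebra_simps)
      also have "\<dots> < 0" using lt k pos[OF \<open>p \<in> U\<close>] by (intro mult_neg_pos) auto
      finally show "\<exists>l. lap_at (\<lambda>p. k * w p) p l \<and> l + (\<alpha>\<^sup>2 + \<beta>\<^sup>2) * (k * w p) < 0"
        using lap_at_cmult[OF sol_lap_at[OF sol \<open>p \<in> U\<close>], of k] by blast
    next
      show "c \<in> closure D" using cD closure_subset by blast
    qed
    also have "\<dots> \<le> k" using k le_1[of c] by simp
    finally show ?thesis .
  qed
  from this[of "1/2"] vc show False by simp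
qed

end

section \<open>Location of the maximum\<close>

lemma cos_ge_linear: assumes "\<bar>t\<bar> \<le> 1/2" shows "cos (pi * t) \<ge> 1 - 2 * \<bar>t\<bar>"
proof -
  have "cos (pi * t) = sin (pi * (1/2 - \<bar>t\<bar>))"
    using cos_sin_eq[of "pi * \<bar>t\<bar>"] by (cases "t \<ge> 0") (simp_all add: algebra_simps)
  then show ?thesis using sin_pi_ge[of "1/2 - \<bar>t\<bar>"] assms by simp
qed

lemma cos_le_linear: assumes "\<bar>t\<bar> \<le> 1/2" shows "cos (pi * t) \<le> 2 * (1 - 2 * \<bar>t\<bar>)"
proof -
  have "cos (pi * t) = sin (pi * (1/2 - \<bar>t\<bar>))"
    using cos_sin_eq[of "pi * \<bar>t\<bar>"] by (cases "t \<ge> 0") (simp_all add: algebra_simps)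
  also have "\<dots> \<le> pi * (1/2 - \<bar>t\<bar>)" using assms by (intro sin_x_le_x) auto
  also have "\<dots> \<le> 4 * (1/2 - \<bar>t\<bar>)" using assms pi_less_4 by (intro mult_right_mono) auto
  finally show ?thesis by simp
qed

context ground_state
begin

text \<open>Beyond \<open>x1\<close> the strip containing \<open>U\<close> is too narrow for the eigenvalue, so \<open>w\<close> decays
  exponentially; before \<open>x1\<close> it can grow at most at the rate of a slow sine.
  The deficit \<open>12000000 / L\<^sup>2\<close> of the width allows the rate \<open>14000 / L\<close> of decay, which over the length
  \<open>L / 2000\<close> yields the factor \<open>exp (- 7)\<close>.\<close>

lemma decay:
  assumes L: "L \<ge> 10^6" and \<mu>: "\<mu> \<le> pi\<^sup>2 + 320 / L\<^sup>2"
    and ab: "0 \<le> \<alpha>" "\<beta> \<le> 1" "\<beta> - \<alpha> = 1 - 12000000 / L\<^sup>2"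
    and S: "\<forall>x y. (x, y) \<in> U \<longrightarrow> x1 \<le> x \<longrightarrow> \<alpha> < y \<and> y < \<beta>"
    and p: "(x, y) \<in> U" and x: "x1 \<le> x"
  defines "n \<equiv> (1 - 1 / L\<^sup>2) / (1 - 12000000 / L\<^sup>2)"
  shows "w (x, y) \<le> 5 * cos (pi * n * (y - (\<alpha> + \<beta>) / 2)) * exp (- (14000 / L) * (x - x1))"
    and "\<bar>n * (y - (\<alpha> + \<beta>) / 2)\<bar> \<le> 1/2"
    and "1 \<le> n" "n \<le> 2"
proof -
  define W where "W = \<beta> - \<alpha>"
  define c where "c = (\<alpha> + \<beta>) / 2"
  define \<gamma> where "\<gamma> = 14000 / L"
  have L2: "L\<^sup>2 \<ge> 10^12" using power_mono[OF L, of 2] by simp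
  then have L0: "L > 0" "L\<^sup>2 > 0" using L by auto
  define h where "h = 1 / L\<^sup>2"
  have h: "0 < h" "h \<le> 1 / 10^12" unfolding h_def using L2 L0 by (auto simp: field_simps)
  have W: "W = 1 - 12000000 * h" and nh: "n = (1 - h) / (1 - 12000000 * h)"
    unfolding W_def ab(3) n_def h_def by simp_all
  have W0: "W > 1/2" "W < 1" unfolding W using h by auto
  \<comment> \<open>This equation explains the choice of \<open>n\<close>: on the section of width
    \<open>W\<close> the argument of the cosine stays below \<pi>/2 by a margin of order
    \<open>h\<close>, so the barrier is positive up to both ends.\<close>
  have nW: "n * W = 1 - h" unfolding nh W using h by simp
  have n1: "n \<ge> 1 + 11999999 * h"
  proof -
    have "(1 + 11999999 * h) * (1 - 12000000 * h) = 1 - h - 143999988000000 * (h * h)" by (simp add: algebra_simps)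
    then have "(1 + 11999999 * h) * W \<le> n * W" unfolding nW using W by simp
    then show ?thesis using W0 by (simp add: mult_le_cancel_right)
  qed
  have n2: "n \<le> 2"
  proof -
    have "n * W \<le> 2 * W" unfolding nW using W0 h by simp
    then show ?thesis using W0 by (simp add: mult_le_cancel_right)
  qed
  show "1 \<le> n" "n \<le> 2" using n1 n2 h by auto
  have half: "n * \<bar>b - c\<bar> \<le> (1 - h) / 2" if "\<alpha> \<le> b" "b \<le> \<beta>" for b
  proof -
    have "\<bar>b - c\<bar> \<le> W / 2" unfolding abs_le_iff c_def W_def using that by (simp add: field_simps)
    then have "n * \<bar>b - c\<bar> \<le> n * (W / 2)" using n1 h by (intro mult_left_mono) auto
    then show ?thesis using nW by simp
  qed
  have cos_ge: "cos (pi * n * (b - c)) \<ge> h + 2 * min (b - \<alpha>) (\<beta> - b)" if "\<alpha> \<le> b" "b \<le> \<beta>" for b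
  proof -
    have "cos (pi * (n * (b - c))) \<ge> 1 - 2 * \<bar>n * (b - c)\<bar>"
      by (rule cos_ge_linear) (use half[OF that] h n1 in \<open>simp add: abs_mult\<close>)
    moreover have "\<bar>n * (b - c)\<bar> = n * \<bar>b - c\<bar>" using n1 h by (simp add: abs_mult)
    moreover have "1 - 2 * (n * \<bar>b - c\<bar>) = h + 2 * (n * (W / 2 - \<bar>b - c\<bar>))"
      using nW by (simp add: algebra_simps)
    moreover have m: "min (b - \<alpha>) (\<beta> - b) = W / 2 - \<bar>b - c\<bar>"
      unfolding c_def W_def min_def abs_if by (simp add: field_simps)
    moreover have "1 * (W / 2 - \<bar>b - c\<bar>) \<le> n * (W / 2 - \<bar>b - c\<bar>)"
    proof (rule mult_right_mono)
      show "0 \<le> W / 2 - \<bar>b - c\<bar>" unfolding m[symmetric] using that by simp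
    qed (use n1 h in simp)
    ultimately show ?thesis by (simp add: mult.assoc)
  qed
  show "\<bar>n * (y - (\<alpha> + \<beta>) / 2)\<bar> \<le> 1/2"
    using half[of y] S[rule_format, OF p x] h n1 unfolding c_def by (simp add: abs_mult)
  have bar: "w (a, b) \<le> 10 * min (b - \<alpha>) (\<beta> - b)" if "x1 \<le> a" "\<alpha> \<le> b" "b \<le> \<beta>" for a b
  proof -
    have \<mu>5: "\<mu> * (1/5)\<^sup>2 < 1"
    proof -
      have "320 / L\<^sup>2 \<le> 1" using L2 by (simp add: divide_le_eq)
      then have "\<mu> < 17" using \<mu> pi_sq_gt_9 by linarith
      then show ?thesis by (simp add: power2_eq_square)
    qed
    have "(a, \<alpha>) \<notin> U" "(a, \<beta>) \<notin> U" using S that by fastforce+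
    then have "w (a, b) \<le> 2 / (1/5) * norm ((a, b) - (a, \<alpha>))" "w (a, b) \<le> 2 / (1/5) * norm ((a, b) - (a, \<beta>))"
      using w_le_dist[OF _ \<mu>5, of "(a, \<alpha>)" "(a, b)"] w_le_dist[OF _ \<mu>5, of "(a, \<beta>)" "(a, b)"] by simp_all
    then show ?thesis using that by (simp add: norm_Pair min_def)
  qed
  \<comment> \<open>By the boundary estimate with d = 1/5, \<open>w\<close> is at most 10 times the
    distance to the ends of the section, while the cosine is at least twice that distance.\<close>
  define g where "g b = 5 * cos (pi * n * (b - c))" for b
  have g: "g b > 0" "10 * min (b - \<alpha>) (\<beta> - b) \<le> g b" if "\<alpha> \<le> b" "b \<le> \<beta>" for b
  proof -
    define t where "t = min (b - \<alpha>) (\<beta> - b)"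
    have "0 \<le> t" unfolding t_def using that by simp
    then have "cos (pi * n * (b - c)) > 0" "2 * t \<le> cos (pi * n * (b - c))"
      using cos_ge[OF that, folded t_def] h(1) by linarith+
    then show "g b > 0" "10 * min (b - \<alpha>) (\<beta> - b) \<le> g b" unfolding g_def t_def[symmetric] by linarith+
  qed
  define \<psi> where "\<psi> q = exp (- \<gamma> * (fst q - x1)) * g (snd q)" for q :: "real \<times> real"
  define D where "D = U \<inter> {x1<..} \<times> UNIV"
  have clD: "x1 \<le> fst q" "\<alpha> \<le> snd q" "snd q \<le> \<beta>" if "q \<in> closure D" for q
  proof -
    have "closure D \<subseteq> {x1..} \<times> {\<alpha>..\<beta>}"
      by (rule closure_minimal) (use S in \<open>force simp: D_def\<close>, auto intro: closed_Times)
    then show "x1 \<le> fst q" "\<alpha> \<le> snd q" "snd q \<le> \<beta>" using that by (auto simp: mem_Times_iff)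
  qed
  have "w (x, y) \<le> \<psi> (x, y)"
  proof (cases "x = x1")
    case True
    then show ?thesis using bar[OF x, of y] g(2)[of y] S[rule_format, OF p x] unfolding \<psi>_def by simp
  next
    case False
    show ?thesis
    proof (rule comparison_principle[where D=D and q="\<lambda>_. \<mu>"])
      show "open D" unfolding D_def using U by (intro open_Int open_Times) auto
      show "bounded D" unfolding D_def using U bounded_subset by blast
      show "continuous_on (closure D) w" by (rule continuous_on_w)
      show "continuous_on (closure D) \<psi>" unfolding \<psi>_def g_def by (intro continuous_intros)
      show \<psi>0: "0 < \<psi> q" if "q \<in> closure D" for q unfolding \<psi>_def using g(1) clD[OF that] by simp
      show "w q \<le> \<psi> q" if q: "q \<in> closure D" "q \<notin> D" for q
      proof (cases "q \<in> U")
        case True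
        obtain a b where qab: "q = (a, b)" by (cases q)
        note cl = clD[OF q(1), unfolded qab fst_conv snd_conv]
        have "a = x1" using q(2) True cl(1) unfolding D_def qab by auto
        then show ?thesis using order_trans[OF bar[OF cl] g(2)[OF cl(2,3)]] unfolding \<psi>_def qab by simp
      next
        case False
        then show ?thesis using off \<psi>0[OF q(1)] by simp
      qed
      show "\<exists>l. lap_at w q l \<and> 0 \<le> l + \<mu> * w q" if "q \<in> D" for q
        using sol_lap_at[OF sol, of q] that unfolding D_def by (intro exI[of _ "- \<mu> * w q"]) simp
      fix q assume q: "q \<in> D"
      have "lap_at \<psi> q ((- \<gamma>)\<^sup>2 * exp (- \<gamma> * (fst q - x1)) * g (snd q)
          + exp (- \<gamma> * (fst q - x1)) * (5 * (- (pi * n)\<^sup>2 * cos (pi * n * (snd q - c)))))"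
        unfolding \<psi>_def g_def by (intro lap_at_prod d2_at_exp d2_at_cmult d2_at_cos)
      moreover have "(- \<gamma>)\<^sup>2 * exp (- \<gamma> * (fst q - x1)) * g (snd q)
          + exp (- \<gamma> * (fst q - x1)) * (5 * (- (pi * n)\<^sup>2 * cos (pi * n * (snd q - c)))) + \<mu> * \<psi> q < 0"
      proof -
        \<comment> \<open>In units of \<open>h\<close>, the decay rate costs 14000^2 = 196000000 and
          the eigenvalue 320; the narrow section returns 9 * 2 * 11999999 = 215999982.\<close>
        have "n\<^sup>2 \<ge> 1 + 2 * (11999999 * h)"
          using power_mono[OF n1, of 2] h by (simp add: power2_eq_square algebra_simps) (smt (verit) mult_nonneg_nonneg)
        then have "pi\<^sup>2 * n\<^sup>2 \<ge> pi\<^sup>2 * (1 + 2 * (11999999 * h))" by (intro mult_left_mono) auto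
        moreover have "pi\<^sup>2 * (2 * (11999999 * h)) \<ge> 9 * (2 * (11999999 * h))"
          using pi_sq_gt_9 h by (intro mult_right_mono) auto
        moreover have "\<gamma>\<^sup>2 = 196000000 * h" unfolding \<gamma>_def h_def by (simp add: power_divide)
        moreover have "\<mu> \<le> pi\<^sup>2 + 320 * h" using \<mu> unfolding h_def by simp
        moreover have "pi\<^sup>2 * (1 + 2 * (11999999 * h)) = pi\<^sup>2 + pi\<^sup>2 * (2 * (11999999 * h))" by (simp add: algebra_simps)
        ultimately have neg: "\<gamma>\<^sup>2 - (pi * n)\<^sup>2 + \<mu> < 0" using h(1) unfolding power_mult_distrib by linarith
        have "q \<in> closure D" using q closure_subset by blast
        have "(- \<gamma>)\<^sup>2 * exp (- \<gamma> * (fst q - x1)) * g (snd q)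
          + exp (- \<gamma> * (fst q - x1)) * (5 * (- (pi * n)\<^sup>2 * cos (pi * n * (snd q - c)))) + \<mu> * \<psi> q
          = (\<gamma>\<^sup>2 - (pi * n)\<^sup>2 + \<mu>) * \<psi> q"
          unfolding \<psi>_def g_def by (simp add: algebra_simps)
        also have "\<dots> < 0" using neg \<psi>0[OF \<open>q \<in> closure D\<close>] by (rule mult_neg_pos)
        finally show ?thesis .
      qed
      ultimately show "\<exists>l. lap_at \<psi> q l \<and> l + \<mu> * \<psi> q < 0" by blast
    next
      have "(x, y) \<in> D" using p x False by (simp add: D_def)
      then show "(x, y) \<in> closure D" using closure_subset[of D] by auto
    qed
  qed
  then show "w (x, y) \<le> 5 * cos (pi * n * (y - (\<alpha> + \<beta>) / 2)) * exp (- (14000 / L) * (x - x1))"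
    unfolding \<psi>_def g_def c_def \<gamma>_def by (simp add: mult.commute)
qed

text \<open>At \<open>x2 = x1 + L / 2000\<close> the decay has pushed \<open>w\<close> below 2/5. To
  the left of \<open>x2\<close> a barrier in the slow variable \<open>(20 / L) * (x2 - x)\<close>
  lets \<open>w\<close> regain at most another 2/5 over the length \<open>L / 1000\<close>, so the
  value 1 is not reached.\<close>

lemma max_point_left_of:
  assumes L: "L \<ge> 10^6" and \<mu>: "\<mu> \<le> pi\<^sup>2 + 320 / L\<^sup>2"
    and ab: "0 \<le> \<alpha>" "\<beta> \<le> 1" "\<beta> - \<alpha> = 1 - 12000000 / L\<^sup>2"
    and S: "\<And>x y. (x, y) \<in> U \<Longrightarrow> x1 \<le> x \<Longrightarrow> \<alpha> < y \<and> y < \<beta>"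
    and p: "w (x0, y0) = 1"
  shows "x0 < x1 - L / 2000"
proof (rule ccontr)
  assume contr: "\<not> x0 < x1 - L / 2000"
  have p0: "(x0, y0) \<in> U" using off[of "(x0, y0)"] p by auto
  have L2: "L\<^sup>2 \<ge> 10^12" using power_mono[OF L, of 2] by simp
  then have L0: "L > 0" "L\<^sup>2 > 0" using L by auto
  define h where "h = 1 / L\<^sup>2"
  have h: "0 < h" "h \<le> 1 / 10^12" unfolding h_def using L2 L0 by (auto simp: field_simps)
  define x2 where "x2 = x1 + L / 2000"
  define n where "n = (1 - 1 / L\<^sup>2) / (1 - 12000000 / L\<^sup>2)"
  \<comment> \<open>A frequency slightly below \<pi> makes the cosine at least \<open>h\<close> on
    the closed strip, as the comparison principle needs.\<close>
  define m where "m = 1 - h"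
  have S': "\<forall>x y. (x, y) \<in> U \<longrightarrow> x1 \<le> x \<longrightarrow> \<alpha> < y \<and> y < \<beta>" using S by blast
  have e7: "exp (- 7) \<le> (1/100::real)"
  proof -
    have "(2::real) ^ 7 \<le> exp 1 ^ 7" using exp_ge_add_one_self[of 1] by (intro power_mono) auto
    also have "exp (1::real) ^ 7 = exp 7" by (simp add: exp_of_nat_mult[symmetric])
    finally show ?thesis by (simp add: exp_minus field_simps)
  qed
  have cos_m: "cos (pi * m * (b - 1/2)) \<ge> h + min b (1 - b)" if "0 \<le> b" "b \<le> 1" for b
  proof -
    have m: "1/2 \<le> m" "m \<le> 1" unfolding m_def using h by auto
    have half: "\<bar>b - 1/2\<bar> \<le> 1/2" using that by linarith
    have "m * \<bar>b - 1/2\<bar> \<le> 1 * (1/2)" using m half by (intro mult_mono) auto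
    then have "cos (pi * (m * (b - 1/2))) \<ge> 1 - 2 * \<bar>m * (b - 1/2)\<bar>"
      using m by (intro cos_ge_linear) (simp add: abs_mult)
    moreover have "1 - 2 * \<bar>m * (b - 1/2)\<bar> = h + 2 * m * (1/2 - \<bar>b - 1/2\<bar>)"
      using m unfolding abs_mult by (simp add: m_def algebra_simps)
    moreover have "1 * (1/2 - \<bar>b - 1/2\<bar>) \<le> 2 * m * (1/2 - \<bar>b - 1/2\<bar>)"
      using m half by (intro mult_right_mono) auto
    moreover have "min b (1 - b) = 1/2 - \<bar>b - 1/2\<bar>" unfolding min_def abs_if by (simp add: field_simps)
    ultimately show ?thesis by (simp add: mult.assoc)
  qed
  \<comment> \<open>The factor 2/5 is 5 * 8 / 100: 5 from \<open>decay\<close>, 1/100 from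
    \<open>exp (- 7)\<close>, and 8 from replacing the cosine of the narrow section by that of the
    strip.\<close>
  have after_x2: "w (a, b) \<le> 2 / 5 * cos (pi * m * (b - 1/2))" if q: "(a, b) \<in> U" "x2 \<le> a" for a b
  proof -
    have a: "x1 \<le> a" using q(2) L0 unfolding x2_def by auto
    note d = decay[OF L \<mu> ab S' q(1) a, folded n_def]
    have sb: "\<alpha> < b" "b < \<beta>" using S[OF q(1) a] by auto
    have "- (14000 / L) * (a - x1) \<le> - (14000 / L) * (L / 2000)"
      using q(2) L0 unfolding x2_def by (intro mult_left_mono_neg) auto
    then have "exp (- (14000 / L) * (a - x1)) \<le> exp (- 7)" using L0 by simp
    then have e: "exp (- (14000 / L) * (a - x1)) \<le> 1/100" using e7 by linarith
    have "cos (pi * (n * (b - (\<alpha> + \<beta>) / 2))) \<le> 2 * (1 - 2 * \<bar>n * (b - (\<alpha> + \<beta>) / 2)\<bar>)"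
      by (rule cos_le_linear[OF d(2)])
    also have "\<bar>n * (b - (\<alpha> + \<beta>) / 2)\<bar> = n * ((\<beta> - \<alpha>) / 2) - n * min (b - \<alpha>) (\<beta> - b)"
    proof -
      have "\<bar>b - (\<alpha> + \<beta>) / 2\<bar> = (\<beta> - \<alpha>) / 2 - min (b - \<alpha>) (\<beta> - b)"
        unfolding min_def abs_if by (simp add: field_simps)
      moreover have "\<bar>n * (b - (\<alpha> + \<beta>) / 2)\<bar> = n * \<bar>b - (\<alpha> + \<beta>) / 2\<bar>"
        using d(3) unfolding abs_mult by simp
      ultimately show ?thesis by (simp only: right_diff_distrib)
    qed
    also have "n * ((\<beta> - \<alpha>) / 2) = (1 - h) / 2"
    proof -
      have "1 - 12000000 / L\<^sup>2 \<noteq> 0" using h unfolding h_def by auto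
      then show ?thesis unfolding ab(3) n_def h_def by simp
    qed
    also have "2 * (1 - 2 * ((1 - h) / 2 - n * min (b - \<alpha>) (\<beta> - b))) = 2 * h + 4 * (n * min (b - \<alpha>) (\<beta> - b))"
      by (simp add: field_simps)
    also have "\<dots> \<le> 2 * h + 4 * (2 * min b (1 - b))"
    proof -
      have "n * min (b - \<alpha>) (\<beta> - b) \<le> 2 * min b (1 - b)"
        using d(3,4) sb ab by (intro mult_mono) auto
      then show ?thesis by simp
    qed
    also have "\<dots> \<le> 8 * (h + min b (1 - b))" using h by simp
    also have "\<dots> \<le> 8 * cos (pi * m * (b - 1/2))" using cos_m[of b] sb ab by auto
    finally have c8: "cos (pi * n * (b - (\<alpha> + \<beta>) / 2)) \<le> 8 * cos (pi * m * (b - 1/2))" by (simp add: mult.assoc)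
    have cpos: "cos (pi * m * (b - 1/2)) \<ge> 0"
    proof -
      define t where "t = min b (1 - b)"
      have t: "0 \<le> t" "0 \<le> b" "b \<le> 1" unfolding t_def using sb ab by auto
      show ?thesis using cos_m[OF t(2,3), folded t_def] t(1) h(1) by linarith
    qed
    have "w (a, b) \<le> 5 * cos (pi * n * (b - (\<alpha> + \<beta>) / 2)) * exp (- (14000 / L) * (a - x1))" by (rule d(1))
    also have "\<dots> \<le> 5 * (8 * cos (pi * m * (b - 1/2))) * exp (- (14000 / L) * (a - x1))"
      using c8 by (intro mult_right_mono mult_left_mono) auto
    also have "\<dots> \<le> 5 * (8 * cos (pi * m * (b - 1/2))) * (1/100)"
      using e cpos by (intro mult_left_mono) auto
    finally show ?thesis by simp
  qed
  show False
  proof (cases "x2 \<le> x0")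
    case True
    have "w (x0, y0) \<le> 2/5 * 1" using after_x2[OF p0 True] cos_le_one[of "pi * m * (y0 - 1/2)"] by linarith
    then show False using p by simp
  next
    case False
    define D where "D = U \<inter> {x2 - L/20<..<x2} \<times> UNIV"
    \<comment> \<open>The cosine matches the bound 2/5 at \<open>x2\<close>. At the other end the
      argument is 1, and 20 sin 1 \<ge> 10 matches the linear boundary estimate for
      \<open>w\<close>.\<close>
    define g where "g a = 20 * sin (- (20 / L) * (a - x2)) + 2/5 * cos (- (20 / L) * (a - x2))" for a
    define \<psi> where "\<psi> q = g (fst q) * cos (pi * m * (snd q - 1/2))" for q :: "real \<times> real"
    have clD: "x2 - L/20 \<le> fst q" "fst q \<le> x2" "0 \<le> snd q" "snd q \<le> 1" if "q \<in> closure D" for q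
    proof -
      have "closure D \<subseteq> {x2 - L/20..x2} \<times> {0..1}"
        by (rule closure_minimal) (use strip in \<open>force simp: D_def\<close>, auto intro: closed_Times)
      then show "x2 - L/20 \<le> fst q" "fst q \<le> x2" "0 \<le> snd q" "snd q \<le> 1" using that by (auto simp: mem_Times_iff)
    qed
    have arg: "0 \<le> - (20 / L) * (a - x2)" "- (20 / L) * (a - x2) \<le> 1" if "x2 - L/20 \<le> a" "a \<le> x2" for a
      using that L0 by (auto simp: field_simps)
    have g0: "0 < g a" if "x2 - L/20 \<le> a" "a \<le> x2" for a
    proof -
      have "sin (- (20 / L) * (a - x2)) \<ge> 0" using arg[OF that] pi_gt3 by (intro sin_ge_zero) linarith+
      moreover have "cos (- (20 / L) * (a - x2)) > 0" using arg[OF that] pi_gt3 by (intro cos_gt_zero_pi) linarith+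
      ultimately show ?thesis unfolding g_def by linarith
    qed
    have \<mu>5: "\<mu> * (1/5)\<^sup>2 < 1"
    proof -
      have "320 / L\<^sup>2 \<le> 1" using L2 by (simp add: divide_le_eq)
      then have "\<mu> < 17" using \<mu> pi_sq_gt_9 by linarith
      then show ?thesis by (simp add: power2_eq_square)
    qed
    have wall: "w (a, b) \<le> 10 * cos (pi * m * (b - 1/2))" if "0 \<le> b" "b \<le> 1" for a b
    proof -
      have "w (a, b) \<le> 10 * min b (1 - b)" using w_le_wall[OF _ \<mu>5, of a b] that by (simp add: min_def)
      also have "\<dots> \<le> 10 * cos (pi * m * (b - 1/2))" using cos_m[OF that] h(1) by simp
      finally show ?thesis .
    qed
    have cpos: "cos (pi * m * (b - 1/2)) > 0" if "0 \<le> b" "b \<le> 1" for b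
    proof -
      define t where "t = min b (1 - b)"
      have "0 \<le> t" unfolding t_def using that by simp
      then show ?thesis using cos_m[OF that, folded t_def] h(1) by linarith
    qed
    have p0D: "(x0, y0) \<in> D"
      using p0 False contr L0 unfolding D_def x2_def by auto
    have "w (x0, y0) \<le> \<psi> (x0, y0)"
    proof (rule comparison_principle[where D=D and q="\<lambda>_. \<mu>"])
      show "open D" unfolding D_def using U by (intro open_Int open_Times) auto
      show "bounded D" unfolding D_def using U bounded_subset by blast
      show "continuous_on (closure D) w" by (rule continuous_on_w)
      show "continuous_on (closure D) \<psi>" unfolding \<psi>_def g_def by (intro continuous_intros)
      show \<psi>0: "0 < \<psi> q" if "q \<in> closure D" for q
        unfolding \<psi>_def using g0 cpos clD[OF that] by simp
      show "w q \<le> \<psi> q" if q: "q \<in> closure D" "q \<notin> D" for q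
      proof (cases "q \<in> U")
        case True
        obtain a b where qab: "q = (a, b)" by (cases q)
        note cl = clD[OF q(1), unfolded qab fst_conv snd_conv]
        consider "a = x2" | "a = x2 - L/20" using True q(2) cl unfolding D_def qab by fastforce
        then show ?thesis
        proof cases
          case 1
          then show ?thesis using after_x2[of a b] True unfolding \<psi>_def g_def qab by simp
        next
          case 2
          have "- (20 / L) * (a - x2) = 1" unfolding 2 using L0 by simp
          moreover have "sin (1::real) \<ge> 1/2"
          proof -
            have "sin (pi * (1/pi)) \<ge> 2 * (1 / pi)" using pi_gt3 by (intro sin_pi_ge) (auto simp: field_simps)
            moreover have "2 * (1 / pi) \<ge> 1/2" using pi_less_4 by (simp add: field_simps)
            moreover have "sin (pi * (1 / pi)) = sin (1::real)" by simp
            ultimately show ?thesis by linarith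
          qed
          moreover have "cos (1::real) > 0" using pi_gt3 by (intro cos_gt_zero) auto
          ultimately have "g a \<ge> 10" unfolding g_def by simp
          then have "10 * cos (pi * m * (b - 1/2)) \<le> g a * cos (pi * m * (b - 1/2))"
            using cpos[OF cl(3,4)] by (intro mult_right_mono) auto
          then show ?thesis using wall[OF cl(3,4), of a] unfolding \<psi>_def qab by simp
        qed
      next
        case False
        then show ?thesis using off \<psi>0[OF q(1)] by simp
      qed
      show "\<exists>l. lap_at w q l \<and> 0 \<le> l + \<mu> * w q" if "q \<in> D" for q
        using sol_lap_at[OF sol, of q] that unfolding D_def by (intro exI[of _ "- \<mu> * w q"]) simp
      fix q assume q: "q \<in> D"
      have qcl: "q \<in> closure D" using q closure_subset[of D] by auto
      define k where "k = - (20 / L)"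
      have "d2_at g (fst q) (20 * (- k\<^sup>2 * sin (k * (fst q - x2))) + 2/5 * (- k\<^sup>2 * cos (k * (fst q - x2))))"
        unfolding g_def k_def by (intro d2_at_add d2_at_cmult d2_at_cos d2_at_sin)
      then have g2: "d2_at g (fst q) (- k\<^sup>2 * g (fst q))" unfolding g_def k_def by (simp add: algebra_simps)
      have "lap_at \<psi> q (- k\<^sup>2 * g (fst q) * cos (pi * m * (snd q - 1/2))
          + g (fst q) * (- (pi * m)\<^sup>2 * cos (pi * m * (snd q - 1/2))))"
        unfolding \<psi>_def by (intro lap_at_prod g2 d2_at_cos)
      moreover have "- k\<^sup>2 * g (fst q) * cos (pi * m * (snd q - 1/2))
          + g (fst q) * (- (pi * m)\<^sup>2 * cos (pi * m * (snd q - 1/2))) + \<mu> * \<psi> q < 0"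
      proof -
        \<comment> \<open>In units of \<open>h\<close>: the horizontal frequency gives 400, the
          eigenvalue costs 320 and the reduced vertical frequency at most 32.\<close>
        have "m\<^sup>2 \<ge> 1 - 2 * h" unfolding m_def by (simp add: power2_eq_square algebra_simps)
        then have "pi\<^sup>2 * m\<^sup>2 \<ge> pi\<^sup>2 * (1 - 2 * h)" by (intro mult_left_mono) auto
        moreover have "pi\<^sup>2 * (2 * h) \<le> 16 * (2 * h)" using pi_sq_gt_9 h by (intro mult_right_mono) auto
        moreover have "k\<^sup>2 = 400 * h" unfolding k_def h_def by (simp add: power_divide)
        moreover have "\<mu> \<le> pi\<^sup>2 + 320 * h" using \<mu> unfolding h_def by simp
        moreover have "pi\<^sup>2 * (1 - 2 * h) = pi\<^sup>2 - pi\<^sup>2 * (2 * h)" by (simp add: algebra_simps)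
        ultimately have neg: "- k\<^sup>2 - (pi * m)\<^sup>2 + \<mu> < 0" using h(1) unfolding power_mult_distrib by linarith
        have "- k\<^sup>2 * g (fst q) * cos (pi * m * (snd q - 1/2))
          + g (fst q) * (- (pi * m)\<^sup>2 * cos (pi * m * (snd q - 1/2))) + \<mu> * \<psi> q
          = (- k\<^sup>2 - (pi * m)\<^sup>2 + \<mu>) * \<psi> q"
          unfolding \<psi>_def by (simp add: algebra_simps)
        also have "\<dots> < 0" using neg \<psi>0[OF qcl] by (rule mult_neg_pos)
        finally show ?thesis .
      qed
      ultimately show "\<exists>l. lap_at \<psi> q l \<and> l + \<mu> * \<psi> q < 0" by blast
    next
      show "(x0, y0) \<in> closure D" using p0D closure_subset[of D] by auto
    qed
    have a0: "0 \<le> - (20 / L) * (x0 - x2)" using arg(1)[of x0] p0D unfolding D_def by simp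
    note \<open>w (x0, y0) \<le> \<psi> (x0, y0)\<close>
    also have "\<psi> (x0, y0) \<le> g x0 * 1"
      unfolding \<psi>_def using g0[of x0] clD[of "(x0, y0)"] p0D closure_subset[of D]
      by (simp add: subset_iff)
    also have "g x0 \<le> 20 * (- (20 / L) * (x0 - x2)) + 2/5 * 1"
      unfolding g_def using a0 by (intro add_mono mult_left_mono sin_x_le_x cos_le_one) auto
    also have "- (20 / L) * (x0 - x2) \<le> 20 / L * (L / 1000)"
    proof -
      have "20 / L * (x2 - x0) \<le> 20 / L * (L / 1000)"
        using contr L0 unfolding x2_def by (intro mult_left_mono) auto
      moreover have "- (20 / L) * (x0 - x2) = 20 / L * (x2 - x0)" by (simp only: minus_mult_commute minus_diff_eq)
      ultimately show ?thesis by linarith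
    qed
    finally show False using p L0 by simp
  qed
qed

end

section \<open>Derivative estimates in long domains\<close>

lemma csc_le: assumes "0 < \<delta>" "\<delta> \<le> y" "y \<le> 1 - \<delta>" shows "csc y \<le> 1 / (2 * \<delta>)"
proof -
  have "sin (pi * y) \<ge> 2 * \<delta>"
  proof (cases "y \<le> 1/2")
    case True
    then show ?thesis using sin_pi_ge[of y] assms by simp
  next
    case False
    then show ?thesis using sin_pi_ge[of "1 - y"] sin_pi_minus[of "pi * y"] assms
      by (simp add: right_diff_distrib)
  qed
  then show ?thesis unfolding csc_def using assms by (intro frac_le) auto
qed

lemma ctg_le: assumes "0 < \<delta>" "\<delta> \<le> y" "y \<le> 1 - \<delta>" shows "\<bar>ctg y\<bar> \<le> 2 / \<delta>"
proof -
  have y: "0 < y" "y < 1" using assms by auto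
  have "(ctg y)\<^sup>2 \<le> pi\<^sup>2 * (csc y)\<^sup>2" unfolding ctg_csc[OF y] by simp
  also have "\<dots> \<le> 4\<^sup>2 * (1 / (2 * \<delta>))\<^sup>2"
    using csc_le[OF assms] csc_ge_1[OF y] pi_less_4 pi_gt3 by (intro mult_mono power_mono) auto
  also have "\<dots> = (2 / \<delta>)\<^sup>2" by (simp add: power_divide power_mult_distrib)
  finally show ?thesis using assms power2_le_iff_abs_le[of "2 / \<delta>" "ctg y"] by simp
qed

text \<open>Used to trade the exponentially small influence of the lateral sides for the required
  power of 1/L.\<close>

lemma exp_minus_le: assumes "t > 0" "n > 0" shows "exp (- t) \<le> (real n / t) ^ n"
proof -
  have "(t / real n) ^ n \<le> (1 + t / real n) ^ n" using assms by (intro power_mono) auto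
  also have "\<dots> \<le> exp t" using assms by (intro exp_ge_one_plus_x_over_n_power_n) auto
  finally have "1 / exp t \<le> 1 / (t / real n) ^ n" using assms by (intro divide_left_mono) auto
  moreover have "1 / (t / real n) ^ n = (real n / t) ^ n" by (simp add: power_divide)
  moreover have "exp (- t) = 1 / exp t" by (simp add: exp_minus inverse_eq_divide)
  ultimately show ?thesis by simp
qed

section \<open>Reflections of the domain\<close>

lemma ground_state_affine:
  assumes "ground_state U w \<mu>" and \<sigma>: "\<sigma> = 1 \<or> \<sigma> = -1" and \<rho>: "\<rho> = 1 \<or> \<rho> = -1"
    and str: "\<And>y. 0 < \<rho> * y + \<beta> \<Longrightarrow> \<rho> * y + \<beta> < 1 \<Longrightarrow> 0 < y \<and> y < 1"
  shows "ground_state ((\<lambda>p. (\<sigma> * fst p + \<alpha>, \<rho> * snd p + \<beta>)) -` U) (\<lambda>p. w (\<sigma> * fst p + \<alpha>, \<rho> * snd p + \<beta>)) \<mu>"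
proof -
  interpret ground_state U w \<mu> by fact
  define \<phi> where "\<phi> p = (\<sigma> * fst p + \<alpha>, \<rho> * snd p + \<beta>)" for p :: "real \<times> real"
  have oV: "open (\<phi> -` U)" unfolding \<phi>_def by (intro open_vimage U continuous_intros)
  have "ground_state (\<phi> -` U) (\<lambda>p. w (\<phi> p)) \<mu>"
  proof
    show "open (\<phi> -` U)" by (rule oV)
    show "convex (\<phi> -` U)"
    proof (rule convexI)
      fix p q and u v :: real
      assume pq: "p \<in> \<phi> -` U" "q \<in> \<phi> -` U" and uv: "0 \<le> u" "0 \<le> v" "u + v = 1"
      have u1: "u = 1 - v" using uv by simp
      have "u *\<^sub>R \<phi> p + v *\<^sub>R \<phi> q \<in> U" using pq uv U(2) by (auto intro: convexD)
      also have "u *\<^sub>R \<phi> p + v *\<^sub>R \<phi> q = \<phi> (u *\<^sub>R p + v *\<^sub>R q)"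
        unfolding \<phi>_def u1 by (simp add: algebra_simps)
      finally show "u *\<^sub>R p + v *\<^sub>R q \<in> \<phi> -` U" by simp
    qed
    define \<theta> where "\<theta> q = (\<sigma> * (fst q - \<alpha>), \<rho> * (snd q - \<beta>))" for q :: "real \<times> real"
    have \<theta>: "\<phi> (\<theta> p) = p" for p using \<sigma> \<rho> unfolding \<theta>_def \<phi>_def by auto
    obtain q where "q \<in> U" using U(4) by blast
    then have "\<theta> q \<in> \<phi> -` U" by (simp add: \<theta>)
    then show "\<phi> -` U \<noteq> {}" by blast
    obtain K where K: "\<And>q. q \<in> U \<Longrightarrow> norm q \<le> K" using U(3) bounded_iff by blast
    show "bounded (\<phi> -` U)"
    proof (rule boundedI)
      fix p assume "p \<in> \<phi> -` U"
      then have "norm (\<phi> p) \<le> K" using K by simp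
      then have "\<bar>\<sigma> * fst p + \<alpha>\<bar> \<le> K" "\<bar>\<rho> * snd p + \<beta>\<bar> \<le> K"
        unfolding \<phi>_def using norm_fst_le[of "\<sigma> * fst p + \<alpha>" "\<rho> * snd p + \<beta>"] norm_snd_le[of "\<rho> * snd p + \<beta>" "\<sigma> * fst p + \<alpha>"]
        by simp_all
      then have "\<bar>fst p\<bar> \<le> K + \<bar>\<alpha>\<bar>" "\<bar>snd p\<bar> \<le> K + \<bar>\<beta>\<bar>" using \<sigma> \<rho> by auto
      then show "norm p \<le> (K + \<bar>\<alpha>\<bar>) + (K + \<bar>\<beta>\<bar>)"
        using norm_Pair_le[of "fst p" "snd p"] by simp
    qed
    show "0 < y \<and> y < 1" if "(x, y) \<in> \<phi> -` U" for x y
      using that strip[of "\<sigma> * x + \<alpha>" "\<rho> * y + \<beta>"] str unfolding \<phi>_def by simp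
    show "continuous_on UNIV (\<lambda>p. w (\<phi> p))"
      unfolding \<phi>_def by (intro continuous_on_compose2[OF cont] continuous_intros) auto
    show "sol \<mu> (\<lambda>p. w (\<phi> p)) (\<phi> -` U)"
      unfolding \<phi>_def by (rule sol_affine[OF sol _ _ oV[unfolded \<phi>_def]]) (use \<sigma> \<rho> in auto)
  qed (use off pos le1 in auto)
  then show ?thesis unfolding \<phi>_def .
qed

text \<open>This reflection reduces the left end of the domain to the right one; its companion in y
  reduces the upper wall to the lower one.\<close>

lemma reflect_x: "ground_state U w \<mu> \<Longrightarrow> ground_state ((\<lambda>p. (- 1 * fst p + 0, 1 * snd p + 0)) -` U) (\<lambda>p. w (- 1 * fst p + 0, 1 * snd p + 0)) \<mu>"
  by (rule ground_state_affine) auto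

lemma reflect_y: "ground_state U w \<mu> \<Longrightarrow> ground_state ((\<lambda>p. (1 * fst p + 0, - 1 * snd p + 1)) -` U) (\<lambda>p. w (1 * fst p + 0, - 1 * snd p + 1)) \<mu>"
  by (rule ground_state_affine) auto

lemma max_point_right_of:
  assumes "ground_state U w \<mu>" and L: "L \<ge> 10^6" and \<mu>: "\<mu> \<le> pi\<^sup>2 + 320 / L\<^sup>2"
    and ab: "0 \<le> \<alpha>" "\<beta> \<le> 1" "\<beta> - \<alpha> = 1 - 12000000 / L\<^sup>2"
    and S: "\<And>x y. (x, y) \<in> U \<Longrightarrow> x \<le> x1 \<Longrightarrow> \<alpha> < y \<and> y < \<beta>"
    and p: "w (x0, y0) = 1"
  shows "x1 + L / 2000 < x0"
proof -
  interpret r: ground_state "(\<lambda>p. (- 1 * fst p + 0, 1 * snd p + 0)) -` U" "\<lambda>p. w (- 1 * fst p + 0, 1 * snd p + 0)" \<mu>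
    by (rule reflect_x) fact
  have "- x0 < - x1 - L / 2000"
    by (rule r.max_point_left_of[OF L \<mu> ab, of "- x1" "- x0" y0]) (use S p in auto)
  then show ?thesis by simp
qed

text \<open>Here \<open>x0\<close> will be the abscissa of the maximum. The estimates on its
  location show that within \<open>L / 2000\<close> of it the domain fills the strip up to the
  deficit \<open>12000000 / L\<^sup>2\<close> at either wall.\<close>

locale long_box = ground_state +
  fixes L x0 :: real
  assumes L: "L \<ge> 10^6" and \<mu>_le: "\<mu> \<le> pi\<^sup>2 + 320 / L\<^sup>2"
    and box: "\<And>x y. \<bar>x - x0\<bar> \<le> L / 2000 \<Longrightarrow> 12000000 / L\<^sup>2 < y \<Longrightarrow> y < 1 - 12000000 / L\<^sup>2 \<Longrightarrow> (x, y) \<in> U"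
begin

lemma L_pos: "L > 0" using L by simp

lemma L2: "L\<^sup>2 \<ge> 10^12" "L\<^sup>2 > 0" using power_mono[OF L, of 2] L_pos by auto

lemma \<mu>_bounds: "\<bar>\<mu> - pi\<^sup>2\<bar> \<le> 320 / L\<^sup>2" "\<bar>\<mu> - pi\<^sup>2\<bar> \<le> 1" "\<mu> < 17" "0 < \<mu>" "\<mu> * (1/5)\<^sup>2 < 1"
proof -
  have 1: "320 / L\<^sup>2 \<le> 1" using L2 by (simp add: divide_le_eq)
  show 2: "\<bar>\<mu> - pi\<^sup>2\<bar> \<le> 320 / L\<^sup>2" using mu_ge \<mu>_le by simp
  then show "\<bar>\<mu> - pi\<^sup>2\<bar> \<le> 1" using 1 by simp
  then show 3: "\<mu> < 17" "0 < \<mu>" using pi_sq_gt_9 by auto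
  then show "\<mu> * (1/5)\<^sup>2 < 1" by (simp add: power2_eq_square)
qed

lemma gradient: assumes "(x, y) \<in> U" shows "\<bar>dx w (x, y)\<bar> \<le> 1200" "\<bar>dy w (x, y)\<bar> \<le> 1200"
  using gradient_le[OF _ \<mu>_bounds(5) assms] \<mu>_bounds(3,4) by auto

text \<open>Twice the deficit in \<open>box\<close>, so that closed rectangles between the heights
  \<open>\<delta>\<close> and \<open>1 - \<delta>\<close> lie in \<open>U\<close>. Its order L^-2 is
  the gain in \<open>dxx_bound\<close>.\<close>

definition \<delta> :: real where "\<delta> = 24000000 / L\<^sup>2"

lemma \<delta>: "0 < \<delta>" "\<delta> \<le> 1/1000" unfolding \<delta>_def using L2 by (auto simp: divide_le_eq)

lemma box_\<delta>: assumes "\<bar>x - x0\<bar> \<le> L / 2000" "\<delta> \<le> y" "y \<le> 1 - \<delta>" shows "(x, y) \<in> U"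
proof (rule box[OF assms(1)])
  have "12000000 / L\<^sup>2 < \<delta>" unfolding \<delta>_def using L2 by (intro divide_strict_right_mono) auto
  then show "12000000 / L\<^sup>2 < y" "y < 1 - 12000000 / L\<^sup>2" using assms(2,3) by auto
qed

lemma wall10: "w (x, y) \<le> 10 * \<bar>y\<bar>" "w (x, y) \<le> 10 * \<bar>1 - y\<bar>"
  using w_le_wall[OF _ \<mu>_bounds(5), of x y] by auto

lemma dxx_w:
  assumes x: "\<bar>x - x0\<bar> \<le> L / 4000" and y: "1/16 \<le> y" "y \<le> 15/16"
  shows "\<bar>dx (dx w) (x, y)\<bar> \<le> 10^15 / L\<^sup>2"
proof -
  define X where "X = L / 2000"
  have X: "X \<ge> 1" using L unfolding X_def by simp
  have R: "{x0-X..x0+X} \<times> {\<delta>..1-\<delta>} \<subseteq> U"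
  proof
    fix p assume "p \<in> {x0-X..x0+X} \<times> {\<delta>..1-\<delta>}"
    then obtain a b where "p = (a, b)" "x0 - X \<le> a" "a \<le> x0 + X" "\<delta> \<le> b" "b \<le> 1 - \<delta>" by auto
    moreover then have "\<bar>a - x0\<bar> \<le> L / 2000" unfolding X_def by linarith
    ultimately show "p \<in> U" using box_\<delta> by simp
  qed
  have D: "\<bar>darboux w (a, b)\<bar> \<le> 1300" if ab: "a \<in> {x0-X..x0+X}" "b \<in> {\<delta>..1-\<delta>}" for a b
  proof -
    have "(a, b) \<in> U" using R ab by blast
    then have 1: "\<bar>dy w (a, b)\<bar> \<le> 1200" by (rule gradient)
    \<comment> \<open>With \<open>t\<close> the distance to the nearer wall, the factor 1/t of
      \<open>ctg\<close> is compensated by the linear vanishing of \<open>w\<close>, so the Darboux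
      data stay bounded.\<close>
    define t where "t = min b (1 - b)"
    have t: "0 < t" "t \<le> b" "b \<le> 1 - t" "w (a, b) \<le> 10 * t"
      unfolding t_def using ab \<delta> wall10[of a b] by (auto simp: min_def)
    have "\<bar>ctg b * w (a, b)\<bar> \<le> 2 / t * (10 * t)"
      unfolding abs_mult using ctg_le[OF t(1-3)] t nonneg[of "(a, b)"] by (intro mult_mono) auto
    then have "\<bar>ctg b * w (a, b)\<bar> \<le> 20" using t(1) by simp
    then show ?thesis unfolding darboux_def using 1 by simp
  qed
  have "\<bar>dx (dx w) (x, y)\<bar> \<le> \<bar>\<mu> - pi\<^sup>2\<bar> * \<bar>w (x, y)\<bar> + 300 * (68 * 1300 * \<delta> + 4 * 1300 * exp (- X / 2))"
    by (rule dxx_bound[OF sol R X _ _ \<mu>_bounds(2)]) (use D X \<delta> x y in \<open>auto simp: X_def\<close>)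
  moreover have "\<bar>\<mu> - pi\<^sup>2\<bar> * \<bar>w (x, y)\<bar> \<le> 320 / L\<^sup>2 * 1"
    using \<mu>_bounds(1) nonneg[of "(x, y)"] le_1[of "(x, y)"] by (intro mult_mono) auto
  \<comment> \<open>The power 2 in \<open>exp_minus_le\<close> suffices for the order L^-2.\<close>
  moreover have "exp (- X / 2) \<le> 64000000 / L\<^sup>2"
    using exp_minus_le[of "X / 2" 2] X by (simp add: X_def power_divide)
  ultimately show ?thesis unfolding \<delta>_def by (simp add: field_simps)
qed

text \<open>Landau's interpolation: values in [0, 1] make \<open>dx w\<close> of order 1/L somewhere
  within a length of order L, and a second derivative O(L^-2) lets it change only by O(1/L) over
  that length.\<close>

lemma dx_w:
  assumes x: "\<bar>x - x0\<bar> \<le> L / 8000" and y: "1/16 \<le> y" "y \<le> 15/16"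
  shows "\<bar>dx w (x, y)\<bar> \<le> 2 * 10^11 / L"
proof -
  define s where "s = L / 8000"
  have s0: "s > 0" unfolding s_def using L_pos by simp
  have in_U: "(a, y) \<in> U" if "\<bar>a - x0\<bar> \<le> L / 4000" for a
    by (rule box_\<delta>) (use that y \<delta> L_pos in auto)
  have seg: "\<bar>a - x0\<bar> \<le> L / 4000" if "x \<le> a" "a \<le> x + s" for a
    using that x L_pos unfolding s_def by linarith
  have "\<exists>a. x < a \<and> a < x + s \<and> w (x + s, y) - w (x, y) = (x + s - x) * dx w (a, y)"
    by (rule MVT2) (use s0 sol_dx[OF sol in_U[OF seg]] in auto)
  then obtain a where a: "x < a" "a < x + s" "w (x + s, y) - w (x, y) = s * dx w (a, y)" by auto
  have C: "Ck_on (Suc 0) (dx w) U" using sol_Suc[OF sol] by simp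
  have "\<exists>b. x < b \<and> b < a \<and> dx w (a, y) - dx w (x, y) = (a - x) * dx (dx w) (b, y)"
    by (rule MVT2) (use a Ck_on_dx[OF C in_U[OF seg]] in auto)
  then obtain b where b: "x < b" "b < a" "dx w (a, y) - dx w (x, y) = (a - x) * dx (dx w) (b, y)" by auto
  have "\<bar>s * dx w (a, y)\<bar> \<le> 1" unfolding a(3)[symmetric]
    using nonneg[of "(x + s, y)"] nonneg[of "(x, y)"] le_1[of "(x + s, y)"] le_1[of "(x, y)"] by linarith
  then have 1: "\<bar>dx w (a, y)\<bar> \<le> 8000 / L" using s0 unfolding s_def by (simp add: abs_mult field_simps)
  have "\<bar>(a - x) * dx (dx w) (b, y)\<bar> \<le> s * (10^15 / L\<^sup>2)"
    unfolding abs_mult using a b dxx_w[OF seg[of b] y] by (intro mult_mono) auto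
  also have "\<dots> = 125000000000 / L" unfolding s_def using L_pos by (simp add: power2_eq_square)
  finally have "\<bar>dx w (x, y)\<bar> \<le> 8000 / L + 125000000000 / L" using 1 b(3) by linarith
  also have "\<dots> \<le> 2 * 10^11 / L" using L_pos by (simp add: field_simps)
  finally show ?thesis .
qed

text \<open>The slope of the wall and the bound of \<open>dx_w\<close> on y = 1/8 feed
  \<open>near_wall\<close>. At heights of order \<open>\<delta>\<close> both resulting terms are
  O(L^-3). The wall is an arbitrary function \<open>f\<close>, to serve the reflected domain as
  well.\<close>

lemma dx_w_wall:
  assumes graph: "\<And>x y. \<bar>x - x0\<bar> \<le> L / 2000 \<Longrightarrow> y \<le> 1/8 \<Longrightarrow> (x, y) \<in> U \<longleftrightarrow> f x < y"
    and f8: "\<And>x. \<bar>x - x0\<bar> \<le> L / 2000 \<Longrightarrow> f x < 1/8"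
    and slope: "\<And>x x'. \<bar>x - x0\<bar> \<le> L / 4000 \<Longrightarrow> \<bar>x' - x0\<bar> \<le> L / 4000 \<Longrightarrow>
        \<bar>f x - f x'\<bar> \<le> 48000000000 / L ^ 3 * \<bar>x - x'\<bar>"
    and x: "\<bar>x - x0\<bar> \<le> L / 20000" and y: "\<delta> \<le> y" "y < 1/8"
  shows "\<bar>dx w (x, y)\<bar> \<le> 10^18 / L ^ 3 + 10^13 * y / L"
proof -
  \<comment> \<open>Small enough for \<open>X + 1\<close> to stay where \<open>dx_w\<close> holds,
    large enough to leave a distance of at least \<open>L / 20000\<close> for the exponential
    decay.\<close>
  define X where "X = L / 9000"
  have X: "X > 0" "X + 1 \<le> L / 8000" using L unfolding X_def by auto
  have "\<bar>dx w (x, y)\<bar> \<le> 4 * (48000000000 / L ^ 3) / (1/5) + 16 * (2 * 10^11 / L) * y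
      + 24 * (2 + \<bar>\<mu>\<bar>) / (1/5) * (cosh (x - x0) / cosh X)"
  proof (rule near_wall)
    show "\<mu> \<le> 23" using \<mu>_bounds(3) by simp
    fix a :: real assume a: "\<bar>a - x0\<bar> \<le> X + 1"
    then have a2: "\<bar>a - x0\<bar> \<le> L / 8000" using X by linarith
    then have a3: "\<bar>a - x0\<bar> \<le> L / 2000" using L_pos by linarith
    show "(a, b) \<in> U \<longleftrightarrow> f a < b" if "b \<le> 1/8" for b using graph[OF a3 that] .
    show "f a < 1/8" using f8[OF a3] .
    show "\<bar>dx w (a, 1/8)\<bar> \<le> 2 * 10^11 / L" by (rule dx_w[OF a2]) auto
    show "\<bar>f a - f a'\<bar> \<le> 48000000000 / L ^ 3 * \<bar>a - a'\<bar>" if "\<bar>a' - x0\<bar> \<le> X + 1" for a'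
      using that a2 X L_pos by (intro slope) linarith+
  next
    show "\<bar>x - x0\<bar> < X" using x L_pos unfolding X_def by linarith
    show "(x, y) \<in> U" using x y \<delta> L_pos by (intro box_\<delta>) linarith+
  qed (use X y \<mu>_bounds(5) in auto)
  also have "24 * (2 + \<bar>\<mu>\<bar>) / (1/5) * (cosh (x - x0) / cosh X) \<le> 2280 * (432000000000000 / L ^ 3)"
  proof (rule mult_mono)
    have "cosh (x - x0) / cosh X \<le> 2 * exp (L / 20000 - X)" by (rule cosh_ratio_le[OF x])
    also have "\<dots> \<le> 2 * exp (- (L / 20000))" using L_pos unfolding X_def by simp
    also have "exp (- (L / 20000)) \<le> (real 3 / (L / 20000)) ^ 3" using L_pos by (intro exp_minus_le) auto
    also have "2 * (real 3 / (L / 20000)) ^ 3 = 432000000000000 / L ^ 3" by (simp add: power_divide)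
    finally show "cosh (x - x0) / cosh X \<le> 432000000000000 / L ^ 3" by simp
  qed (use \<mu>_bounds(3,4) in auto)
  also have "4 * (48000000000 / L ^ 3) / (1/5) + 16 * (2 * 10^11 / L) * y + 2280 * (432000000000000 / L ^ 3)
    \<le> 10^18 / L ^ 3 + 10^13 * y / L"
  proof -
    have "16 * (2 * 10^11 / L) * y \<le> 10^13 * y / L" using y \<delta> L_pos by (simp add: divide_right_mono)
    moreover have "4 * (48000000000 / L ^ 3) / (1/5) + 2280 * (432000000000000 / L ^ 3) \<le> 10^18 / L ^ 3"
      using L_pos by (simp add: field_simps)
    ultimately show ?thesis by linarith
  qed
  finally show ?thesis by simp
qed

text \<open>The bound \<open>dxx_bound\<close> applied to \<open>dx w\<close>. Near the lines
  \<open>y = 2 * \<delta>\<close> and \<open>y = 1 - 2 * \<delta>\<close> this function is O(L^-3),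
  so an interior estimate at scale \<delta> makes its Darboux transform O(1/L) on them, and the
  barrier gains another factor \<delta>.\<close>

lemma dxxx_w:
  assumes wall: "\<And>x y. \<bar>x - x0\<bar> \<le> L / 20000 \<Longrightarrow> \<delta> \<le> y \<Longrightarrow> y < 1/8 \<Longrightarrow>
        \<bar>dx w (x, y)\<bar> \<le> 10^18 / L ^ 3 + 10^13 * y / L"
    and wall': "\<And>x y. \<bar>x - x0\<bar> \<le> L / 20000 \<Longrightarrow> \<delta> \<le> y \<Longrightarrow> y < 1/8 \<Longrightarrow>
        \<bar>dx w (x, 1 - y)\<bar> \<le> 10^18 / L ^ 3 + 10^13 * y / L"
    and x: "\<bar>x - x0\<bar> \<le> L / 50000" and y: "1/16 \<le> y" "y \<le> 15/16"
  shows "\<bar>dx (dx (dx w)) (x, y)\<bar> \<le> 10^31 / L ^ 3"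
proof -
  define X where "X = L / 25000"
  have X: "X \<ge> 1" using L unfolding X_def by simp
  \<comment> \<open>Squares of half-side \<open>r\<close> around points at height
    \<open>2 * \<delta>\<close> reach down to \<open>3/2 * \<delta>\<close> and up to
    \<open>5/2 * \<delta>\<close>, inside the range of the wall estimate.\<close>
  define r where "r = \<delta> / 2"
  have r: "0 < r" "r \<le> 1/2000" "\<delta> = 2 * r" unfolding r_def using \<delta> by auto
  have v: "sol \<mu> (dx w) U" by (rule sol_dx_sol[OF sol])
  have in_U: "(a, b) \<in> U" if "a \<in> {x0-X..x0+X}" "b \<in> {2*\<delta>..1-2*\<delta>}" for a b
  proof -
    have ab: "x0 - X \<le> a" "a \<le> x0 + X" "2 * \<delta> \<le> b" "b \<le> 1 - 2 * \<delta>" using that by auto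
    show ?thesis using ab L_pos \<delta> unfolding X_def by (intro box_\<delta>) linarith+
  qed
  then have R: "{x0-X..x0+X} \<times> {2*\<delta>..1-2*\<delta>} \<subseteq> U" by auto
  have sq: "{a-r..a+r} \<times> {b-r..b+r} \<subseteq> U" if "a \<in> {x0-X..x0+X}" "b \<in> {2*\<delta>..1-2*\<delta>}" for a b
  proof
    fix p assume "p \<in> {a-r..a+r} \<times> {b-r..b+r}"
    then obtain s t where st: "p = (s, t)" "a - r \<le> s" "s \<le> a + r" "b - r \<le> t" "t \<le> b + r" by auto
    have ab: "x0 - X \<le> a" "a \<le> x0 + X" "2 * \<delta> \<le> b" "b \<le> 1 - 2 * \<delta>" using that by auto
    have "(s, t) \<in> U"
      using ab st r X unfolding X_def by (intro box_\<delta>) linarith+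
    then show "p \<in> U" using st(1) by simp
  qed
  have wall_sq: "\<bar>darboux (dx w) (a, b)\<bar> \<le> 10^16 / L"
    if a: "a \<in> {x0-X..x0+X}" and b: "b = 2 * \<delta> \<or> b = 1 - 2 * \<delta>" for a b
  proof -
    have b': "b \<in> {2*\<delta>..1-2*\<delta>}" using b \<delta> by auto
    have small: "\<bar>dx w q\<bar> \<le> 10^21 / L ^ 3" if q: "q \<in> {a-r..a+r} \<times> {b-r..b+r}" for q
    proof -
      obtain s t where st: "q = (s, t)" "a - r \<le> s" "s \<le> a + r" "b - r \<le> t" "t \<le> b + r" using q by auto
      have s: "\<bar>s - x0\<bar> \<le> L / 20000"
      proof -
        have "x0 - X \<le> a" "a \<le> x0 + X" using a by auto
        moreover have "L \<ge> 1000000" using L by simp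
        ultimately show ?thesis using st(2-5) r unfolding X_def by linarith
      qed
      have bound: "10^18 / L ^ 3 + 10^13 * t' / L \<le> 10^21 / L ^ 3" if "t' \<le> 5/2 * \<delta>" for t'
      proof -
        have "10^13 * t' / L \<le> 10^13 * (5/2 * \<delta>) / L" using that L_pos by (intro divide_right_mono mult_left_mono) auto
        also have "\<dots> = 6 * 10^20 / L ^ 3" unfolding \<delta>_def using L_pos by (simp add: power2_eq_square power3_eq_cube)
        finally have "10^18 / L ^ 3 + 10^13 * t' / L \<le> 10^18 / L ^ 3 + 6 * 10^20 / L ^ 3" by simp
        also have "\<dots> \<le> 10^21 / L ^ 3" using L_pos by (simp add: field_simps)
        finally show ?thesis .
      qed
      from b show ?thesis
      proof
        assume "b = 2 * \<delta>"
        then have "\<delta> \<le> t" "t < 1/8" "t \<le> 5/2 * \<delta>" using st r \<delta> by linarith+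
        then show ?thesis using wall[OF s, of t] bound[of t] st(1) by simp
      next
        assume "b = 1 - 2 * \<delta>"
        then have "\<delta> \<le> 1 - t" "1 - t < 1/8" "1 - t \<le> 5/2 * \<delta>" using st r \<delta> by linarith+
        then show ?thesis using wall'[OF s, of "1 - t"] bound[of "1 - t"] st(1) by simp
      qed
    qed
    have "\<bar>dy (dx w) (a, b)\<bar> \<le> (2 + \<bar>\<mu>\<bar>) * (10^21 / L ^ 3) / r"
      by (rule sol_grad_bound(2)[OF v _ _ sq[OF a b'] small]) (use r in auto)
    also have "\<dots> \<le> 19 * (10^21 / L ^ 3) / r"
      using \<mu>_bounds(3,4) r L_pos by (intro divide_right_mono mult_right_mono) auto
    also have "\<dots> \<le> 2 * 10^15 / L" unfolding r_def \<delta>_def using L_pos by (simp add: field_simps power2_eq_square power3_eq_cube)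
    finally have 1: "\<bar>dy (dx w) (a, b)\<bar> \<le> 2 * 10^15 / L" .
    have "\<bar>ctg b * dx w (a, b)\<bar> \<le> 2 / (2 * \<delta>) * (10^21 / L ^ 3)"
      unfolding abs_mult using ctg_le[of "2 * \<delta>" b] b' \<delta> small[of "(a, b)"] r L_pos by (intro mult_mono) auto
    also have "\<dots> \<le> 10^15 / L" unfolding \<delta>_def using L_pos by (simp add: field_simps power2_eq_square power3_eq_cube)
    finally have 2: "\<bar>ctg b * dx w (a, b)\<bar> \<le> 10^15 / L" .
    have "2 * 10^15 / L + 10^15 / L \<le> 10^16 / L" using L_pos by (simp add: field_simps)
    then show ?thesis unfolding darboux_def using 1 2 by simp
  qed
  \<comment> \<open>A crude bound of order 1/\<delta> is enough on the lateral sides, since the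
    exponential factor absorbs any power of L.\<close>
  have lateral: "\<bar>darboux (dx w) (a, b)\<bar> \<le> 2 * L\<^sup>2" if a: "a \<in> {x0-X..x0+X}" and b: "b \<in> {2*\<delta>..1-2*\<delta>}" for a b
  proof -
    have g: "\<bar>dx w q\<bar> \<le> 1200" if "q \<in> {a-r..a+r} \<times> {b-r..b+r}" for q
      using that sq[OF a b] gradient(1)[of "fst q" "snd q"] by auto
    have "\<bar>dy (dx w) (a, b)\<bar> \<le> (2 + \<bar>\<mu>\<bar>) * 1200 / r"
      by (rule sol_grad_bound(2)[OF v _ _ sq[OF a b] g]) (use r in auto)
    also have "\<dots> \<le> 19 * 1200 / r"
      using \<mu>_bounds(3,4) r by (intro divide_right_mono mult_right_mono) auto
    also have "\<dots> \<le> L\<^sup>2" unfolding r_def \<delta>_def using L_pos by (simp add: field_simps)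
    finally have 1: "\<bar>dy (dx w) (a, b)\<bar> \<le> L\<^sup>2" .
    have "\<bar>ctg b * dx w (a, b)\<bar> \<le> 2 / (2 * \<delta>) * 1200"
      unfolding abs_mult using ctg_le[of "2 * \<delta>" b] b \<delta> g[of "(a, b)"] r by (intro mult_mono) auto
    also have "\<dots> \<le> L\<^sup>2" unfolding \<delta>_def using L_pos by (simp add: field_simps)
    finally show ?thesis unfolding darboux_def using 1 by simp
  qed
  have "\<bar>dx (dx (dx w)) (x, y)\<bar> \<le> \<bar>\<mu> - pi\<^sup>2\<bar> * \<bar>dx w (x, y)\<bar>
      + 300 * (68 * (10^16 / L) * (2 * \<delta>) + 4 * (2 * L\<^sup>2) * exp (- X / 2))"
    by (rule dxx_bound[OF v R X _ _ \<mu>_bounds(2)]) (use wall_sq lateral X \<delta> x y in \<open>auto simp: X_def\<close>)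
  also have "\<bar>\<mu> - pi\<^sup>2\<bar> * \<bar>dx w (x, y)\<bar> \<le> 320 / L\<^sup>2 * (2 * 10^11 / L)"
    using \<mu>_bounds(1) dx_w[OF _ y, of x] x L_pos by (intro mult_mono) auto
  \<comment> \<open>The power 5 turns the growth L^2 of the lateral data into L^-3.\<close>
  also have "4 * (2 * L\<^sup>2) * exp (- X / 2) \<le> 4 * (2 * L\<^sup>2) * (real 5 / (L / 50000)) ^ 5"
    using exp_minus_le[of "X / 2" 5] X by (intro mult_left_mono) (auto simp: X_def)
  also have "320 / L\<^sup>2 * (2 * 10^11 / L) + 300 * (68 * (10^16 / L) * (2 * \<delta>) + 4 * (2 * L\<^sup>2) * (real 5 / (L / 50000)) ^ 5)
     \<le> 10^31 / L ^ 3"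
  proof -
    define t where "t = 1 / L ^ 3"
    have "320 / L\<^sup>2 * (2 * 10^11 / L) = 64000000000000 * t"
      unfolding t_def using L_pos by (simp add: power2_eq_square power3_eq_cube)
    moreover have "68 * (10^16 / L) * (2 * \<delta>) = 32640000000000000000000000 * t"
      unfolding t_def \<delta>_def using L_pos by (simp add: power2_eq_square power3_eq_cube)
    moreover have "4 * (2 * L\<^sup>2) * (real 5 / (L / 50000)) ^ 5 = 8 * 250000 ^ 5 * t"
      unfolding t_def using L_pos by (simp add: power_divide field_simps eval_nat_numeral)
    moreover have "10^31 / L ^ 3 = 10^31 * t" unfolding t_def by simp
    moreover have "t > 0" unfolding t_def using L_pos by simp
    ultimately show ?thesis by simp
  qed
  finally show ?thesis by simp
qed

end

section \<open>Taylor estimates\<close>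

lemma taylor_remainder_le:
  fixes diff :: "nat \<Rightarrow> real \<Rightarrow> real"
  assumes n: "n > 0" and D: "\<And>m t. m < n \<Longrightarrow> \<bar>t - c\<bar> \<le> r \<Longrightarrow> (diff m has_real_derivative diff (Suc m) t) (at t)"
    and M: "\<And>t. \<bar>t - c\<bar> \<le> r \<Longrightarrow> \<bar>diff n t\<bar> \<le> M" and x: "\<bar>x - c\<bar> \<le> r"
  shows "\<bar>diff 0 x - (\<Sum>m<n. diff m c / fact m * (x - c) ^ m)\<bar> \<le> M * \<bar>x - c\<bar> ^ n"
proof (cases "x = c")
  case True
  obtain k where k: "n = Suc k" using n by (cases n) auto
  have "(\<Sum>m<n. diff m c / fact m * (x - c) ^ m) = diff 0 c"
    unfolding k True by (simp add: sum.lessThan_Suc_shift)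
  then show ?thesis using True n by (simp add: power_0_left)
next
  case False
  have "\<exists>t. (if x < c then x < t \<and> t < c else c < t \<and> t < x) \<and>
      diff 0 x = (\<Sum>m<n. diff m c / fact m * (x - c) ^ m) + diff n t / fact n * (x - c) ^ n"
    by (rule Taylor[where a="c - r" and b="c + r"]) (use n D x False in \<open>auto simp: abs_le_iff\<close>)
  then obtain t where t': "if x < c then x < t \<and> t < c else c < t \<and> t < x"
    and tx: "diff 0 x = (\<Sum>m<n. diff m c / fact m * (x - c) ^ m) + diff n t / fact n * (x - c) ^ n"
    by blast
  have "\<bar>t - c\<bar> \<le> r" using t' x by (cases "x < c") (simp_all add: abs_le_iff)
  note t = this tx
  have "\<bar>diff n t / fact n * (x - c) ^ n\<bar> = \<bar>diff n t\<bar> / fact n * \<bar>x - c\<bar> ^ n"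
    by (simp add: abs_mult power_abs)
  also have "\<dots> \<le> M * \<bar>x - c\<bar> ^ n"
  proof (rule mult_right_mono)
    have "\<bar>diff n t\<bar> / fact n \<le> \<bar>diff n t\<bar> / 1" using fact_ge_1 by (intro divide_left_mono) auto
    then show "\<bar>diff n t\<bar> / fact n \<le> M" using M[OF t(1)] by simp
  qed simp
  finally show ?thesis using t(2) by simp
qed

lemma taylor1:
  assumes D: "\<And>t. \<bar>t - c\<bar> \<le> r \<Longrightarrow> (f has_real_derivative f' t) (at t)"
    and M: "\<And>t. \<bar>t - c\<bar> \<le> r \<Longrightarrow> \<bar>f' t\<bar> \<le> M" and x: "\<bar>x - c\<bar> \<le> r"
  shows "\<bar>f x - f c\<bar> \<le> M * \<bar>x - c\<bar>"
  using taylor_remainder_le[where n=1 and diff="\<lambda>m. if m = 0 then f else f'" and c=c and r=r and M=M and x=x] assms by simp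

lemma taylor2:
  assumes D: "\<And>t. \<bar>t - c\<bar> \<le> r \<Longrightarrow> (f has_real_derivative f' t) (at t)"
    "\<And>t. \<bar>t - c\<bar> \<le> r \<Longrightarrow> (f' has_real_derivative f'' t) (at t)"
    and M: "\<And>t. \<bar>t - c\<bar> \<le> r \<Longrightarrow> \<bar>f'' t\<bar> \<le> M" and x: "\<bar>x - c\<bar> \<le> r"
  shows "\<bar>f x - (f c + f' c * (x - c))\<bar> \<le> M * \<bar>x - c\<bar> ^ 2"
proof -
  define diff where "diff m = (if m = 0 then f else if m = 1 then f' else f'')" for m :: nat
  have "\<bar>diff 0 x - (\<Sum>m<2. diff m c / fact m * (x - c) ^ m)\<bar> \<le> M * \<bar>x - c\<bar> ^ 2"
    by (rule taylor_remainder_le[where r=r]) (use assms in \<open>auto simp: diff_def less_2_cases_iff\<close>)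
  then show ?thesis by (simp add: diff_def eval_nat_numeral)
qed

lemma taylor3:
  assumes D: "\<And>t. \<bar>t - c\<bar> \<le> r \<Longrightarrow> (f has_real_derivative f' t) (at t)"
    "\<And>t. \<bar>t - c\<bar> \<le> r \<Longrightarrow> (f' has_real_derivative f'' t) (at t)"
    "\<And>t. \<bar>t - c\<bar> \<le> r \<Longrightarrow> (f'' has_real_derivative f''' t) (at t)"
    and M: "\<And>t. \<bar>t - c\<bar> \<le> r \<Longrightarrow> \<bar>f''' t\<bar> \<le> M" and x: "\<bar>x - c\<bar> \<le> r"
  shows "\<bar>f x - (f c + f' c * (x - c) + f'' c / 2 * (x - c)\<^sup>2)\<bar> \<le> M * \<bar>x - c\<bar> ^ 3"
proof -
  define diff where "diff m = (if m = 0 then f else if m = 1 then f' else if m = 2 then f'' else f''')" for m :: nat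
  have m3: "m < 3 \<Longrightarrow> m = 0 \<or> m = 1 \<or> m = 2" for m :: nat by auto
  have "\<bar>diff 0 x - (\<Sum>m<3. diff m c / fact m * (x - c) ^ m)\<bar> \<le> M * \<bar>x - c\<bar> ^ 3"
    by (rule taylor_remainder_le[where r=r]) (use assms in \<open>auto simp: diff_def dest!: m3\<close>)
  then show ?thesis by (simp add: diff_def eval_nat_numeral)
qed

text \<open>Near \<open>(x0, y0)\<close> the third derivatives give the estimate; far from it both \<open>w\<close> and the quadratic
  terms are dominated by the right-hand side.\<close>

lemma scaled_taylor:
  assumes s: "sol \<mu> w U" and l: "l > 0" and c: "0 < c" "c \<le> 1" and K: "K \<ge> 0"
    and box: "{x0 - c*l..x0 + c*l} \<times> {y0 - c..y0 + c} \<subseteq> U"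
    and w0: "w (x0, y0) = 1" "dx w (x0, y0) = 0" "dy w (x0, y0) = 0"
    and xxx: "\<And>x y. \<bar>x - x0\<bar> \<le> c*l \<Longrightarrow> \<bar>y - y0\<bar> \<le> c \<Longrightarrow> \<bar>dx (dx (dx w)) (x, y)\<bar> \<le> K / l ^ 3"
    and yxx: "\<And>y. \<bar>y - y0\<bar> \<le> c \<Longrightarrow> \<bar>dy (dx (dx w)) (x0, y)\<bar> \<le> K / l\<^sup>2"
    and yyx: "\<And>y. \<bar>y - y0\<bar> \<le> c \<Longrightarrow> \<bar>dy (dy (dx w)) (x0, y)\<bar> \<le> K / l"
    and yyy: "\<And>y. \<bar>y - y0\<bar> \<le> c \<Longrightarrow> \<bar>dy (dy (dy w)) (x0, y)\<bar> \<le> K"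
    and xx: "\<bar>dx (dx w) (x0, y0)\<bar> \<le> K / l\<^sup>2" and yx: "\<bar>dy (dx w) (x0, y0)\<bar> \<le> K / l"
    and yy: "\<bar>dy (dy w) (x0, y0)\<bar> \<le> K"
    and w01: "0 \<le> w (x, y)" "w (x, y) \<le> 1"
  shows "\<bar>w (x, y) - P2 w x0 y0 x y\<bar> \<le> (4 * K + 1 / c ^ 3 + 2 * K / c) * max (1 / l ^ 3 * \<bar>x - x0\<bar> ^ 3) (\<bar>y - y0\<bar> ^ 3)"
proof -
  define X Y where "X = \<bar>x - x0\<bar> / l" and "Y = \<bar>y - y0\<bar>"
  define m where "m = max X Y"
  have XY: "0 \<le> X" "0 \<le> Y" "X \<le> m" "Y \<le> m" "0 \<le> m" unfolding X_def Y_def m_def using l by (auto simp: max_def)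
  have xX: "\<bar>x - x0\<bar> = l * X" unfolding X_def using l by simp
  have max_m: "max (1 / l ^ 3 * \<bar>x - x0\<bar> ^ 3) (\<bar>y - y0\<bar> ^ 3) = m ^ 3"
  proof -
    have "1 / l ^ 3 * \<bar>x - x0\<bar> ^ 3 = X ^ 3" unfolding X_def by (simp add: power_divide)
    moreover have "max (X ^ 3) (Y ^ 3) = (max X Y) ^ 3"
      using XY power_mono[of X Y 3] power_mono[of Y X 3] by (auto simp: max_def)
    ultimately show ?thesis unfolding m_def Y_def by simp
  qed
  have p0: "(x0, y0) \<in> U" using box c l by auto
  have com: "dx (dy w) (x0, y0) = dy (dx w) (x0, y0)" using dy_dx_commute[OF s p0] by simp
  define H where "H = dx (dx w) (x0, y0)"
  define J where "J = dy (dx w) (x0, y0)"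
  define G where "G = dy (dy w) (x0, y0)"
  have P2: "P2 w x0 y0 x y = 1 + H / 2 * (x - x0)\<^sup>2 + J * (x - x0) * (y - y0) + G / 2 * (y - y0)\<^sup>2"
    unfolding P2_def com H_def J_def G_def by simp
  have pw: "X\<^sup>2 \<le> m\<^sup>2" "X * Y \<le> m\<^sup>2" "Y\<^sup>2 \<le> m\<^sup>2" "X ^ 3 \<le> m ^ 3" "Y ^ 3 \<le> m ^ 3" "X\<^sup>2 * Y \<le> m ^ 3" "X * Y\<^sup>2 \<le> m ^ 3"
  proof -
    show "X\<^sup>2 \<le> m\<^sup>2" "Y\<^sup>2 \<le> m\<^sup>2" "X ^ 3 \<le> m ^ 3" "Y ^ 3 \<le> m ^ 3" using XY by (auto intro: power_mono)
    show "X * Y \<le> m\<^sup>2" unfolding power2_eq_square using XY by (intro mult_mono) auto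
    have "X\<^sup>2 * Y \<le> m\<^sup>2 * m" using XY by (intro mult_mono power_mono) auto
    then show "X\<^sup>2 * Y \<le> m ^ 3" by (simp add: power3_eq_cube power2_eq_square)
    have "X * Y\<^sup>2 \<le> m * m\<^sup>2" using XY by (intro mult_mono power_mono) auto
    then show "X * Y\<^sup>2 \<le> m ^ 3" by (simp add: power3_eq_cube power2_eq_square)
  qed
  have nn: "0 \<le> 1 / c ^ 3" "0 \<le> 2 * K / c" "0 \<le> m ^ 3" using c K XY by auto
  show ?thesis
  proof (cases "X \<le> c \<and> Y \<le> c")
    case True
    have xc: "\<bar>x - x0\<bar> \<le> c * l" unfolding xX using True l by simp
    have yc: "\<bar>y - y0\<bar> \<le> c" using True unfolding Y_def by simp
    have in_U: "(a, b) \<in> U" if "\<bar>a - x0\<bar> \<le> c * l" "\<bar>b - y0\<bar> \<le> c" for a b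
      using box that by (auto simp: abs_le_iff)
    have in_U0: "(x0, b) \<in> U" if "\<bar>b - y0\<bar> \<le> c" for b using in_U[of x0 b] that c l by simp
    note s1 = sol_dx_sol[OF s] note s2 = sol_dy_sol[OF s]
    note s11 = sol_dx_sol[OF s1] note s12 = sol_dy_sol[OF s1] note s22 = sol_dy_sol[OF s2]
    have 1: "\<bar>w (x, y) - (w (x0, y) + dx w (x0, y) * (x - x0) + dx (dx w) (x0, y) / 2 * (x - x0)\<^sup>2)\<bar> \<le> K / l ^ 3 * \<bar>x - x0\<bar> ^ 3"
      by (rule taylor3[where r="c*l" and f="\<lambda>s. w (s, y)" and f'="\<lambda>s. dx w (s, y)" and f''="\<lambda>s. dx (dx w) (s, y)" and f'''="\<lambda>s. dx (dx (dx w)) (s, y)"])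
        (use xc yc in_U xxx sol_dx[OF s] sol_dx[OF s1] sol_dx[OF s11] in auto)
    have 2: "\<bar>w (x0, y) - (w (x0, y0) + dy w (x0, y0) * (y - y0) + dy (dy w) (x0, y0) / 2 * (y - y0)\<^sup>2)\<bar> \<le> K * \<bar>y - y0\<bar> ^ 3"
      by (rule taylor3[where r=c and f="\<lambda>s. w (x0, s)" and f'="\<lambda>s. dy w (x0, s)" and f''="\<lambda>s. dy (dy w) (x0, s)" and f'''="\<lambda>s. dy (dy (dy w)) (x0, s)"])
        (use yc in_U0 yyy sol_dy[OF s] sol_dy[OF s2] sol_dy[OF s22] in auto)
    have 3: "\<bar>dx w (x0, y) - (dx w (x0, y0) + dy (dx w) (x0, y0) * (y - y0))\<bar> \<le> K / l * \<bar>y - y0\<bar> ^ 2"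
      by (rule taylor2[where r=c and f="\<lambda>s. dx w (x0, s)" and f'="\<lambda>s. dy (dx w) (x0, s)" and f''="\<lambda>s. dy (dy (dx w)) (x0, s)"])
        (use yc in_U0 yyx sol_dy[OF s1] sol_dy[OF s12] in auto)
    have 4: "\<bar>dx (dx w) (x0, y) - dx (dx w) (x0, y0)\<bar> \<le> K / l\<^sup>2 * \<bar>y - y0\<bar>"
      by (rule taylor1[where r=c and f="\<lambda>s. dx (dx w) (x0, s)" and f'="\<lambda>s. dy (dx (dx w)) (x0, s)"])
        (use yc in_U0 yxx sol_dy[OF s11] in auto)
    \<comment> \<open>\<open>R1\<close> is the error of the expansion in x at height
      \<open>y\<close>; \<open>R2\<close>, \<open>R3\<close>, \<open>R4\<close> are the errors of
      expanding its three coefficients in y along the line x = \<open>x0\<close>. So every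
      derivative but the third one in x is needed only on that line.\<close>
    define R1 where "R1 = w (x, y) - (w (x0, y) + dx w (x0, y) * (x - x0) + dx (dx w) (x0, y) / 2 * (x - x0)\<^sup>2)"
    define R2 where "R2 = w (x0, y) - (1 + G / 2 * (y - y0)\<^sup>2)"
    define R3 where "R3 = dx w (x0, y) - J * (y - y0)"
    define R4 where "R4 = dx (dx w) (x0, y) - H"
    have b1: "\<bar>R1\<bar> \<le> K * m ^ 3"
    proof -
      have "K / l ^ 3 * \<bar>x - x0\<bar> ^ 3 = K * X ^ 3" unfolding X_def by (simp add: power_divide)
      also have "\<dots> \<le> K * m ^ 3" using pw K by (intro mult_left_mono) auto
      finally show ?thesis using 1 unfolding R1_def by linarith
    qed
    have b2: "\<bar>R2\<bar> \<le> K * m ^ 3"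
    proof -
      have "K * \<bar>y - y0\<bar> ^ 3 \<le> K * m ^ 3" using pw K unfolding Y_def by (intro mult_left_mono) auto
      then show ?thesis using 2 w0 unfolding R2_def G_def by simp
    qed
    have b3: "\<bar>R3 * (x - x0)\<bar> \<le> K * m ^ 3"
    proof -
      have "\<bar>R3 * (x - x0)\<bar> \<le> K / l * Y\<^sup>2 * (l * X)"
        unfolding abs_mult xX using 3 w0 l XY unfolding R3_def J_def Y_def by (intro mult_mono) auto
      also have "\<dots> = K * (X * Y\<^sup>2)" using l by simp
      also have "\<dots> \<le> K * m ^ 3" using pw K by (intro mult_left_mono) auto
      finally show ?thesis .
    qed
    have b4: "\<bar>R4 / 2 * (x - x0)\<^sup>2\<bar> \<le> K * m ^ 3"
    proof -
      have "\<bar>R4 / 2 * (x - x0)\<^sup>2\<bar> = \<bar>R4\<bar> / 2 * (l * X)\<^sup>2"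
        unfolding abs_mult using xX by (metis abs_divide abs_numeral power2_abs abs_power2)
      also have "\<dots> \<le> (K / l\<^sup>2 * Y) / 2 * (l * X)\<^sup>2"
        using 4 unfolding R4_def H_def Y_def by (intro mult_right_mono divide_right_mono) auto
      also have "\<dots> = K * (X\<^sup>2 * Y) / 2" using l by (simp add: power_mult_distrib)
      also have "\<dots> \<le> K * m ^ 3"
        using mult_left_mono[OF pw(6) K] mult_nonneg_nonneg[OF K nn(3)] by linarith
      finally show ?thesis .
    qed
    have "w (x, y) - P2 w x0 y0 x y = R1 + R2 + R3 * (x - x0) + R4 / 2 * (x - x0)\<^sup>2"
      unfolding P2 R1_def R2_def R3_def R4_def by (simp add: algebra_simps add_divide_distrib diff_divide_distrib)
    then have "\<bar>w (x, y) - P2 w x0 y0 x y\<bar> \<le> 4 * K * m ^ 3" using b1 b2 b3 b4 by linarith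
    also have "\<dots> \<le> (4 * K + 1 / c ^ 3 + 2 * K / c) * m ^ 3" using nn by (intro mult_right_mono) auto
    finally show ?thesis unfolding max_m .
  next
    case False
    \<comment> \<open>Far away 1 \<le> (m/c)^3 and m^2 \<le> m^3/c, so the crude bound
      \<open>1 + 2 * K * m\<^sup>2\<close> is already of the required form.\<close>
    then have mc: "c \<le> m" unfolding m_def by auto
    then have m0: "m > 0" using c by simp
    have h1: "\<bar>H / 2 * (x - x0)\<^sup>2\<bar> \<le> K / 2 * m\<^sup>2"
    proof -
      have "\<bar>H / 2 * (x - x0)\<^sup>2\<bar> = \<bar>H\<bar> / 2 * (l * X)\<^sup>2"
        unfolding abs_mult using xX by (metis abs_divide abs_numeral power2_abs abs_power2)
      also have "\<dots> \<le> (K / l\<^sup>2) / 2 * (l * X)\<^sup>2"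
        using xx unfolding H_def by (intro mult_right_mono divide_right_mono) auto
      also have "\<dots> = K / 2 * X\<^sup>2" using l by (simp add: power_mult_distrib)
      also have "\<dots> \<le> K / 2 * m\<^sup>2" using pw K by (intro mult_left_mono) auto
      finally show ?thesis .
    qed
    have h2: "\<bar>J * (x - x0) * (y - y0)\<bar> \<le> K * m\<^sup>2"
    proof -
      have "\<bar>J * (x - x0) * (y - y0)\<bar> \<le> K / l * (l * X) * Y"
        unfolding abs_mult xX Y_def[symmetric] using yx l XY unfolding J_def by (intro mult_right_mono) auto
      also have "\<dots> = K * (X * Y)" using l by simp
      also have "\<dots> \<le> K * m\<^sup>2" using pw K by (intro mult_left_mono) auto
      finally show ?thesis .
    qed
    have h3: "\<bar>G / 2 * (y - y0)\<^sup>2\<bar> \<le> K / 2 * m\<^sup>2"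
    proof -
      have "\<bar>G / 2 * (y - y0)\<^sup>2\<bar> = \<bar>G\<bar> / 2 * Y\<^sup>2"
        unfolding abs_mult Y_def by (metis abs_divide abs_numeral power2_abs abs_power2)
      also have "\<dots> \<le> K / 2 * m\<^sup>2"
        using yy pw K unfolding G_def by (intro mult_mono divide_right_mono) auto
      finally show ?thesis .
    qed
    have "\<bar>w (x, y) - P2 w x0 y0 x y\<bar> \<le> 1 + 2 * K * m\<^sup>2"
      unfolding P2 using w01 h1 h2 h3 by linarith
    also have "1 \<le> 1 / c ^ 3 * m ^ 3"
      using power_mono[OF mc, of 3] c by (simp add: field_simps)
    also have "2 * K * m\<^sup>2 \<le> 2 * K / c * m ^ 3"
    proof -
      have "2 * K * m\<^sup>2 * 1 \<le> 2 * K * m\<^sup>2 * (m / c)" using mc c K by (intro mult_left_mono) auto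
      then show ?thesis by (simp add: power3_eq_cube power2_eq_square algebra_simps)
    qed
    also have "1 / c ^ 3 * m ^ 3 + 2 * K / c * m ^ 3 \<le> (4 * K + 1 / c ^ 3 + 2 * K / c) * m ^ 3"
      using nn K by (simp add: algebra_simps)
    finally show ?thesis unfolding max_m by simp
  qed
qed

context ground_state
begin

lemma max_point:
  assumes "w (x0, y0) = 1"
  shows "(x0, y0) \<in> U" "dx w (x0, y0) = 0" "dy w (x0, y0) = 0"
proof -
  show p: "(x0, y0) \<in> U" using off[of "(x0, y0)"] assms by auto
  show "dx w (x0, y0) = 0"
    by (rule DERIV_local_max[OF sol_dx[OF sol p], of 1]) (use assms le_1 in auto)
  show "dy w (x0, y0) = 0"
    by (rule DERIV_local_max[OF sol_dy[OF sol p], of 1]) (use assms le_1 in auto)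
qed

text \<open>With d = 1/400 the boundary estimate gives 1 = w (x0, y0) \<le> 800 dist, so a square of
  fixed size around the maximum lies in \<open>U\<close> and interior estimates control three
  derivatives.\<close>

lemma taylor_short:
  assumes \<mu>: "\<mu> \<le> 100000" and max: "w (x0, y0) = 1"
  shows "\<bar>w (x, y) - P2 w x0 y0 x y\<bar> \<le> 10^60 * max (\<bar>x - x0\<bar> ^ 3) (\<bar>y - y0\<bar> ^ 3)"
proof -
  have \<mu>0: "0 < \<mu>" using mu_ge pi_sq_gt_9 by linarith
  have \<mu>d: "\<mu> * (1/400)\<^sup>2 < 1" using \<mu> by (simp add: power2_eq_square)
  have far: "1 / 800 \<le> norm ((x0, y0) - z)" if "z \<notin> U" for z
    using w_le_dist[OF _ \<mu>d that, of "(x0, y0)"] max by simp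
  have sq: "{x0-1/2000..x0+1/2000} \<times> {y0-1/2000..y0+1/2000} \<subseteq> U"
  proof
    fix p assume p: "p \<in> {x0-1/2000..x0+1/2000} \<times> {y0-1/2000..y0+1/2000}"
    show "p \<in> U"
    proof (rule ccontr)
      assume "p \<notin> U"
      from far[OF this] have "1/800 \<le> \<bar>x0 - fst p\<bar> + \<bar>y0 - snd p\<bar>"
        using norm_Pair_le[of "x0 - fst p" "y0 - snd p"] by (cases p) simp
      moreover have "\<bar>x0 - fst p\<bar> \<le> 1/2000" "\<bar>y0 - snd p\<bar> \<le> 1/2000"
        using p by (simp_all only: mem_Times_iff atLeastAtMost_iff abs_le_iff) linarith+
      ultimately show False by linarith
    qed
  qed
  \<comment> \<open>Each derivative costs a margin 1/10000 of the half-side 5/10000 and a factor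
    10^10; three of them leave a square of half-side 2/10000.\<close>
  have step: "\<bar>dx v (a, b)\<bar> \<le> 10^10 * M \<and> \<bar>dy v (a, b)\<bar> \<le> 10^10 * M"
    if v: "sol \<mu> v U" and r: "r + 1/10000 \<le> 1/2000" and M: "\<And>a b. \<bar>a - x0\<bar> \<le> r + 1/10000 \<Longrightarrow> \<bar>b - y0\<bar> \<le> r + 1/10000 \<Longrightarrow> \<bar>v (a, b)\<bar> \<le> M"
      and ab: "\<bar>a - x0\<bar> \<le> r" "\<bar>b - y0\<bar> \<le> r" for v r M a b
  proof -
    have near: "\<bar>s - x0\<bar> \<le> r + 1/10000 \<and> \<bar>t - y0\<bar> \<le> r + 1/10000" if "(s, t) \<in> {a-1/10000..a+1/10000} \<times> {b-1/10000..b+1/10000}" for s t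
    proof -
      have "a - 1/10000 \<le> s" "s \<le> a + 1/10000" "b - 1/10000 \<le> t" "t \<le> b + 1/10000" using that by auto
      then show ?thesis using ab by linarith
    qed
    have sub: "{a-1/10000..a+1/10000} \<times> {b-1/10000..b+1/10000} \<subseteq> U"
    proof
      fix p assume p: "p \<in> {a-1/10000..a+1/10000} \<times> {b-1/10000..b+1/10000}"
      obtain s t where st: "p = (s, t)" by (cases p)
      have "\<bar>s - x0\<bar> \<le> r + 1/10000" "\<bar>t - y0\<bar> \<le> r + 1/10000" using near p st by blast+
      then have "x0 - 1/2000 \<le> s" "s \<le> x0 + 1/2000" "y0 - 1/2000 \<le> t" "t \<le> y0 + 1/2000" using r by linarith+
      then show "p \<in> U" using sq st by auto
    qed
    have M': "\<bar>v q\<bar> \<le> M" if "q \<in> {a-1/10000..a+1/10000} \<times> {b-1/10000..b+1/10000}" for q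
      using M[of "fst q" "snd q"] near[of "fst q" "snd q"] that by simp
    have M0: "M \<ge> 0" using M'[of "(a, b)"] by force
    have "(2 + \<bar>\<mu>\<bar>) * M / (1/10000) \<le> 100002 * M / (1/10000)"
      using \<mu> \<mu>0 M0 by (intro divide_right_mono mult_right_mono) auto
    also have "\<dots> \<le> 10^10 * M" using M0 by simp
    finally have K: "(2 + \<bar>\<mu>\<bar>) * M / (1/10000) \<le> 10^10 * M" .
    have "\<bar>dx v (a, b)\<bar> \<le> (2 + \<bar>\<mu>\<bar>) * M / (1/10000)"
      by (rule sol_grad_bound(1)[OF v _ _ sub M']) auto
    moreover have "\<bar>dy v (a, b)\<bar> \<le> (2 + \<bar>\<mu>\<bar>) * M / (1/10000)"
      by (rule sol_grad_bound(2)[OF v _ _ sub M']) auto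
    ultimately show ?thesis using K by linarith
  qed
  note s1 = sol_dx_sol[OF sol] note s2 = sol_dy_sol[OF sol]
  note s11 = sol_dx_sol[OF s1] note s12 = sol_dy_sol[OF s1] note s22 = sol_dy_sol[OF s2]
  have d1: "\<bar>dx w (a, b)\<bar> \<le> 10^10 \<and> \<bar>dy w (a, b)\<bar> \<le> 10^10" if "\<bar>a - x0\<bar> \<le> 4/10000" "\<bar>b - y0\<bar> \<le> 4/10000" for a b
    using step[OF sol _ _ that, of 1] nonneg le_1 by simp
  have d2: "\<bar>dx (dx w) (a, b)\<bar> \<le> 10^20 \<and> \<bar>dy (dx w) (a, b)\<bar> \<le> 10^20 \<and> \<bar>dy (dy w) (a, b)\<bar> \<le> 10^20"
    if "\<bar>a - x0\<bar> \<le> 3/10000" "\<bar>b - y0\<bar> \<le> 3/10000" for a b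
    using step[OF s1 _ _ that, of "10^10"] step[OF s2 _ _ that, of "10^10"] d1 by simp
  have d3: "\<bar>dx (dx (dx w)) (a, b)\<bar> \<le> 10^30 \<and> \<bar>dy (dx (dx w)) (a, b)\<bar> \<le> 10^30 \<and>
      \<bar>dy (dy (dx w)) (a, b)\<bar> \<le> 10^30 \<and> \<bar>dy (dy (dy w)) (a, b)\<bar> \<le> 10^30"
    if "\<bar>a - x0\<bar> \<le> 2/10000" "\<bar>b - y0\<bar> \<le> 2/10000" for a b
    using step[OF s11 _ _ that, of "10^20"] step[OF s12 _ _ that, of "10^20"] step[OF s22 _ _ that, of "10^20"] d2 by simp
  define c :: real where "c = 2/10000"
  have c: "0 < c" "c \<le> 1" by (auto simp: c_def)
  have "\<bar>w (x, y) - P2 w x0 y0 x y\<bar> \<le> (4 * 10^30 + 1 / c ^ 3 + 2 * 10^30 / c) * max (1 / 1 ^ 3 * \<bar>x - x0\<bar> ^ 3) (\<bar>y - y0\<bar> ^ 3)"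
  proof (rule scaled_taylor[OF sol _ c])
    show "{x0 - c * 1..x0 + c * 1} \<times> {y0 - c..y0 + c} \<subseteq> U"
      by (rule order_trans[OF _ sq]) (auto simp: c_def)
  qed (use d2[of x0 y0] d3 max max_point[OF max] nonneg le_1 in \<open>auto simp: c_def\<close>)
  also have "\<dots> \<le> 10^60 * max (1 / 1 ^ 3 * \<bar>x - x0\<bar> ^ 3) (\<bar>y - y0\<bar> ^ 3)"
    by (intro mult_right_mono) (auto simp: c_def le_max_iff_disj power_divide)
  finally show ?thesis by simp
qed

end

context long_box
begin

text \<open>Derivatives in y lose no power of L: interior estimates on squares of fixed size,
  applied to the bounds for \<open>dx (dx w)\<close>, \<open>dx w\<close> and \<open>dy w\<close>,
  give the mixed third derivatives and the third one in y.\<close>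

lemma taylor_long:
  assumes max: "w (x0, y0) = 1"
    and xxx: "\<And>x y. \<bar>x - x0\<bar> \<le> L / 50000 \<Longrightarrow> 1/16 \<le> y \<Longrightarrow> y \<le> 15/16 \<Longrightarrow> \<bar>dx (dx (dx w)) (x, y)\<bar> \<le> 10^31 / L ^ 3"
  shows "\<bar>w (x, y) - P2 w x0 y0 x y\<bar> \<le> 10^60 * max (1 / L ^ 3 * \<bar>x - x0\<bar> ^ 3) (\<bar>y - y0\<bar> ^ 3)"
proof -
  have y0: "1/10 \<le> y0" "y0 \<le> 9/10"
    using wall10[of x0 y0] max strip[OF max_point(1)[OF max]] by auto
  define c :: real where "c = 1/50000"
  \<comment> \<open>From y0 in [1/10, 9/10], squares of this half-side around heights within
    \<open>c\<close> of \<open>y0\<close> stay in [1/16, 15/16]. Then 1216 = 19 * 64 and 11829248 =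
    8 * 19^2 * 64^2.\<close>
  define r :: real where "r = 1/64"
  have sq: "\<bar>s - x0\<bar> \<le> L / 50000 \<and> 1/16 \<le> t \<and> t \<le> 15/16" if "(s, t) \<in> {x0-r..x0+r} \<times> {y-r..y+r}" "\<bar>y - y0\<bar> \<le> c" for s t y
  proof -
    have "x0 - r \<le> s" "s \<le> x0 + r" "y - r \<le> t" "t \<le> y + r" using that by auto
    moreover have "L \<ge> 1000000" using L by simp
    ultimately show ?thesis using that(2) y0 unfolding r_def c_def by linarith
  qed
  have in_U: "(s, t) \<in> U" if "\<bar>s - x0\<bar> \<le> L / 50000" "1/16 \<le> t" "t \<le> 15/16" for s t
    using that L_pos \<delta> by (intro box_\<delta>) linarith+
  have sub: "{x0-r..x0+r} \<times> {y-r..y+r} \<subseteq> U" if "\<bar>y - y0\<bar> \<le> c" for y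
    using sq[OF _ that] in_U by auto
  have \<mu>2: "2 + \<bar>\<mu>\<bar> \<le> 19" using \<mu>_bounds(3,4) by simp
  have g: "\<bar>dx v (x0, y)\<bar> \<le> 1216 * M" "\<bar>dy v (x0, y)\<bar> \<le> 1216 * M"
    if v: "sol \<mu> v U" and y: "\<bar>y - y0\<bar> \<le> c" and M: "\<And>s t. \<bar>s - x0\<bar> \<le> L / 50000 \<Longrightarrow> 1/16 \<le> t \<Longrightarrow> t \<le> 15/16 \<Longrightarrow> \<bar>v (s, t)\<bar> \<le> M" for v y M
  proof -
    have M': "\<bar>v q\<bar> \<le> M" if "q \<in> {x0-r..x0+r} \<times> {y-r..y+r}" for q
      using M sq[OF _ y, of "fst q" "snd q"] that by (metis prod.collapse)
    have M0: "M \<ge> 0" using M'[of "(x0, y)"] by (force simp: r_def)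
    have "(2 + \<bar>\<mu>\<bar>) * M / r \<le> 19 * M / r" using \<mu>2 M0 by (intro divide_right_mono mult_right_mono) (auto simp: r_def)
    then have "(2 + \<bar>\<mu>\<bar>) * M / r \<le> 1216 * M" by (simp add: r_def)
    moreover have "\<bar>dx v (x0, y)\<bar> \<le> (2 + \<bar>\<mu>\<bar>) * M / r"
      by (rule sol_grad_bound(1)[OF v _ _ sub[OF y] M']) (auto simp: r_def)
    moreover have "\<bar>dy v (x0, y)\<bar> \<le> (2 + \<bar>\<mu>\<bar>) * M / r"
      by (rule sol_grad_bound(2)[OF v _ _ sub[OF y] M']) (auto simp: r_def)
    ultimately show "\<bar>dx v (x0, y)\<bar> \<le> 1216 * M" "\<bar>dy v (x0, y)\<bar> \<le> 1216 * M" by linarith+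
  qed
  have h: "\<bar>dy (dy v) (x0, y)\<bar> \<le> 11829248 * M"
    if v: "sol \<mu> v U" and y: "\<bar>y - y0\<bar> \<le> c" and M: "\<And>s t. \<bar>s - x0\<bar> \<le> L / 50000 \<Longrightarrow> 1/16 \<le> t \<Longrightarrow> t \<le> 15/16 \<Longrightarrow> \<bar>v (s, t)\<bar> \<le> M" for v y M
  proof -
    have M': "\<bar>v q\<bar> \<le> M" if "q \<in> {x0-r..x0+r} \<times> {y-r..y+r}" for q
      using M sq[OF _ y, of "fst q" "snd q"] that by (metis prod.collapse)
    have M0: "M \<ge> 0" using M'[of "(x0, y)"] by (force simp: r_def)
    have "8 * (2 + \<bar>\<mu>\<bar>)\<^sup>2 * M / r\<^sup>2 \<le> 8 * 19\<^sup>2 * M / r\<^sup>2"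
      using \<mu>2 M0 by (intro divide_right_mono mult_right_mono mult_left_mono power_mono) auto
    then have "8 * (2 + \<bar>\<mu>\<bar>)\<^sup>2 * M / r\<^sup>2 \<le> 11829248 * M" by (simp add: r_def power2_eq_square)
    moreover have "\<bar>dy (dy v) (x0, y)\<bar> \<le> 8 * (2 + \<bar>\<mu>\<bar>)\<^sup>2 * M / r\<^sup>2"
      by (rule sol_hess_bound(4)[OF v _ _ sub[OF y] M']) (auto simp: r_def)
    ultimately show ?thesis by linarith
  qed
  note s1 = sol_dx_sol[OF sol] note s11 = sol_dx_sol[OF s1] note s2 = sol_dy_sol[OF sol]
  have b1: "\<bar>dx w (s, t)\<bar> \<le> 2 * 10^11 / L" "\<bar>dx (dx w) (s, t)\<bar> \<le> 10^15 / L\<^sup>2" "\<bar>dy w (s, t)\<bar> \<le> 1200"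
    if "\<bar>s - x0\<bar> \<le> L / 50000" "1/16 \<le> t" "t \<le> 15/16" for s t
  proof -
    have "\<bar>s - x0\<bar> \<le> L / 8000" "\<bar>s - x0\<bar> \<le> L / 4000" using that(1) L_pos by linarith+
    then show "\<bar>dx w (s, t)\<bar> \<le> 2 * 10^11 / L" "\<bar>dx (dx w) (s, t)\<bar> \<le> 10^15 / L\<^sup>2" "\<bar>dy w (s, t)\<bar> \<le> 1200"
      using dx_w[OF _ that(2,3)] dxx_w[OF _ that(2,3)] gradient(2)[OF in_U[OF that]] by blast+
  qed
  have yc: "\<bar>y0 - y0\<bar> \<le> c" by (simp add: c_def)
  have "\<bar>w (x, y) - P2 w x0 y0 x y\<bar> \<le> (4 * 10^31 + 1 / c ^ 3 + 2 * 10^31 / c) * max (1 / L ^ 3 * \<bar>x - x0\<bar> ^ 3) (\<bar>y - y0\<bar> ^ 3)"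
  proof (rule scaled_taylor[OF sol L_pos])
    show "0 < c" "c \<le> 1" unfolding c_def by auto
    have near: "\<bar>s - x0\<bar> \<le> L / 50000 \<and> 1/16 \<le> t \<and> t \<le> 15/16" if "\<bar>s - x0\<bar> \<le> c * L" "\<bar>t - y0\<bar> \<le> c" for s t
      using that y0 unfolding c_def by linarith
    show "{x0 - c * L..x0 + c * L} \<times> {y0 - c..y0 + c} \<subseteq> U"
    proof
      fix p assume "p \<in> {x0 - c * L..x0 + c * L} \<times> {y0 - c..y0 + c}"
      then obtain s t where st: "p = (s, t)" "x0 - c * L \<le> s" "s \<le> x0 + c * L" "y0 - c \<le> t" "t \<le> y0 + c" by auto
      then have "\<bar>s - x0\<bar> \<le> c * L" "\<bar>t - y0\<bar> \<le> c" by linarith+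
      then show "p \<in> U" using near[of s t] in_U[of s t] st(1) by blast
    qed
    show "\<bar>dx (dx (dx w)) (s, t)\<bar> \<le> 10^31 / L ^ 3" if "\<bar>s - x0\<bar> \<le> c * L" "\<bar>t - y0\<bar> \<le> c" for s t
      using xxx near[OF that] by blast
    have L1: "L \<ge> 1" using L by simp
    fix t assume t: "\<bar>t - y0\<bar> \<le> c"
    have "\<bar>dy (dx (dx w)) (x0, t)\<bar> \<le> 1216 * (10^15 / L\<^sup>2)" by (rule g(2)[OF s11 t b1(2)])
    also have "\<dots> \<le> 10^31 / L\<^sup>2" by (simp add: divide_right_mono)
    finally show "\<bar>dy (dx (dx w)) (x0, t)\<bar> \<le> 10^31 / L\<^sup>2" .
    have "\<bar>dy (dy (dx w)) (x0, t)\<bar> \<le> 11829248 * (2 * 10^11 / L)" by (rule h[OF s1 t b1(1)])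
    also have "\<dots> \<le> 10^31 / L" using L_pos by (simp add: divide_right_mono)
    finally show "\<bar>dy (dy (dx w)) (x0, t)\<bar> \<le> 10^31 / L" .
    have "\<bar>dy (dy (dy w)) (x0, t)\<bar> \<le> 11829248 * 1200" by (rule h[OF s2 t b1(3)])
    then show "\<bar>dy (dy (dy w)) (x0, t)\<bar> \<le> 10^31" by simp
  next
    have "\<bar>dx (dx w) (x0, y0)\<bar> \<le> 10^15 / L\<^sup>2" by (rule b1(2)) (use y0 L_pos in auto)
    also have "\<dots> \<le> 10^31 / L\<^sup>2" by (simp add: divide_right_mono)
    finally show "\<bar>dx (dx w) (x0, y0)\<bar> \<le> 10^31 / L\<^sup>2" .
    have "\<bar>dy (dx w) (x0, y0)\<bar> \<le> 1216 * (2 * 10^11 / L)" by (rule g(2)[OF s1 yc b1(1)])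
    also have "\<dots> \<le> 10^31 / L" using L_pos by (simp add: divide_right_mono)
    finally show "\<bar>dy (dx w) (x0, y0)\<bar> \<le> 10^31 / L" .
    have "\<bar>dy (dy w) (x0, y0)\<bar> \<le> 1216 * 1200" by (rule g(2)[OF s2 yc b1(3)])
    then show "\<bar>dy (dy w) (x0, y0)\<bar> \<le> 10^31" by simp
  qed (use max max_point[OF max] nonneg le_1 in auto)
  also have "\<dots> \<le> 10^60 * max (1 / L ^ 3 * \<bar>x - x0\<bar> ^ 3) (\<bar>y - y0\<bar> ^ 3)"
    using L_pos by (intro mult_right_mono) (auto simp: c_def le_max_iff_disj power_divide)
  finally show ?thesis .
qed

end

section \<open>Normalised domains\<close>

lemma sol_cong:
  assumes s: "sol \<mu> u U" and eq: "\<And>p. p \<in> U \<Longrightarrow> u p = w p"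
  shows "sol \<mu> w U"
proof -
  have U: "open U" using s sol_Ck by blast
  have d: "dx u p = dx w p" "dy u p = dy w p" if "p \<in> U" for p
    by (rule dx_cong[OF U that eq] dy_cong[OF U that eq]; assumption)+
  have "laplacian w p = laplacian u p" if "p \<in> U" for p
    unfolding laplacian_def using dx_cong[OF U that d(1)] dy_cong[OF U that d(2)] by simp
  then show ?thesis using s Ck_on_cong[OF U _ eq] eq unfolding sol_def by simp
qed

lemma P2_cong:
  assumes U: "open U" and p: "(x0, y0) \<in> U" and eq: "\<And>p. p \<in> U \<Longrightarrow> u p = w p"
  shows "P2 u x0 y0 x y = P2 w x0 y0 x y"
proof -
  have d: "dx u p = dx w p" "dy u p = dy w p" if "p \<in> U" for p
    by (rule dx_cong[OF U that eq] dy_cong[OF U that eq]; assumption)+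
  show ?thesis unfolding P2_def
    using dx_cong[OF U p d(1)] dx_cong[OF U p d(2)] dy_cong[OF U p d(2)] by simp
qed

text \<open>A convex function with values in [0, M] cannot rise by more than \<open>M\<close> up to
  the end of the larger interval, at distance at least \<open>r\<close>; convexity bounds earlier
  slopes by this one.\<close>

lemma convex_slope_le:
  fixes f :: "real \<Rightarrow> real"
  assumes f: "convex_on {c - 2*r..c + 2*r} f" and r: "r > 0"
    and M: "\<And>x. \<bar>x - c\<bar> \<le> 2 * r \<Longrightarrow> 0 \<le> f x \<and> f x \<le> M"
    and x: "\<bar>x - c\<bar> \<le> r" "\<bar>x' - c\<bar> \<le> r"
  shows "\<bar>f x - f x'\<bar> \<le> M / r * \<bar>x - x'\<bar>"
proof -
  have one: "f s' - f s \<le> M / r * \<bar>s' - s\<bar>" if s: "\<bar>s - c\<bar> \<le> r" "\<bar>s' - c\<bar> \<le> r" for s s'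
  proof (cases "s = s'")
    case False
    \<comment> \<open>The end of the larger interval beyond s', seen from s.\<close>
    define z where "z = (if s < s' then c + 2 * r else c - 2 * r)"
    have zs: "\<bar>z - s\<bar> \<ge> r" "z \<noteq> s" "\<bar>z - c\<bar> \<le> 2 * r" unfolding z_def using s r by (auto simp: abs_le_iff)
    define t where "t = (s' - s) / (z - s)"
    have t: "0 \<le> t" "t \<le> 1" "s' = (1 - t) * s + t * z"
    proof -
      show "0 \<le> t" "t \<le> 1" unfolding t_def z_def using s r False
        by (auto simp: abs_le_iff zero_le_divide_iff divide_le_eq_1)
      have "t * (z - s) = s' - s" unfolding t_def using zs by simp
      then show "s' = (1 - t) * s + t * z" by (simp add: algebra_simps)
    qed
    have t_le: "t \<le> \<bar>s' - s\<bar> / r"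
    proof -
      have "t = \<bar>s' - s\<bar> / \<bar>z - s\<bar>" using t(1) unfolding t_def by (metis abs_divide abs_of_nonneg)
      also have "\<dots> \<le> \<bar>s' - s\<bar> / r" using zs r by (intro divide_left_mono) auto
      finally show ?thesis .
    qed
    have mem: "s \<in> {c - 2*r..c + 2*r}" "z \<in> {c - 2*r..c + 2*r}" using s zs r by (auto simp: abs_le_iff)
    have "f s' \<le> (1 - t) * f s + t * f z"
      using convex_onD[OF f t(1,2) mem] t(3) by simp
    then have "f s' - f s \<le> t * (f z - f s)" by (simp add: algebra_simps)
    also have "\<dots> \<le> t * M" using M[of z] M[of s] zs s r t(1) by (intro mult_left_mono) auto
    also have "\<dots> \<le> \<bar>s' - s\<bar> / r * M" using t_le M[of s] s r by (intro mult_right_mono) auto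
    finally show ?thesis by (simp add: mult.commute)
  qed simp
  from one[OF x] one[OF x(2,1)] show ?thesis by (simp add: abs_le_iff abs_minus_commute)
qed

lemma measure_le_interval:
  fixes S :: "real set"
  assumes "S \<subseteq> {c..d}" "c \<le> d" shows "measure lborel S \<le> d - c"
proof (cases "S \<in> sets lborel")
  case True
  have "measure lborel S \<le> measure lborel {c..d}"
    by (rule measure_mono_fmeasurable) (use assms True in \<open>auto simp: fmeasurable_def\<close>)
  then show ?thesis using assms by simp
next
  case False
  \<comment> \<open>A set that is not measurable has \<open>measure\<close> 0.\<close>
  then show ?thesis using assms measure_notin_sets[OF False] by simp
qed

locale normalised =
  fixes a b :: real and f\<^sub>1 f\<^sub>2 :: "real \<Rightarrow> real"
  assumes normalised: "normalised_domain a b f\<^sub>1 f\<^sub>2"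
begin

lemma ab: "a < b" and f1_convex: "convex_on {a..b} f\<^sub>1" and f2_concave: "concave_on {a..b} f\<^sub>2"
  and f12: "x \<in> {a..b} \<Longrightarrow> f\<^sub>1 x \<le> f\<^sub>2 x" and f1_nonneg: "x \<in> {a..b} \<Longrightarrow> 0 \<le> f\<^sub>1 x"
  and f2_le1: "x \<in> {a..b} \<Longrightarrow> f\<^sub>2 x \<le> 1"
  using normalised unfolding normalised_domain_def by auto

lemma f2_convex: "convex_on {a..b} (\<lambda>x. - f\<^sub>2 x)"
  using f2_concave unfolding concave_on_def .

lemma f1_D: "x \<in> {a..b} \<Longrightarrow> y \<in> {a..b} \<Longrightarrow> 0 \<le> t \<Longrightarrow> t \<le> 1 \<Longrightarrow> f\<^sub>1 ((1 - t) * x + t * y) \<le> (1 - t) * f\<^sub>1 x + t * f\<^sub>1 y"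
  using convex_onD[OF f1_convex, of t x y] by simp

lemma f2_D: "x \<in> {a..b} \<Longrightarrow> y \<in> {a..b} \<Longrightarrow> 0 \<le> t \<Longrightarrow> t \<le> 1 \<Longrightarrow> (1 - t) * f\<^sub>2 x + t * f\<^sub>2 y \<le> f\<^sub>2 ((1 - t) * x + t * y)"
  using convex_onD[OF f2_convex, of t x y] by simp

text \<open>The interior of the region in explicit form; \<open>interior_region\<close> proves
  this.\<close>

definition U :: "(real \<times> real) set" where
  "U = {(x, y). a < x \<and> x < b \<and> f\<^sub>1 x < y \<and> y < f\<^sub>2 x}"

lemma mem_U: "(x, y) \<in> U \<longleftrightarrow> a < x \<and> x < b \<and> f\<^sub>1 x < y \<and> y < f\<^sub>2 x"
  unfolding U_def by simp

lemma open_U: "open U"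
proof -
  have c1: "continuous_on {a<..<b} f\<^sub>1"
    by (rule convex_on_continuous) (auto intro!: convex_on_subset[OF f1_convex])
  have c2: "continuous_on {a<..<b} (\<lambda>x. - f\<^sub>2 x)"
    by (rule convex_on_continuous) (auto intro!: convex_on_subset[OF f2_convex])
  have c2': "continuous_on {a<..<b} f\<^sub>2" using continuous_on_minus[OF c2] by simp
  let ?A = "{a<..<b} \<times> (UNIV :: real set)"
  have "open (?A \<inter> (\<lambda>p. snd p - f\<^sub>1 (fst p)) -` {0<..})"
    by (intro continuous_open_preimage continuous_intros continuous_on_compose2[OF c1]) (auto intro: open_Times)
  moreover have "open (?A \<inter> (\<lambda>p. f\<^sub>2 (fst p) - snd p) -` {0<..})"
    by (intro continuous_open_preimage continuous_intros continuous_on_compose2[OF c2']) (auto intro: open_Times)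
  moreover have "U = (?A \<inter> (\<lambda>p. snd p - f\<^sub>1 (fst p)) -` {0<..}) \<inter> (?A \<inter> (\<lambda>p. f\<^sub>2 (fst p) - snd p) -` {0<..})"
    unfolding U_def by auto
  ultimately show ?thesis by (simp only: open_Int)
qed

lemma interior_region: "interior (region a b f\<^sub>1 f\<^sub>2) = U"
proof
  show "U \<subseteq> interior (region a b f\<^sub>1 f\<^sub>2)"
    by (rule interior_maximal[OF _ open_U]) (auto simp: U_def region_def)
  show "interior (region a b f\<^sub>1 f\<^sub>2) \<subseteq> U"
  proof
    fix p assume p: "p \<in> interior (region a b f\<^sub>1 f\<^sub>2)"
    obtain x y where xy: "p = (x, y)" by (cases p)
    obtain r where r: "r > 0" "{x-r..x+r} \<times> {y-r..y+r} \<subseteq> interior (region a b f\<^sub>1 f\<^sub>2)"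
      using open_contains_square[OF open_interior p[unfolded xy]] by blast
    then have R: "{x-r..x+r} \<times> {y-r..y+r} \<subseteq> region a b f\<^sub>1 f\<^sub>2" using interior_subset by blast
    have "(x - r, y) \<in> region a b f\<^sub>1 f\<^sub>2" "(x + r, y) \<in> region a b f\<^sub>1 f\<^sub>2"
      "(x, y - r) \<in> region a b f\<^sub>1 f\<^sub>2" "(x, y + r) \<in> region a b f\<^sub>1 f\<^sub>2"
      by (rule subsetD[OF R]; use r(1) in simp)+
    then show "p \<in> U" using r(1) unfolding region_def U_def xy by auto
  qed
qed

lemma convex_region: "convex (region a b f\<^sub>1 f\<^sub>2)"
proof (rule convexI)
  fix p q and u v :: real
  assume p: "p \<in> region a b f\<^sub>1 f\<^sub>2" and q: "q \<in> region a b f\<^sub>1 f\<^sub>2" and uv: "0 \<le> u" "0 \<le> v" "u + v = 1"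
  obtain x y x' y' where xy: "p = (x, y)" "q = (x', y')" by (cases p, cases q)
  have u: "u = 1 - v" using uv by simp
  have m: "x \<in> {a..b}" "f\<^sub>1 x \<le> y" "y \<le> f\<^sub>2 x" "x' \<in> {a..b}" "f\<^sub>1 x' \<le> y'" "y' \<le> f\<^sub>2 x'"
    using p q unfolding region_def xy by auto
  have "u * x + v * x' \<in> {a..b}"
    using convexD[OF convex_real_interval(5) m(1,4) uv] by simp
  moreover have "f\<^sub>1 (u * x + v * x') \<le> u * y + v * y'"
  proof -
    have "f\<^sub>1 (u * x + v * x') \<le> u * f\<^sub>1 x + v * f\<^sub>1 x'" using f1_D[OF m(1,4), of v] uv unfolding u by simp
    also have "\<dots> \<le> u * y + v * y'" using m uv by (intro add_mono mult_left_mono) auto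
    finally show ?thesis .
  qed
  moreover have "u * y + v * y' \<le> f\<^sub>2 (u * x + v * x')"
  proof -
    have "u * y + v * y' \<le> u * f\<^sub>2 x + v * f\<^sub>2 x'" using m uv by (intro add_mono mult_left_mono) auto
    also have "\<dots> \<le> f\<^sub>2 (u * x + v * x')" using f2_D[OF m(1,4), of v] uv unfolding u by simp
    finally show ?thesis .
  qed
  ultimately show "u *\<^sub>R p + v *\<^sub>R q \<in> region a b f\<^sub>1 f\<^sub>2" unfolding region_def xy by simp
qed

text \<open>By convexity the region contains the segment from a zero of \<open>f\<^sub>1\<close> to
  a point where \<open>f\<^sub>2\<close> equals 1, and this segment already projects onto
  [0, 1].\<close>

lemma projection_y: "projection_length (region a b f\<^sub>1 f\<^sub>2) (0, 1) = 1"
proof -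
  obtain xa where xa: "xa \<in> {a..b}" "f\<^sub>1 xa = 0" using normalised unfolding normalised_domain_def by blast
  obtain xb where xb: "xb \<in> {a..b}" "f\<^sub>2 xb = 1" using normalised unfolding normalised_domain_def by blast
  have "(\<lambda>p. p \<bullet> (0, 1::real)) ` region a b f\<^sub>1 f\<^sub>2 = {0..1}"
  proof
    show "(\<lambda>p. p \<bullet> (0, 1::real)) ` region a b f\<^sub>1 f\<^sub>2 \<subseteq> {0..1}"
      using f1_nonneg f2_le1 unfolding region_def by (force simp: inner_prod_def)
    show "{0..1} \<subseteq> (\<lambda>p. p \<bullet> (0, 1::real)) ` region a b f\<^sub>1 f\<^sub>2"
    proof
      fix t :: real assume t: "t \<in> {0..1}"
      have "(xa, 0::real) \<in> region a b f\<^sub>1 f\<^sub>2" "(xb, 1::real) \<in> region a b f\<^sub>1 f\<^sub>2"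
        using xa xb f12[OF xa(1)] f12[OF xb(1)] unfolding region_def by auto
      then have "(1 - t) *\<^sub>R (xa, 0::real) + t *\<^sub>R (xb, 1::real) \<in> region a b f\<^sub>1 f\<^sub>2"
        using t by (intro convexD[OF convex_region]) auto
      moreover have "((1 - t) *\<^sub>R (xa, 0::real) + t *\<^sub>R (xb, 1::real)) \<bullet> (0, 1::real) = t" by (simp add: inner_prod_def inner_real_def)
      ultimately show "t \<in> (\<lambda>p. p \<bullet> (0, 1::real)) ` region a b f\<^sub>1 f\<^sub>2" by (metis image_eqI)
    qed
  qed
  then show ?thesis unfolding projection_length_def by simp
qed

text \<open>The form in which the minimality of the projection onto the y-axis enters: no direction
  has width below 1.\<close>

lemma width_ge: assumes "norm v = 1" "(\<lambda>p. p \<bullet> v) ` region a b f\<^sub>1 f\<^sub>2 \<subseteq> {c..d}" "c \<le> d" shows "1 \<le> d - c"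
proof -
  have "projection_length (region a b f\<^sub>1 f\<^sub>2) (0, 1) \<le> projection_length (region a b f\<^sub>1 f\<^sub>2) v"
    using normalised assms(1) unfolding normalised_domain_def by blast
  also have "\<dots> \<le> d - c"
    unfolding projection_length_def by (rule measure_le_interval[OF assms(2,3)])
  finally show ?thesis using projection_y by simp
qed

lemma length_ge: "1 \<le> b - a"
  by (rule width_ge[of "(1, 0)"]) (use ab in \<open>auto simp: region_def norm_Pair inner_prod_def\<close>)

text \<open>Otherwise \<open>\<Omega>\<close> lies close to the chord of \<open>f\<^sub>1\<close> and is too thin in the direction normal to it.\<close>

lemma height_ge: "\<exists>x\<in>{a..b}. f\<^sub>2 x - f\<^sub>1 x > 1/4"
proof (rule ccontr)
  assume "\<not> ?thesis"
  then have small: "f\<^sub>2 x - f\<^sub>1 x \<le> 1/4" if "x \<in> {a..b}" for x using that by force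
  define \<sigma> where "\<sigma> = (f\<^sub>1 b - f\<^sub>1 a) / (b - a)"
  define N where "N = sqrt (1 + \<sigma>\<^sup>2)"
  have N: "N \<ge> 1" "N\<^sup>2 = 1 + \<sigma>\<^sup>2" unfolding N_def by (simp_all add: add_nonneg_nonneg)
  \<comment> \<open>The unit normal to the chord of \<open>f\<^sub>1\<close> over [a, b].\<close>
  define v where "v = (- \<sigma> / N, 1 / N)"
  have "norm v = sqrt ((\<sigma>\<^sup>2 + 1) / N\<^sup>2)" unfolding v_def norm_Pair by (simp add: power_divide add_divide_distrib)
  also have "(\<sigma>\<^sup>2 + 1) / N\<^sup>2 = 1"
  proof -
    have "N\<^sup>2 \<noteq> 0" using N(1) by simp
    then show ?thesis unfolding N(2) by (simp add: add.commute)
  qed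
  finally have nv: "norm v = 1" by simp
  define k where "k = f\<^sub>1 a - \<sigma> * a"
  have ineq: "\<bar>y - \<sigma> * x - k\<bar> \<le> 1/4" if "(x, y) \<in> region a b f\<^sub>1 f\<^sub>2" for x y
  proof -
    have m: "x \<in> {a..b}" "f\<^sub>1 x \<le> y" "y \<le> f\<^sub>2 x" using that unfolding region_def by auto
    define t where "t = (x - a) / (b - a)"
    have t: "0 \<le> t" "t \<le> 1" unfolding t_def using m(1) ab by (auto simp: divide_le_eq_1)
    have "t * (b - a) = x - a" unfolding t_def using ab by simp
    then have xt: "(1 - t) * a + t * b = x" by (simp add: algebra_simps)
    have e: "a \<in> {a..b}" "b \<in> {a..b}" using ab by auto
    have "\<sigma> * x + k = f\<^sub>1 a + \<sigma> * (x - a)" unfolding k_def by (simp add: algebra_simps)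
    also have "\<sigma> * (x - a) = t * (f\<^sub>1 b - f\<^sub>1 a)" unfolding \<sigma>_def t_def by simp
    also have "f\<^sub>1 a + t * (f\<^sub>1 b - f\<^sub>1 a) = (1 - t) * f\<^sub>1 a + t * f\<^sub>1 b" by (simp add: algebra_simps)
    finally have l: "\<sigma> * x + k = (1 - t) * f\<^sub>1 a + t * f\<^sub>1 b" .
    have "f\<^sub>1 x \<le> \<sigma> * x + k" using f1_D[OF e t] unfolding l xt .
    \<comment> \<open>The chord of \<open>f\<^sub>1\<close> lies below that of
      \<open>f\<^sub>2\<close>, hence below the concave \<open>f\<^sub>2\<close>. So the point and
      the chord share a section of length at most 1/4.\<close>
    moreover have "\<sigma> * x + k \<le> f\<^sub>2 x"
    proof -
      have "\<sigma> * x + k \<le> (1 - t) * f\<^sub>2 a + t * f\<^sub>2 b" unfolding l using f12[OF e(1)] f12[OF e(2)] t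
        by (intro add_mono mult_left_mono) auto
      then show ?thesis using f2_D[OF e t] unfolding xt by simp
    qed
    ultimately show ?thesis using small[OF m(1)] m(2,3) by linarith
  qed
  have "1 \<le> (k / N + 1/4) - (k / N - 1/4)"
  proof (rule width_ge[OF nv])
    show "(\<lambda>p. p \<bullet> v) ` region a b f\<^sub>1 f\<^sub>2 \<subseteq> {k / N - 1/4..k / N + 1/4}"
    proof
      fix s assume "s \<in> (\<lambda>p. p \<bullet> v) ` region a b f\<^sub>1 f\<^sub>2"
      then obtain x y where xy: "(x, y) \<in> region a b f\<^sub>1 f\<^sub>2" "s = (x, y) \<bullet> v" by auto
      have "s - k / N = (y - \<sigma> * x - k) / N" unfolding xy(2) v_def by (simp add: inner_prod_def diff_divide_distrib)
      then have "\<bar>s - k / N\<bar> = \<bar>y - \<sigma> * x - k\<bar> / N" using N by simp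
      also have "\<dots> \<le> \<bar>y - \<sigma> * x - k\<bar> / 1" using N by (intro divide_left_mono) auto
      finally have "\<bar>s - k / N\<bar> \<le> 1/4" using ineq[OF xy(1)] by simp
      then have "k / N - 1/4 \<le> s" "s \<le> k / N + 1/4" by linarith+
      then show "s \<in> {k / N - 1/4..k / N + 1/4}" by simp
    qed
  qed simp
  then show False by simp
qed

text \<open>Starting from a section of height above 1/4, a move by a fraction t \<le> 1/16 of the
  way to an end of the interval changes \<open>f\<^sub>1\<close> and \<open>f\<^sub>2\<close>
  unfavourably by at most t < 1/12. This bounds the eigenvalue by an absolute constant.\<close>

lemma small_rectangle:
  "\<exists>x1 x2 y1 y2. 1/64 \<le> x2 - x1 \<and> 1/12 \<le> y2 - y1 \<and> {x1..x2} \<times> {y1..y2} \<subseteq> U"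
proof -
  obtain c where c: "c \<in> {a..b}" "f\<^sub>2 c - f\<^sub>1 c > 1/4" using height_ge by blast
  \<comment> \<open>An end at distance at least 1/2, as b - a \<ge> 1. The fraction stays above 1/32
    because \<open>c\<close> itself may be an end of [a, b].\<close>
  define e where "e = (if b - c \<ge> 1/2 then b else a)"
  have e: "e \<in> {a..b}" "\<bar>e - c\<bar> \<ge> 1/2" unfolding e_def using ab c length_ge by auto
  define x1 where "x1 = min (c + (e - c) / 32) (c + (e - c) / 16)"
  define x2 where "x2 = max (c + (e - c) / 32) (c + (e - c) / 16)"
  have "x2 - x1 = \<bar>e - c\<bar> / 32"
    unfolding x1_def x2_def by (cases "e \<ge> c") (simp_all add: min_def max_def abs_if field_simps)
  then have "1/64 \<le> x2 - x1" using e(2) by simp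
  moreover have "{x1..x2} \<times> {f\<^sub>1 c + 1/12..f\<^sub>2 c - 1/12} \<subseteq> U"
  proof
    fix p assume p: "p \<in> {x1..x2} \<times> {f\<^sub>1 c + 1/12..f\<^sub>2 c - 1/12}"
    obtain x y where xy: "p = (x, y)" by (cases p)
    have x: "x1 \<le> x" "x \<le> x2" and y: "f\<^sub>1 c + 1/12 \<le> y" "y \<le> f\<^sub>2 c - 1/12" using p unfolding xy by auto
    define t where "t = (x - c) / (e - c)"
    have "t * (e - c) = x - c" unfolding t_def using e(2) by auto
    then have xt: "x = (1 - t) * c + t * e" by (simp add: algebra_simps)
    have t: "1/32 \<le> t" "t \<le> 1/16"
    proof -
      have "1/32 \<le> t \<and> t \<le> 1/16"
      proof (cases "e > c")
        case True
        then have "x1 = c + (e - c) / 32" "x2 = c + (e - c) / 16"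
          unfolding x1_def x2_def by (simp_all add: min_def max_def)
        then have "1/32 * (e - c) \<le> x - c" "x - c \<le> 1/16 * (e - c)" using x by linarith+
        then show ?thesis unfolding t_def using True
          by (simp only: pos_le_divide_eq[of "e - c"] pos_divide_le_eq[of "e - c"] diff_gt_0_iff_gt)
      next
        case False
        then have ec: "e < c" using e(2) by auto
        then have "x1 = c + (e - c) / 16" "x2 = c + (e - c) / 32"
          unfolding x1_def x2_def by (simp_all add: min_def max_def)
        then have "x - c \<le> 1/32 * (e - c)" "1/16 * (e - c) \<le> x - c" using x by linarith+
        then show ?thesis unfolding t_def using ec
          by (simp only: neg_le_divide_eq[of "e - c"] neg_divide_le_eq[of "e - c"] diff_less_0_iff_less)
      qed
      then show "1/32 \<le> t" "t \<le> 1/16" by auto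
    qed
    have t01: "0 \<le> t" "t \<le> 1" using t by auto
    have "f\<^sub>1 x \<le> (1 - t) * f\<^sub>1 c + t * f\<^sub>1 e" unfolding xt by (rule f1_D[OF c(1) e(1) t01])
    also have "\<dots> \<le> 1 * f\<^sub>1 c + t * 1"
      using t01 f1_nonneg[OF c(1)] f1_nonneg[OF e(1)] f12[OF e(1)] f2_le1[OF e(1)] by (intro add_mono mult_mono) auto
    finally have 1: "f\<^sub>1 x < y" using t y by linarith
    have "(1 - t) * f\<^sub>2 c + t * f\<^sub>2 e \<le> f\<^sub>2 x" unfolding xt by (rule f2_D[OF c(1) e(1) t01])
    moreover have "t * f\<^sub>2 e \<ge> 0" using t01 f12[OF e(1)] f1_nonneg[OF e(1)] by (intro mult_nonneg_nonneg) auto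
    moreover have "t * f\<^sub>2 c \<le> t * 1" using t01 f2_le1[OF c(1)] by (intro mult_left_mono) auto
    ultimately have "f\<^sub>2 c - t \<le> f\<^sub>2 x" by (simp add: algebra_simps)
    then have 2: "y < f\<^sub>2 x" using t y by linarith
    have tp: "0 < t" "t < 1" using t by auto
    have "a < x \<and> x < b"
    proof
      have "(1 - t) * (c - a) + t * (e - a) > 0"
        using tp c(1) e by (cases "c = a") (auto intro!: add_pos_nonneg add_nonneg_pos mult_pos_pos simp: e_def split: if_splits)
      then show "a < x" unfolding xt by (simp add: algebra_simps)
      have "(1 - t) * (b - c) + t * (b - e) > 0"
        using tp c(1) e by (cases "c = b") (auto intro!: add_pos_nonneg add_nonneg_pos mult_pos_pos simp: e_def split: if_splits)
      then show "x < b" unfolding xt by (simp add: algebra_simps)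
    qed
    then show "p \<in> U" using 1 2 unfolding xy mem_U by blast
  qed
  moreover have "1/12 \<le> (f\<^sub>2 c - 1/12) - (f\<^sub>1 c + 1/12)" using c(2) by simp
  ultimately show ?thesis by blast
qed

end

text \<open>The interval may lack its ends or reach \<open>a\<close> or \<open>b\<close>, where the
  boundary functions may jump. Giving up half of its length leaves a closed segment strictly inside
  (a, b).\<close>

lemma interval_contains_segment:
  fixes I :: "real set"
  assumes I: "is_interval I" "I \<subseteq> {a..b}" and L: "L > 0" "measure lborel I \<ge> L"
  shows "\<exists>p. {p..p + L / 2} \<subseteq> I \<and> a < p \<and> p + L / 2 < b"
proof -
  have "I \<noteq> {}" using L by auto
  have bdd: "bdd_below I" "bdd_above I" using I(2) by (auto intro: bdd_below_mono bdd_above_mono)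
  have "I \<subseteq> {Inf I..Sup I}" using bdd by (auto intro: cInf_lower cSup_upper)
  moreover have "Inf I \<le> Sup I" using cInf_le_cSup[OF \<open>I \<noteq> {}\<close> bdd(2,1)] .
  ultimately have len: "L \<le> Sup I - Inf I" using measure_le_interval[of I "Inf I" "Sup I"] L by linarith
  obtain s where s: "s \<in> I" "s < Inf I + L / 8"
    using cInf_lessD[OF \<open>I \<noteq> {}\<close>, of "Inf I + L / 8"] L by auto
  obtain t where t: "t \<in> I" "Sup I - L / 8 < t"
    using less_cSupD[OF \<open>I \<noteq> {}\<close>, of "Sup I - L / 8"] L by auto
  have st: "s + 3 / 4 * L < t" using s t len by linarith
  have "{s + L / 8..s + L / 8 + L / 2} \<subseteq> I"
  proof
    fix z assume "z \<in> {s + L / 8..s + L / 8 + L / 2}"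
    then have "s \<le> z" "z \<le> t" using st L by auto
    then show "z \<in> I" using I(1) s(1) t(1) unfolding is_interval_1 by blast
  qed
  moreover have "a \<le> s" "t \<le> b" using s t I(2) by auto
  ultimately show ?thesis using L st by (intro exI[of _ "s + L / 8"]) auto
qed

context normalised
begin

lemma ground_state_U:
  assumes u: "normalised_first_eigenfunction (region a b f\<^sub>1 f\<^sub>2) \<mu> u (x0, y0)"
  defines "w \<equiv> \<lambda>p. if p \<in> U then u p else 0"
  shows "ground_state U w \<mu>" "w (x0, y0) = 1"
proof -
  let ?\<Omega> = "region a b f\<^sub>1 f\<^sub>2"
  have e: "continuous_on (closure ?\<Omega>) u" "Ck_on 2 u U" "\<And>p. p \<in> U \<Longrightarrow> laplacian u p = - \<mu> * u p"
    "\<And>p. p \<in> frontier ?\<Omega> \<Longrightarrow> u p = 0" "\<And>p. p \<in> U \<Longrightarrow> u p > 0" "\<And>p. p \<in> ?\<Omega> \<Longrightarrow> u p \<le> 1"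
    "(x0, y0) \<in> ?\<Omega>" "u (x0, y0) = 1"
    using u unfolding normalised_first_eigenfunction_def dirichlet_eigenfunction_def interior_region by blast+
  have fr: "frontier ?\<Omega> = closure ?\<Omega> - U" unfolding frontier_def interior_region ..
  have "(x0, y0) \<in> closure ?\<Omega>" using e(7) closure_subset by blast
  \<comment> \<open>The value 1 cannot be taken on the frontier, where \<open>u\<close>
    vanishes.\<close>
  then have p0: "(x0, y0) \<in> U" using e(4)[of "(x0, y0)"] e(8) fr by force
  then show "w (x0, y0) = 1" unfolding w_def using e(8) by simp
  have U\<Omega>: "U \<subseteq> ?\<Omega>" unfolding interior_region[symmetric] by (rule interior_subset)
  show "ground_state U w \<mu>"
  proof
    show "open U" by (rule open_U)
    show "convex U" unfolding interior_region[symmetric] by (rule convex_interior[OF convex_region])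
    have "U \<subseteq> {a..b} \<times> {0..1}"
      using U\<Omega> f1_nonneg f2_le1 unfolding region_def by force
    then show "bounded U" by (rule bounded_subset[rotated]) (intro bounded_Times bounded_closed_interval)
    show "U \<noteq> {}" using p0 by blast
    show "0 < y \<and> y < 1" if "(x, y) \<in> U" for x y
      using that f1_nonneg[of x] f2_le1[of x] unfolding mem_U by auto
    \<comment> \<open>Two closed sets are glued; their intersection is the frontier, where both
      pieces are 0.\<close>
    have c: "continuous_on (closure ?\<Omega> \<union> - U) (\<lambda>p. if p \<in> closure ?\<Omega> then u p else 0)"
      by (rule continuous_on_cases) (use e(1,4) fr open_U in \<open>auto simp: closed_Compl\<close>)
    have UN: "closure ?\<Omega> \<union> - U = UNIV" using U\<Omega> closure_subset by blast
    have weq: "(\<lambda>p. if p \<in> closure ?\<Omega> then u p else 0) = w"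
      unfolding w_def using e(4) fr U\<Omega> closure_subset[of ?\<Omega>] by (auto simp: fun_eq_iff)
    show "continuous_on UNIV w" using c unfolding UN weq .
    have "sol \<mu> u U" unfolding sol_def using open_U e(2,3) by blast
    then show "sol \<mu> w U" by (rule sol_cong) (simp add: w_def)
  qed (use e(5,6) U\<Omega> in \<open>auto simp: w_def\<close>)
qed

text \<open>The rectangle of sides 1/64 and 1/12 gives \<mu> \<le> (64^2 + 12^2) \<pi>^2 = 4240
  \<pi>^2, whatever the length of the domain.\<close>

lemma taylor_small_L:
  assumes g: "ground_state U w \<mu>" and max: "w (x0, y0) = 1"
  shows "\<bar>w (x, y) - P2 w x0 y0 x y\<bar> \<le> 10^60 * max (\<bar>x - x0\<bar> ^ 3) (\<bar>y - y0\<bar> ^ 3)"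
proof (rule ground_state.taylor_short[OF g _ max])
  obtain x1 x2 y1 y2 where R: "1/64 \<le> x2 - x1" "1/12 \<le> y2 - y1" "{x1..x2} \<times> {y1..y2} \<subseteq> U"
    using small_rectangle by blast
  have "\<mu> \<le> (pi / (x2 - x1))\<^sup>2 + (pi / (y2 - y1))\<^sup>2"
    by (rule ground_state.mu_le_rectangle[OF g _ _ R(3)]) (use R in auto)
  also have "\<dots> \<le> (pi / (1/64))\<^sup>2 + (pi / (1/12))\<^sup>2"
    using R by (intro add_mono power_mono divide_left_mono) auto
  also have "\<dots> = 4240 * pi\<^sup>2" by (simp add: power_mult_distrib)
  also have "\<dots> \<le> 100000" using pi_sq_gt_9 by simp
  finally show "\<mu> \<le> 100000" .
qed

text \<open>The length scale supplies a long rectangle and thereby the upper bound for \<mu>; the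
  location of the maximum supplies the box around it; convexity turns the depth of the walls over
  the box into their slope. Both walls are then treated by \<open>dx_w_wall\<close>.\<close>

lemma taylor_large_L:
  assumes g: "ground_state U w \<mu>" and max: "w (x0, y0) = 1"
    and L: "L \<ge> 10^6" and adm: "admissible_length a b (\<lambda>x. f\<^sub>2 x - f\<^sub>1 x) L"
  shows "\<bar>w (x, y) - P2 w x0 y0 x y\<bar> \<le> 10^60 * max (1 / L ^ 3 * \<bar>x - x0\<bar> ^ 3) (\<bar>y - y0\<bar> ^ 3)"
proof -
  interpret ground_state U w \<mu> by (rule g)
  have L2: "L\<^sup>2 \<ge> 10^12" using power_mono[OF L, of 2] by simp
  then have L0: "L > 0" "L\<^sup>2 > 0" using L by auto
  define h where "h = 1 / L\<^sup>2"
  have h: "0 < h" "h \<le> 1 / 10^12" unfolding h_def using L2 L0 by (auto simp: field_simps)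
  obtain I where I: "is_interval I" "I \<subseteq> {a..b}" "measure lborel I \<ge> L" "\<And>x. x \<in> I \<Longrightarrow> f\<^sub>2 x - f\<^sub>1 x \<ge> 1 - h"
    using adm unfolding admissible_length_def h_def by blast
  obtain p where p: "{p..p + L / 2} \<subseteq> I" "a < p" "p + L / 2 < b"
    using interval_contains_segment[OF I(1,2) L0(1) I(3)] by blast
  have onI: "f\<^sub>1 x \<le> h" "1 - h \<le> f\<^sub>2 x" if "x \<in> {p..p + L / 2}" for x
    using I(4)[of x] that p I(2) f1_nonneg[of x] f2_le1[of x] by fastforce+
  have "{p..p + L / 2} \<times> {2 * h..1 - 2 * h} \<subseteq> U"
  proof
    fix q assume "q \<in> {p..p + L / 2} \<times> {2 * h..1 - 2 * h}"
    then obtain s t where st: "q = (s, t)" "s \<in> {p..p + L / 2}" "2 * h \<le> t" "t \<le> 1 - 2 * h" by auto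
    then show "q \<in> U" using onI[OF st(2)] p h unfolding st(1) mem_U by auto
  qed
  \<comment> \<open>Origin of 320: the length L/2 contributes 4 \<pi>^2 h, the height 1 - 4h at most
    16 \<pi>^2 h beyond \<pi>^2, and 20 \<pi>^2 < 320.\<close>
  then have "\<mu> \<le> (pi / (p + L / 2 - p))\<^sup>2 + (pi / (1 - 2 * h - 2 * h))\<^sup>2"
    by (rule mu_le_rectangle[rotated 2]) (use L0 h in auto)
  also have "(pi / (p + L / 2 - p))\<^sup>2 = pi\<^sup>2 * (4 * h)" unfolding h_def using L0 by (simp add: power_divide)
  also have "(pi / (1 - 2 * h - 2 * h))\<^sup>2 \<le> pi\<^sup>2 * (1 + 16 * h)"
  proof -
    have "1 \<le> (1 + 16 * h) * (1 - 4 * h)\<^sup>2"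
    proof -
      have "h * h \<le> 1/100 * h" using h by (intro mult_right_mono) auto
      moreover have "h * h * h \<ge> 0" using h by simp
      moreover have "(1 + 16 * h) * (1 - 4 * h)\<^sup>2 = 1 + 8 * h - 112 * (h * h) + 256 * (h * h * h)"
        by (simp add: power2_eq_square algebra_simps)
      ultimately show ?thesis using h(1) by linarith
    qed
    moreover have "(1 - 4 * h)\<^sup>2 > 0" using h by simp
    ultimately have "1 / (1 - 4 * h)\<^sup>2 \<le> 1 + 16 * h" by (simp add: divide_le_eq)
    from mult_left_mono[OF this, of "pi\<^sup>2"] show ?thesis by (simp add: power_divide)
  qed
  also have "pi\<^sup>2 * (4 * h) + pi\<^sup>2 * (1 + 16 * h) = pi\<^sup>2 + pi\<^sup>2 * (20 * h)" by (simp add: algebra_simps)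
  also have "\<dots> \<le> pi\<^sup>2 + 16 * (20 * h)"
    using pi_sq_gt_9 h by (intro add_mono mult_right_mono) auto
  finally have \<mu>: "\<mu> \<le> pi\<^sup>2 + 320 / L\<^sup>2" unfolding h_def by simp
  define k where "k = 12000000 / L\<^sup>2"
  have k12: "k = 12000000 * h" unfolding k_def h_def by simp
  have k: "h < k" "0 < k" "k \<le> 1/1000" unfolding k12 using h by auto
  have right: "x0 < z - L / 2000" if "0 \<le> \<alpha>" "\<beta> \<le> 1" "\<beta> - \<alpha> = 1 - k"
    "\<And>x y. (x, y) \<in> U \<Longrightarrow> z \<le> x \<Longrightarrow> \<alpha> < y \<and> y < \<beta>" for \<alpha> \<beta> z
    by (rule max_point_left_of[OF L \<mu> that(1,2) _ _ max]) (use that in \<open>auto simp: k_def\<close>)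
  have left: "z + L / 2000 < x0" if "0 \<le> \<alpha>" "\<beta> \<le> 1" "\<beta> - \<alpha> = 1 - k"
    "\<And>x y. (x, y) \<in> U \<Longrightarrow> x \<le> z \<Longrightarrow> \<alpha> < y \<and> y < \<beta>" for \<alpha> \<beta> z
    by (rule max_point_right_of[OF g L \<mu> that(1,2) _ _ max]) (use that in \<open>auto simp: k_def\<close>)
  have pI: "p \<in> {a..b}" "f\<^sub>1 p \<le> h" "1 - h \<le> f\<^sub>2 p" using onI[of p] p L0 by auto
  \<comment> \<open>Once the convex \<open>f\<^sub>1\<close> exceeds its value at \<open>p\<close>,
    it keeps increasing away from \<open>p\<close>. So if the domain is too thin at
    \<open>z\<close>, it stays within a narrower strip from there on, as the lemmas on the maximum
    require.\<close>
  have mono1: "f\<^sub>1 z \<le> f\<^sub>1 x" if z: "z \<in> {a..b}" "f\<^sub>1 p < f\<^sub>1 z" and x: "x \<in> {a..b}" "p < z \<and> z \<le> x \<or> x \<le> z \<and> z < p" for x z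
  proof -
    define t where "t = (z - p) / (x - p)"
    have t: "0 < t" "t \<le> 1" unfolding t_def using x(2) by (auto simp: zero_less_divide_iff divide_le_eq_1)
    have "t * (x - p) = z - p" unfolding t_def using x(2) by auto
    then have zt: "(1 - t) * p + t * x = z" by (simp add: algebra_simps)
    have "f\<^sub>1 z \<le> (1 - t) * f\<^sub>1 p + t * f\<^sub>1 x" using f1_D[OF pI(1) x(1), of t] t unfolding zt by simp
    also have "\<dots> \<le> (1 - t) * f\<^sub>1 z + t * f\<^sub>1 x" using z t by (intro add_mono mult_left_mono) auto
    finally have "t * f\<^sub>1 z \<le> t * f\<^sub>1 x" by (simp add: algebra_simps)
    then show ?thesis using t by simp
  qed
  have mono2: "f\<^sub>2 x \<le> f\<^sub>2 z" if z: "z \<in> {a..b}" "f\<^sub>2 z < f\<^sub>2 p" and x: "x \<in> {a..b}" "p < z \<and> z \<le> x \<or> x \<le> z \<and> z < p" for x z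
  proof -
    define t where "t = (z - p) / (x - p)"
    have t: "0 < t" "t \<le> 1" unfolding t_def using x(2) by (auto simp: zero_less_divide_iff divide_le_eq_1)
    have "t * (x - p) = z - p" unfolding t_def using x(2) by auto
    then have zt: "(1 - t) * p + t * x = z" by (simp add: algebra_simps)
    have "(1 - t) * f\<^sub>2 z + t * f\<^sub>2 x \<le> (1 - t) * f\<^sub>2 p + t * f\<^sub>2 x" using z t by (intro add_mono mult_left_mono) auto
    also have "\<dots> \<le> f\<^sub>2 z" using f2_D[OF pI(1) x(1), of t] t unfolding zt by simp
    finally have "t * f\<^sub>2 x \<le> t * f\<^sub>2 z" by (simp add: algebra_simps)
    then show ?thesis using t by simp
  qed
  have near: "a < z \<and> z < b \<and> f\<^sub>1 z \<le> k \<and> 1 - k \<le> f\<^sub>2 z" if z: "\<bar>z - x0\<bar> \<le> L / 2000" for z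
  proof -
    have zb: "z < b"
    proof (rule ccontr)
      assume "\<not> z < b"
      \<comment> \<open>No point of \<open>U\<close> has abscissa at least \<open>z\<close>, so the
        condition on the sections is vacuous.\<close>
      then have "x0 < z - L / 2000" by (intro right[of 0 "1 - k"]) (use k mem_U in auto)
      then show False using z by linarith
    qed
    have za: "a < z"
    proof (rule ccontr)
      assume "\<not> a < z"
      then have "z + L / 2000 < x0" by (intro left[of 0 "1 - k"]) (use k mem_U in auto)
      then show False using z by linarith
    qed
    have zab: "z \<in> {a..b}" using za zb by simp
    have "f\<^sub>1 z \<le> k"
    proof (rule ccontr)
      assume c: "\<not> f\<^sub>1 z \<le> k"
      then have f: "f\<^sub>1 p < f\<^sub>1 z" using pI k by simp
      then consider "p < z" | "z < p" by fastforce
      then show False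
      proof cases
        case 1
        have "x0 < z - L / 2000"
        proof (rule right[of k 1])
          fix x y assume "(x, y) \<in> U" "z \<le> x"
          then show "k < y \<and> y < 1" using mono1[OF zab f, of x] 1 c strip[of x y] unfolding mem_U by auto
        qed (use k in auto)
        then show False using z by linarith
      next
        case 2
        have "z + L / 2000 < x0"
        proof (rule left[of k 1])
          fix x y assume "(x, y) \<in> U" "x \<le> z"
          then show "k < y \<and> y < 1" using mono1[OF zab f, of x] 2 c strip[of x y] unfolding mem_U by auto
        qed (use k in auto)
        then show False using z by linarith
      qed
    qed
    moreover have "1 - k \<le> f\<^sub>2 z"
    proof (rule ccontr)
      assume c: "\<not> 1 - k \<le> f\<^sub>2 z"
      then have f: "f\<^sub>2 z < f\<^sub>2 p" using pI k by simp
      then consider "p < z" | "z < p" by fastforce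
      then show False
      proof cases
        case 1
        have "x0 < z - L / 2000"
        proof (rule right[of 0 "1 - k"])
          fix x y assume "(x, y) \<in> U" "z \<le> x"
          then show "0 < y \<and> y < 1 - k" using mono2[OF zab f, of x] 1 c strip[of x y] unfolding mem_U by auto
        qed (use k in auto)
        then show False using z by linarith
      next
        case 2
        have "z + L / 2000 < x0"
        proof (rule left[of 0 "1 - k"])
          fix x y assume "(x, y) \<in> U" "x \<le> z"
          then show "0 < y \<and> y < 1 - k" using mono2[OF zab f, of x] 2 c strip[of x y] unfolding mem_U by auto
        qed (use k in auto)
        then show False using z by linarith
      qed
    qed
    ultimately show ?thesis using za zb by blast
  qed
  interpret lb: long_box U w \<mu> L x0
  proof
    show "(s, t) \<in> U" if "\<bar>s - x0\<bar> \<le> L / 2000" "12000000 / L\<^sup>2 < t" "t < 1 - 12000000 / L\<^sup>2" for s t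
      using near[OF that(1)] that(2,3) unfolding mem_U k_def by linarith
  qed (use L \<mu> in auto)
  define r where "r = L / 4000"
  have r: "r > 0" unfolding r_def using L0 by simp
  have sub: "{x0 - 2*r..x0 + 2*r} \<subseteq> {a..b}"
  proof
    fix s assume "s \<in> {x0 - 2*r..x0 + 2*r}"
    then have "x0 - 2 * (L / 4000) \<le> s" "s \<le> x0 + 2 * (L / 4000)" unfolding r_def by auto
    then have "\<bar>s - x0\<bar> \<le> L / 2000" by linarith
    then show "s \<in> {a..b}" using near by fastforce
  qed
  \<comment> \<open>A depth O(L^-2) over a length of order L: this is the slope O(L^-3) of the
    walls.\<close>
  have kr: "k / r = 48000000000 / L ^ 3"
    unfolding k_def r_def using L0 by (simp add: power2_eq_square power3_eq_cube)
  have in_ab: "s \<in> {a..b}" "f\<^sub>1 s \<le> k" "1 - k \<le> f\<^sub>2 s" if "\<bar>s - x0\<bar> \<le> 2 * r" for s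
    using near[of s] that unfolding r_def by auto
  have slope1: "\<bar>f\<^sub>1 s - f\<^sub>1 t\<bar> \<le> 48000000000 / L ^ 3 * \<bar>s - t\<bar>" if "\<bar>s - x0\<bar> \<le> L / 4000" "\<bar>t - x0\<bar> \<le> L / 4000" for s t
    unfolding kr[symmetric]
    by (rule convex_slope_le[OF convex_on_subset[OF f1_convex sub] r])
      (use in_ab f1_nonneg that in \<open>auto simp: r_def\<close>)
  have slope2: "\<bar>(1 - f\<^sub>2 s) - (1 - f\<^sub>2 t)\<bar> \<le> 48000000000 / L ^ 3 * \<bar>s - t\<bar>" if "\<bar>s - x0\<bar> \<le> L / 4000" "\<bar>t - x0\<bar> \<le> L / 4000" for s t
    unfolding kr[symmetric]
  proof (rule convex_slope_le)
    have "convex_on {x0 - 2*r..x0 + 2*r} (\<lambda>x. 1 + - f\<^sub>2 x)"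
      by (intro convex_on_add convex_on_subset[OF f2_convex sub]) (auto simp: convex_on_def)
    then show "convex_on {x0 - 2*r..x0 + 2*r} (\<lambda>x. 1 - f\<^sub>2 x)" by simp
    show "0 \<le> 1 - f\<^sub>2 s \<and> 1 - f\<^sub>2 s \<le> k" if "\<bar>s - x0\<bar> \<le> 2 * r" for s
      using in_ab[OF that] f2_le1[of s] by auto
  qed (use r that in \<open>auto simp: r_def\<close>)
  have wall: "\<bar>dx w (s, t)\<bar> \<le> 10^18 / L ^ 3 + 10^13 * t / L"
    if "\<bar>s - x0\<bar> \<le> L / 20000" "lb.\<delta> \<le> t" "t < 1/8" for s t
  proof (rule lb.dx_w_wall[OF _ _ slope1 that])
    fix s t assume s: "\<bar>s - x0\<bar> \<le> L / 2000"
    show "f\<^sub>1 s < 1/8" using near[OF s] k by simp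
    show "(s, t) \<in> U \<longleftrightarrow> f\<^sub>1 s < t" if "t \<le> 1/8" using near[OF s] k that unfolding mem_U by auto
  qed
  \<comment> \<open>In the domain reflected in the midline, the upper wall becomes the lower wall,
    the graph of \<open>1 - f\<^sub>2\<close>.\<close>
  define V where "V = (\<lambda>p. (1 * fst p + 0, - 1 * snd p + 1)) -` U"
  define w' where "w' = (\<lambda>p. w (1 * fst p + 0, - 1 * snd p + 1))"
  have memV: "(s, t) \<in> V \<longleftrightarrow> (s, 1 - t) \<in> U" for s t unfolding V_def by simp
  have gV: "ground_state V w' \<mu>" unfolding V_def w'_def by (rule reflect_y[OF g])
  interpret lb': long_box V w' \<mu> L x0
  proof (rule long_box.intro[OF gV], unfold_locales)
    show "(s, t) \<in> V" if "\<bar>s - x0\<bar> \<le> L / 2000" "12000000 / L\<^sup>2 < t" "t < 1 - 12000000 / L\<^sup>2" for s t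
      unfolding memV by (rule lb.box) (use that in auto)
  qed (use L \<mu> in auto)
  have wall': "\<bar>dx w (s, 1 - t)\<bar> \<le> 10^18 / L ^ 3 + 10^13 * t / L"
    if "\<bar>s - x0\<bar> \<le> L / 20000" "lb.\<delta> \<le> t" "t < 1/8" for s t
  proof -
    have "\<bar>dx w' (s, t)\<bar> \<le> 10^18 / L ^ 3 + 10^13 * t / L"
    proof (rule lb'.dx_w_wall[OF _ _ slope2 that(1) _ that(3)])
      show "lb'.\<delta> \<le> t" using that(2) unfolding lb.\<delta>_def lb'.\<delta>_def .
      fix s t assume s: "\<bar>s - x0\<bar> \<le> L / 2000"
      show "1 - f\<^sub>2 s < 1/8" using near[OF s] k by simp
      show "(s, t) \<in> V \<longleftrightarrow> 1 - f\<^sub>2 s < t" if "t \<le> 1/8" using near[OF s] k that unfolding memV mem_U by auto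
    qed
    moreover have "dx w' (s, t) = dx w (s, 1 - t)" unfolding dx_def w'_def by simp
    ultimately show ?thesis by simp
  qed
  show ?thesis
    by (rule lb.taylor_long[OF max]) (rule lb.dxxx_w; use wall wall' in blast)
qed

end

theorem theorem1p3:
  "\<exists>C::real. C > 0 \<and>
     (\<forall>(a::real) (b::real) f\<^sub>1 f\<^sub>2 (L::real) (\<mu>::real) (u :: real \<times> real \<Rightarrow> real) (x\<^sub>0::real) (y\<^sub>0::real).
        normalised_domain a b f\<^sub>1 f\<^sub>2 \<longrightarrow>
        is_length_scale a b f\<^sub>1 f\<^sub>2 L \<longrightarrow>
        normalised_first_eigenfunction (region a b f\<^sub>1 f\<^sub>2) \<mu> u (x\<^sub>0, y\<^sub>0) \<longrightarrow>
        (\<forall>(x, y) \<in> superlevel (region a b f\<^sub>1 f\<^sub>2) u (1/2).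
           \<bar>u (x, y) - P2 u x\<^sub>0 y\<^sub>0 x y\<bar>
             \<le> C * max (1 / L ^ 3 * \<bar>x - x\<^sub>0\<bar> ^ 3) (\<bar>y - y\<^sub>0\<bar> ^ 3)))"
proof (intro exI[of _ "10^78"] conjI allI impI ballI, simp, clarify)
  fix a b :: real and f\<^sub>1 f\<^sub>2 :: "real \<Rightarrow> real" and L \<mu> :: real and u :: "real \<times> real \<Rightarrow> real" and x\<^sub>0 y\<^sub>0 x y :: real
  assume n: "normalised_domain a b f\<^sub>1 f\<^sub>2" and l: "is_length_scale a b f\<^sub>1 f\<^sub>2 L"
    and u: "normalised_first_eigenfunction (region a b f\<^sub>1 f\<^sub>2) \<mu> u (x\<^sub>0, y\<^sub>0)"
    and xy: "(x, y) \<in> superlevel (region a b f\<^sub>1 f\<^sub>2) u (1/2)"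
  interpret normalised a b f\<^sub>1 f\<^sub>2 by (rule normalised.intro[OF n])
  define w where "w = (\<lambda>p. if p \<in> U then u p else 0)"
  have g: "ground_state U w \<mu>" and max: "w (x\<^sub>0, y\<^sub>0) = 1"
    using ground_state_U[OF u] unfolding w_def by auto
  have p0: "(x\<^sub>0, y\<^sub>0) \<in> U" using max unfolding w_def by (simp split: if_splits)
  have P: "P2 u x\<^sub>0 y\<^sub>0 x y = P2 w x\<^sub>0 y\<^sub>0 x y"
    by (rule P2_cong[OF open_U p0]) (simp add: w_def)
  \<comment> \<open>The bound u \<ge> 1/2 excludes the frontier, so the point is interior, where
    \<open>u\<close> and \<open>w\<close> agree.\<close>
  have "(x, y) \<in> U"
  proof (rule ccontr)
    assume "(x, y) \<notin> U"
    moreover have "(x, y) \<in> closure (region a b f\<^sub>1 f\<^sub>2)"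
      using xy closure_subset[of "region a b f\<^sub>1 f\<^sub>2"] unfolding superlevel_def by auto
    ultimately have "(x, y) \<in> frontier (region a b f\<^sub>1 f\<^sub>2)" unfolding frontier_def interior_region by simp
    then have "u (x, y) = 0"
      using u unfolding normalised_first_eigenfunction_def dirichlet_eigenfunction_def by blast
    then show False using xy unfolding superlevel_def by simp
  qed
  then have uw: "u (x, y) = w (x, y)" unfolding w_def by simp
  have adm: "admissible_length a b (\<lambda>x. f\<^sub>2 x - f\<^sub>1 x) L" and L0: "L > 0"
    using l unfolding is_length_scale_def admissible_length_def by auto
  define m where "m = max (1 / L ^ 3 * \<bar>x - x\<^sub>0\<bar> ^ 3) (\<bar>y - y\<^sub>0\<bar> ^ 3)"
  have m0: "m \<ge> 0" unfolding m_def by (simp add: le_max_iff_disj)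
  have "\<bar>w (x, y) - P2 w x\<^sub>0 y\<^sub>0 x y\<bar> \<le> 10^78 * m"
  proof (cases "L \<ge> 10^6")
    case True
    have "\<bar>w (x, y) - P2 w x\<^sub>0 y\<^sub>0 x y\<bar> \<le> 10^60 * m"
      unfolding m_def by (rule taylor_large_L[OF g max True adm])
    also have "\<dots> \<le> 10^78 * m" using m0 by (intro mult_right_mono) auto
    finally show ?thesis .
  next
    case False
    \<comment> \<open>Below the threshold L^-3 is at least 10^-18, so the unscaled estimate costs
      only the factor 10^18 by which 10^78 exceeds 10^60.\<close>
    have L3: "L ^ 3 \<le> (10^6) ^ 3" using False L0 by (intro power_mono) auto
    have "\<bar>x - x\<^sub>0\<bar> ^ 3 = L ^ 3 * (1 / L ^ 3 * \<bar>x - x\<^sub>0\<bar> ^ 3)" using L0 by simp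
    also have "\<dots> \<le> (10^6) ^ 3 * m" using L3 L0 m0 unfolding m_def by (intro mult_mono) auto
    finally have 1: "\<bar>x - x\<^sub>0\<bar> ^ 3 \<le> 10^18 * m" by simp
    have "\<bar>y - y\<^sub>0\<bar> ^ 3 \<le> m" unfolding m_def by simp
    then have "\<bar>y - y\<^sub>0\<bar> ^ 3 \<le> 10^18 * m" using m0 by simp
    then have "max (\<bar>x - x\<^sub>0\<bar> ^ 3) (\<bar>y - y\<^sub>0\<bar> ^ 3) \<le> 10^18 * m" using 1 by simp
    then have "10^60 * max (\<bar>x - x\<^sub>0\<bar> ^ 3) (\<bar>y - y\<^sub>0\<bar> ^ 3) \<le> 10^60 * (10^18 * m)" by (intro mult_left_mono) auto
    moreover have "10^60 * (10^18 * m) = 10^78 * m" by simp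
    ultimately show ?thesis using taylor_small_L[OF g max, of x y] by linarith
  qed
  then show "\<bar>u (x, y) - P2 u x\<^sub>0 y\<^sub>0 x y\<bar> \<le> 10^78 * max (1 / L ^ 3 * \<bar>x - x\<^sub>0\<bar> ^ 3) (\<bar>y - y\<^sub>0\<bar> ^ 3)"
    unfolding P uw m_def .
qed

end
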